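(* Let $a,b,c,q\ge1$ and $d,e\ge0$ be integers. Let $\{x_i\}_{i=1}^\infty$ be a strictly increasing infinite sequence of positive integers which contains the arithmetic progression $\{a+bi\}_{i=e}^\infty$ as a subsequence. Let $(l_1,\dots,l_c)$ be positive integers with $l_1+\dots+l_c>d$. Let $f_1,\dots,f_c\in\mathcal{C}$ be distinct, multiplicative, and increasing on $\{p_i(b)\}_{i=1}^\infty$. Put $h=f_1^{(l_1)}*\dots*f_c^{(l_c)}*\mu^{(d)}$ and let $\lambda_n^{(1)}\le\dots\le\lambda_n^{(n)}$ be the eigenvalues of the $n\times n$ matrix $\big(h(\gcd(x_i,x_j))\big)_{1\le i,j\le n}$. Then: (i) if $h(p_i(b))=0$ for some $i\ge1$, then $\lambda_n^{(q)}=0$ for all sufficiently large $n$; (ii) if $h(p_i(b))\ne0$ for all $i\ge1$ and $\sum_{i=1}^\infty\frac1{f_1(p_i(b))+\dots+f_c(p_i(b))}=\infty$, then $\lim_{n\to\infty}\lambda_n^{(q)}=0$; (iii) in particular, if for each $1\le j\le c$ there is a constant $C_j>0$ with $f_j(p_i(b))\le C_jp_i(b)$ for all $i\ge1$, then $\lim_{n\to\infty}\lambda_n^{(q)}=0$.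
   Context: An arithmetical function is a complex-valued function on the positive integers; $*$ denotes Dirichlet convolution $(f*g)(m)=\sum_{e\mid m}f(e)g(m/e)$, and $\mu$ is the Möbius function. For an arithmetical function $f$, $f^{(0)}=\delta$ (where $\delta(1)=1$, $\delta(m)=0$ for $m>1$) and $f^{(c)}=f^{(c-1)}*f$ for $c\ge1$. For the sequence $\{x_i\}$, $\mathcal{C}$ is the class of arithmetical functions $f$ such that $(f*\mu)(d')\ge0$ (in particular is real) whenever $d'\mid x_i$ for some $i\ge1$. A function $f$ is multiplicative if $f(mn)=f(m)f(n)$ whenever $\gcd(m,n)=1$. $p_1(b)<p_2(b)<\cdots$ denote the primes in the arithmetic progression $\{1+bi\}_{i=0}^\infty$ in increasing order. $f$ is increasing on a sequence $\{y_i\}$ means $f(y_i)\le f(y_j)$ whenever $i<j$. *)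

theory Defs
  imports
    "HOL-Library.Complex_Order"
    "HOL-Library.Infinite_Set"
    "HOL-Library.Multiset"
    "HOL-Computational_Algebra.Computational_Algebra"
    "HOL-Number_Theory.Number_Theory"
    "Jordan_Normal_Form.Char_Poly"
begin

text \<open>
  Arithmetical functions are represented by functions of type \<^typ>\<open>nat \<Rightarrow> complex\<close>, of which
  only the values at positive arguments matter. The order on complex numbers is that of
  \<^theory>\<open>HOL-Library.Complex_Order\<close>: \<open>0 \<le> z\<close> means that \<open>z\<close> is real and nonnegative, and
  \<open>z \<le> w\<close> is the usual order when \<open>z\<close> and \<open>w\<close> are real.
\<close>

definition dconv :: "(nat \<Rightarrow> complex) \<Rightarrow> (nat \<Rightarrow> complex) \<Rightarrow> nat \<Rightarrow> complex" (infixr "\<star>" 70) where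
  "(f \<star> g) m = (\<Sum>e | e dvd m. f e * g (m div e))"

definition ddelta :: "nat \<Rightarrow> complex" where
  "ddelta m = (if m = 1 then 1 else 0)"

primrec dpow :: "(nat \<Rightarrow> complex) \<Rightarrow> nat \<Rightarrow> nat \<Rightarrow> complex" where
  "dpow f 0 = ddelta"
| "dpow f (Suc c) = dpow f c \<star> f"

definition moebius_mu :: "nat \<Rightarrow> complex" where
  "moebius_mu m = (if squarefree m then (-1) ^ card (prime_factors m) else 0)"

text \<open>The class \<open>\<C>\<close> of a sequence; all sequences are indexed from 1.\<close>

definition class_C :: "(nat \<Rightarrow> nat) \<Rightarrow> (nat \<Rightarrow> complex) set" where
  "class_C x = {f. \<forall>i\<ge>1. \<forall>m. m dvd x i \<longrightarrow> (f \<star> moebius_mu) m \<ge> 0}"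

text \<open>The value \<open>f 1 = 1\<close> is not demanded, so the zero function is multiplicative.\<close>

definition multiplicative_fun :: "(nat \<Rightarrow> complex) \<Rightarrow> bool" where
  "multiplicative_fun f \<longleftrightarrow> (\<forall>m\<ge>1. \<forall>n\<ge>1. coprime m n \<longrightarrow> f (m * n) = f m * f n)"

text \<open>The \<open>i\<close>-th prime, \<open>i \<ge> 1\<close>, in the arithmetic progression \<open>1, 1 + b, 1 + 2 b, \<dots>\<close>;
  \<^const>\<open>enumerate\<close> counts from 0.\<close>

definition ap_prime :: "nat \<Rightarrow> nat \<Rightarrow> nat" where
  "ap_prime b i = enumerate {p. prime p \<and> (\<exists>k. p = 1 + b * k)} (i - 1)"

definition increasing_on_seq :: "(nat \<Rightarrow> complex) \<Rightarrow> (nat \<Rightarrow> nat) \<Rightarrow> bool" where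
  "increasing_on_seq f y \<longleftrightarrow> (\<forall>i j. 1 \<le> i \<longrightarrow> i < j \<longrightarrow> f (y i) \<le> f (y j))"

text \<open>\<open>f\<^sub>1\<^bsup>(l\<^sub>1)\<^esup> * \<dots> * f\<^sub>c\<^bsup>(l\<^sub>c)\<^esup> * \<mu>\<^bsup>(d)\<^esup>\<close>\<close>

definition h_fun :: "nat \<Rightarrow> (nat \<Rightarrow> nat \<Rightarrow> complex) \<Rightarrow> (nat \<Rightarrow> nat) \<Rightarrow> nat \<Rightarrow> nat \<Rightarrow> complex" where
  "h_fun c f l d = foldr (\<lambda>j g. dpow (f j) (l j) \<star> g) [1..<Suc c] (dpow moebius_mu d)"

text \<open>Matrices have indices \<open>0, \<dots>, n - 1\<close>, whence the shift.\<close>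

definition gcd_mat :: "(nat \<Rightarrow> complex) \<Rightarrow> (nat \<Rightarrow> nat) \<Rightarrow> nat \<Rightarrow> complex mat" where
  "gcd_mat h x n = mat n n (\<lambda>(i, j). h (gcd (x (Suc i)) (x (Suc j))))"

text \<open>
  The \<open>k\<close>-th smallest eigenvalue, \<open>k \<ge> 1\<close>, counted with algebraic multiplicity, of a matrix all
  of whose eigenvalues are real. The lemma \<open>char_poly_nth_eigenvalue\<close> below shows that real
  symmetric matrices are of this kind and that taking real parts loses nothing for them.
  The matrices \<^term>\<open>gcd_mat h x n\<close> of interest are real and symmetric, because a function in
  \<^term>\<open>class_C x\<close> is real on the divisors of the \<open>x i\<close>.
\<close>

definition nth_eigenvalue :: "complex mat \<Rightarrow> nat \<Rightarrow> real" where
  "nth_eigenvalue A k = sorted_list_of_multiset (image_mset Re (proots (char_poly A))) ! (k - 1)"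

lemma real_symmetric_eigenvalue_real:
  fixes A :: "complex mat"
  assumes A: "A \<in> carrier_mat n n"
    and sym: "\<And>i j. i < n \<Longrightarrow> j < n \<Longrightarrow> A $$ (i, j) = A $$ (j, i)"
    and re: "\<And>i j. i < n \<Longrightarrow> j < n \<Longrightarrow> A $$ (i, j) \<in> \<real>"
    and k: "eigenvalue A k"
  shows "k \<in> \<real>"
proof -
  from k A obtain v where v: "v \<in> carrier_vec n" "v \<noteq> 0\<^sub>v n" and Av: "A *\<^sub>v v = k \<cdot>\<^sub>v v"
    by (auto simp: eigenvalue_def eigenvector_def)
  have row: "(\<Sum>j<n. A $$ (i, j) * v $ j) = k * v $ i" if "i < n" for i
  proof -
    have "(A *\<^sub>v v) $ i = (\<Sum>j<n. A $$ (i, j) * v $ j)"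
      using A v that by (auto simp: scalar_prod_def lessThan_atLeast0 intro!: sum.cong)
    then show ?thesis using Av v that by simp
  qed
  define S where "S = (\<Sum>i<n. \<Sum>j<n. A $$ (i, j) * v $ j * cnj (v $ i))"
  define N where "N = (\<Sum>i<n. (cmod (v $ i))\<^sup>2)"
  have "S = (\<Sum>i<n. k * v $ i * cnj (v $ i))"
    unfolding S_def by (intro sum.cong refl) (simp add: row flip: sum_distrib_right)
  then have S1: "S = k * of_real N"
    by (simp add: N_def sum_distrib_left mult.assoc complex_norm_square del: of_real_power)
  have "cnj S = (\<Sum>i<n. \<Sum>j<n. A $$ (j, i) * v $ i * cnj (v $ j))"
    unfolding S_def cnj_sum using re sym
    by (intro sum.cong refl) (auto simp: Reals_cnj_iff mult_ac)
  also have "\<dots> = S" unfolding S_def by (rule sum.swap)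
  finally have "S \<in> \<real>" by (simp add: Reals_cnj_iff)
  moreover have "N \<noteq> 0"
  proof
    assume "N = 0"
    then have "\<forall>i<n. v $ i = 0" by (auto simp: N_def sum_nonneg_eq_0_iff)
    with v show False by (auto intro: eq_vecI)
  qed
  then have "k = S / of_real N" using S1 by simp
  ultimately show ?thesis by simp
qed

lemma char_poly_nth_eigenvalue:
  fixes A :: "complex mat"
  assumes A: "A \<in> carrier_mat n n"
    and sym: "\<And>i j. i < n \<Longrightarrow> j < n \<Longrightarrow> A $$ (i, j) = A $$ (j, i)"
    and re: "\<And>i j. i < n \<Longrightarrow> j < n \<Longrightarrow> A $$ (i, j) \<in> \<real>"
  shows "char_poly A = (\<Prod>k=1..n. [:- complex_of_real (nth_eigenvalue A k), 1:])"
    and "\<And>j k. 1 \<le> j \<Longrightarrow> j \<le> k \<Longrightarrow> k \<le> n \<Longrightarrow> nth_eigenvalue A j \<le> nth_eigenvalue A k"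
proof -
  obtain as where as: "char_poly A = (\<Prod>a\<leftarrow>as. [:- a, 1:])" "length as = n"
    using char_poly_factorized[OF A] by blast
  have "proots (\<Prod>a\<leftarrow>as. [:- a, 1:]) = mset as"
  proof (induction as)
    case (Cons a as)
    have "(\<Prod>a\<leftarrow>as. [:- a, 1:]) \<noteq> 0" by (auto simp: prod_list_zero_iff)
    then have "proots ([:- a, 1:] * (\<Prod>a\<leftarrow>as. [:- a, 1:])) = {#a#} + mset as"
      by (subst proots_mult) (simp_all add: Cons.IH del: mult_pCons_left)
    then show ?case by (simp del: mult_pCons_left)
  qed simp
  then have pr: "proots (char_poly A) = mset as" using as by simp
  have real: "a \<in> \<real>" if "a \<in> set as" for a
  proof -
    have "poly (char_poly A) a = 0" using that as by (auto simp: poly_prod_list prod_list_zero_iff)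
    then have "eigenvalue A a" using eigenvalue_root_char_poly[OF A] by simp
    then show ?thesis using real_symmetric_eigenvalue_real[OF A sym re] by blast
  qed
  define L where "L = sorted_list_of_multiset (image_mset Re (mset as))"
  have mL: "mset L = image_mset Re (mset as)" by (simp add: L_def)
  have lenL: "length L = n" using arg_cong[OF mL, of size] as by simp
  have ev: "nth_eigenvalue A k = L ! (k - 1)" for k by (simp add: nth_eigenvalue_def pr L_def)
  have "image_mset (\<lambda>a. [:- a, 1:]) (mset as)
      = image_mset (\<lambda>r. [:- complex_of_real r, 1:]) (image_mset Re (mset as))"
    using real by (auto simp: multiset.map_comp o_def intro!: image_mset_cong)
  then have "mset (map (\<lambda>a. [:- a, 1:]) as) = mset (map (\<lambda>r. [:- complex_of_real r, 1:]) L)"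
    by (simp add: mL)
  then have "char_poly A = (\<Prod>r\<leftarrow>L. [:- complex_of_real r, 1:])"
    unfolding as by (metis prod_mset_prod_list)
  also have "\<dots> = (\<Prod>k<n. [:- complex_of_real (L ! k), 1:])"
    by (simp add: prod.list_conv_set_nth lenL lessThan_atLeast0)
  also have "\<dots> = (\<Prod>k=1..n. [:- complex_of_real (nth_eigenvalue A k), 1:])"
    by (rule prod.reindex_bij_witness[where i = "\<lambda>k. k - 1" and j = Suc]) (auto simp: ev)
  finally show "char_poly A = (\<Prod>k=1..n. [:- complex_of_real (nth_eigenvalue A k), 1:])" .
  show "nth_eigenvalue A j \<le> nth_eigenvalue A k" if "1 \<le> j" "j \<le> k" "k \<le> n" for j k
    using that lenL by (auto simp: ev L_def intro!: sorted_nth_mono)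
qed

end

theory Submission
  imports
    "HOL-Complex_Analysis.Complex_Analysis"
    "HOL-Real_Asymp.Real_Asymp"
    Defs
    "Jordan_Normal_Form.Schur_Decomposition"
begin

text \<open>
  If some \<open>f\<^sub>j\<close> vanishes at 1 it vanishes identically, and so does \<open>h\<close>. Otherwise pairing each \<open>\<mu>\<close> in
  \<open>h * \<mu>\<close> with one of the \<open>f\<^sub>j\<close> gives \<open>g = h * \<mu> \<ge> 0\<close> on all divisors of the \<open>x\<^sub>i\<close>. Hence the matrices are
  positive semidefinite, \<open>h(p) \<ge> h(1) = 1\<close> at the primes \<open>p \<equiv> 1\<close> modulo \<open>b\<close>, and by the min-max principle it
  suffices to find vectors with disjoint supports and small Rayleigh quotients. For a large prime \<open>P\<close> and a
  finite set \<open>T\<close> of larger primes, all \<open>\<equiv> 1\<close> modulo \<open>b\<close>, the numbers \<open>a P \<Prod>S\<close> with \<open>S \<subseteq> T\<close> occur in the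
  sequence, and on them the matrix is \<open>h(aP)\<close> times a Kronecker product of the 2 by 2 matrices with rows
  \<open>(1, 1)\<close> and \<open>(1, h(p))\<close>. The product of the vectors \<open>(1, -1 / h(p))\<close> has Rayleigh quotient at most
  \<open>h(aP) \<Prod>(1 - 1 / h(p))\<close>, which tends to 0 because \<open>\<Sum> 1 / h(p)\<close> diverges.

  In the third part the divergence comes from \<open>\<Sum> 1 / p = \<infinity>\<close> over the primes \<open>p \<equiv> 1\<close> modulo \<open>b\<close>. Let \<open>F\<close> be
  the product of the \<open>L\<close>-series of all characters modulo \<open>b\<close>, a Dirichlet series with nonnegative
  coefficients. Were the sum finite, \<open>F\<close> would be bounded near 1, so the zero of the other factors would
  cancel the pole of the principal one and \<open>F\<close> would continue to the disc of radius 2 around 2. By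
  Landau's argument its series would then converge on \<open>(0, 2)\<close>, but at \<open>1 / \<phi>(b)\<close> it dominates a
  harmonic series.
\<close>

unbundle no vec_syntax and no fps_syntax and no inner_syntax

section \<open>Dirichlet convolution\<close>

text \<open>Two obstacles shape the proof. Disjoint supports do not decouple the test vectors,
  because the matrix is far from diagonal; but its form is a sum of squares with weights
  \<open>g e\<close>, so Cauchy-Schwarz controls it on the span of q vectors at the cost of a factor
  q. And the class condition speaks only of divisors of the \<open>x i\<close>; it reaches every
  prime p congruent to 1 because \<open>a * p ^ k\<close> lies in the progression for large k. The
  prime P is fixed before T, so that \<open>h (a * P)\<close> is a constant which T can beat. For
  the divergence, no single L-series is shown to be nonzero at 1. The product over all characters is
  used as a whole: up to sign its logarithmic derivative has the coefficients
  \<open>totient b * mangoldt n\<close> on the class of 1. This positivity bounds the product at 1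
  by an exponential of the prime sum, and bounds its coefficients below by the indicator of the
  \<open>totient b\<close>-th powers of numbers coprime to b. At the exponent
  \<open>1 / totient b\<close> the powers of \<open>1 + b * k\<close> contribute
  \<open>1 / (1 + b * k)\<close> each.\<close>

lemma finite_factor_pairs: "m > 0 \<Longrightarrow> finite {(d, e). d * e = (m::nat)}"
  by (rule finite_subset[of _ "{..m} \<times> {..m}"]) (auto intro: Nat.gr0I)

text \<open>Every number divides 0, so the sum ranges over an infinite set and is 0 by default. Two
  convolutions therefore always agree at 0, and commutativity and associativity can be stated as
  equalities of functions.\<close>

lemma dconv_0: "(f \<star> g) 0 = 0"
  unfolding dconv_def by (simp add: infinite_UNIV_nat)

text \<open>Factor pairs put f and g on the same footing, so commutativity and associativity become
  reindexings.\<close>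

lemma dconv_pairs:
  assumes "m > 0"
  shows "(f \<star> g) m = (\<Sum>(d, e) | d * e = m. f d * g e)"
  unfolding dconv_def
  by (rule sum.reindex_bij_witness[where i = fst and j = "\<lambda>d. (d, m div d)"]) (use assms in auto)

lemma dconv_commute: "f \<star> g = g \<star> f"
proof
  fix m
  show "(f \<star> g) m = (g \<star> f) m"
  proof (cases "m = 0")
    case False
    then show ?thesis
      by (simp add: dconv_pairs)
         (rule sum.reindex_bij_witness[where i = prod.swap and j = prod.swap], auto)
  qed (simp add: dconv_0)
qed

lemma dconv_assoc: "(f \<star> g) \<star> h = f \<star> (g \<star> h)"
proof
  fix m
  show "((f \<star> g) \<star> h) m = (f \<star> (g \<star> h)) m"
  proof (cases "m = 0")
    case False
    then have m: "m > 0" by simp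
    have pos: "d > 0" "e > 0" if "d * e = m" for d e using that m by (auto intro: Nat.gr0I)
    have "((f \<star> g) \<star> h) m = (\<Sum>x | fst x * snd x = m. \<Sum>y | fst y * snd y = fst x. f (fst y) * g (snd y) * h (snd x))"
      unfolding dconv_pairs[OF m] case_prod_unfold using pos
      by (intro sum.cong refl) (simp add: dconv_pairs sum_distrib_right case_prod_unfold)
    also have "\<dots> = (\<Sum>(x, y) \<in> (SIGMA x:{x. fst x * snd x = m}. {y. fst y * snd y = fst x}).
        f (fst y) * g (snd y) * h (snd x))"
      using finite_factor_pairs m pos by (intro sum.Sigma) (auto simp: case_prod_unfold)
    also have "\<dots> = (\<Sum>(x, y) \<in> (SIGMA x:{x. fst x * snd x = m}. {y. fst y * snd y = snd x}).
        f (fst x) * (g (fst y) * h (snd y)))"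
      by (rule sum.reindex_bij_witness
          [where i = "\<lambda>((a, b), (c, d)). ((a * c, d), (a, c))" and j = "\<lambda>((a, b), (c, d)). ((c, d * b), (d, b))"])
         (auto simp: mult.assoc)
    also have "\<dots> = (\<Sum>x | fst x * snd x = m. \<Sum>y | fst y * snd y = snd x. f (fst x) * (g (fst y) * h (snd y)))"
      using finite_factor_pairs m pos by (intro sum.Sigma[symmetric]) (auto simp: case_prod_unfold)
    also have "\<dots> = (f \<star> (g \<star> h)) m"
      unfolding dconv_pairs[OF m] case_prod_unfold using pos
      by (intro sum.cong refl) (simp add: dconv_pairs sum_distrib_left case_prod_unfold)
    finally show ?thesis .
  qed (simp add: dconv_0)
qed

lemma dconv_left_commute: "f \<star> (g \<star> h) = g \<star> (f \<star> h)"
  by (metis dconv_assoc dconv_commute)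

lemmas dconv_ac = dconv_assoc dconv_commute dconv_left_commute

lemma dconv_cong:
  assumes "\<And>k. k dvd m \<Longrightarrow> k > 0 \<Longrightarrow> f k = f' k" "\<And>k. k dvd m \<Longrightarrow> k > 0 \<Longrightarrow> g k = g' k"
  shows "(f \<star> g) m = (f' \<star> g') m"
proof (cases "m = 0")
  case False
  then show ?thesis unfolding dconv_def
    by (intro sum.cong refl arg_cong2[where f = "(*)"] assms)
       (auto simp: div_dvd_iff_mult dvd_div_eq_0_iff intro: Nat.gr0I dvd_div_eq_0_iff)
qed (simp add: dconv_0)

lemma ddelta_dconv: "m > 0 \<Longrightarrow> (ddelta \<star> f) m = f m"
proof -
  assume m: "m > 0"
  have "(ddelta \<star> f) m = (\<Sum>e | e dvd m. if e = 1 then f m else 0)"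
    unfolding dconv_def ddelta_def by (intro sum.cong) auto
  then show ?thesis using m by simp
qed

text \<open>\<open>ddelta\<close> acts as a unit only at positive arguments; a function that is
  itself a convolution also has the right value at 0, so here the unit law holds between
  functions.\<close>

lemma ddelta_dconv_dconv: "ddelta \<star> (f \<star> g) = f \<star> g"
  by (rule ext) (metis dconv_0 ddelta_dconv not_gr0)

lemma dconv_1: "(f \<star> g) (Suc 0) = f (Suc 0) * g (Suc 0)"
  by (simp add: dconv_def)

lemma dconv_prime:
  assumes "prime p"
  shows "(f \<star> g) p = f 1 * g p + f p * g 1"
proof -
  have "{e. e dvd p} = {1, p}" "p \<noteq> 1" "p > 0"
    using assms by (auto simp: prime_nat_iff)
  then show ?thesis by (simp add: dconv_def)
qed

lemma dconv_multiplicative: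
  assumes f: "multiplicative_fun f" and g: "multiplicative_fun g"
  shows "multiplicative_fun (f \<star> g)"
  unfolding multiplicative_fun_def
proof (intro allI impI)
  fix m n :: nat
  assume m: "1 \<le> m" and n: "1 \<le> n" and co: "coprime m n"
  have mn: "m * n > 0" "m > 0" "n > 0" using m n by auto
  have "(f \<star> g) m * (f \<star> g) n = (\<Sum>d | d dvd m. \<Sum>e | e dvd n. (f d * g (m div d)) * (f e * g (n div e)))"
    by (simp add: dconv_def sum_product)
  also have "\<dots> = (\<Sum>(d, e) \<in> {d. d dvd m} \<times> {e. e dvd n}. (f d * g (m div d)) * (f e * g (n div e)))"
    by (rule sum.cartesian_product)
  also have "\<dots> = (\<Sum>d | d dvd m * n. f d * g (m * n div d))"
  \<comment> \<open>A divisor of m n is uniquely a divisor of m times a divisor of n; as m and n are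
    coprime, the two gcds recover the parts.\<close>
  proof (rule sum.reindex_bij_witness[where j = "\<lambda>(d, e). d * e" and i = "\<lambda>k. (gcd k m, gcd k n)"], goal_cases)
    case (1 x)
    then obtain d e where x: "x = (d, e)" "d dvd m" "e dvd n" by auto
    then have "coprime m e" "coprime n d"
      using co coprime_divisors[of m m e n] coprime_divisors[of d m n n] by (auto simp: coprime_commute)
    then have "gcd (d * e) m = gcd d m" "gcd (d * e) n = gcd e n"
      by (simp_all add: gcd_mult_left_right_cancel gcd_mult_left_left_cancel)
    then show ?case using x by (simp add: gcd_nat.absorb1)
  next
    case (2 x) then show ?case by auto
  next
    case (3 k)
    have "gcd k m * gcd k n = gcd k (m * n)"
    proof (rule dvd_antisym)
      show "gcd k m * gcd k n dvd gcd k (m * n)"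
        using co by (intro gcd_greatest divides_mult mult_dvd_mono) (auto intro: coprime_divisors)
      obtain u v where uv: "gcd k (m * n) = u * v" "u dvd m" "v dvd n"
        using division_decomp[of "gcd k (m * n)" m n] by auto
      then have "u dvd k" "v dvd k" by (metis dvd_trans dvd_triv_left dvd_triv_right gcd_dvd1)+
      then show "gcd k (m * n) dvd gcd k m * gcd k n"
        using uv by (auto intro!: mult_dvd_mono)
    qed
    then show ?case using 3 by (auto simp: gcd_nat.absorb1)
  next
    case (4 k) then show ?case by auto
  next
    case (5 x)
    then obtain d e where x: "x = (d, e)" "d dvd m" "e dvd n" by auto
    have pos: "d > 0" "e > 0" "m div d > 0" "n div e > 0"
      using x mn by (auto intro!: Nat.gr0I simp: dvd_div_eq_0_iff)
    have "m div d dvd m" "n div e dvd n"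
      using x by (metis dvd_div_mult_self dvd_triv_left)+
    then have "coprime d e" "coprime (m div d) (n div e)"
      using co x coprime_divisors by blast+
    then have "f (d * e) = f d * f e" "g ((m div d) * (n div e)) = g (m div d) * g (n div e)"
      using f g pos unfolding multiplicative_fun_def by (simp_all add: Suc_le_eq)
    moreover have "m * n div (d * e) = (m div d) * (n div e)"
      using x by (simp add: div_mult_div_if_dvd)
    ultimately show ?case using x by simp
  qed
  finally show "(f \<star> g) (m * n) = (f \<star> g) m * (f \<star> g) n" by (simp add: dconv_def)
qed

lemma ddelta_multiplicative: "multiplicative_fun ddelta"
  by (simp add: multiplicative_fun_def ddelta_def)

lemma moebius_mu_multiplicative: "multiplicative_fun moebius_mu"
  unfolding multiplicative_fun_def
proof (intro allI impI)
  fix m n :: nat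
  assume m: "1 \<le> m" and n: "1 \<le> n" and co: "coprime m n"
  have "prime_factors (m * n) = prime_factors m \<union> prime_factors n"
    using m n by (intro prime_factors_product) auto
  moreover have "prime_factors m \<inter> prime_factors n = {}"
    using co by (auto simp: in_prime_factors_iff dest: coprime_common_divisor)
  ultimately have "card (prime_factors (m * n)) = card (prime_factors m) + card (prime_factors n)"
    by (simp add: card_Un_disjoint)
  moreover have "squarefree (m * n) \<longleftrightarrow> squarefree m \<and> squarefree n"
    using co by (metis squarefree_mult_coprime squarefree_multD)
  ultimately show "moebius_mu (m * n) = moebius_mu m * moebius_mu n"
    by (simp add: moebius_mu_def power_add)
qed

lemma dpow_multiplicative: "multiplicative_fun f \<Longrightarrow> multiplicative_fun (dpow f k)"
  by (induction k) (auto intro: dconv_multiplicative ddelta_multiplicative)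

lemma moebius_mu_prime_power: "prime p \<Longrightarrow> moebius_mu (p ^ k) = (if k = 0 then 1 else if k = 1 then -1 else 0)"
  by (auto simp: moebius_mu_def prime_factors_power prime_prime_factors squarefree_power_iff squarefree_prime)

lemma moebius_mu_1: "moebius_mu (Suc 0) = 1"
  by (simp add: moebius_mu_def)

text \<open>By multiplicativity it suffices to split off the full power of one prime p, on which
  only the terms 1 and p survive and cancel.\<close>

lemma sum_moebius_mu:
  assumes "m > 0"
  shows "((\<lambda>_. 1) \<star> moebius_mu) m = ddelta m"
proof -
  have mult: "multiplicative_fun ((\<lambda>_. 1) \<star> moebius_mu)"
    by (intro dconv_multiplicative moebius_mu_multiplicative) (simp add: multiplicative_fun_def)
  have pp: "((\<lambda>_. 1) \<star> moebius_mu) (p ^ k) = 0" if p: "prime p" and k: "k > 0" for p k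
  proof -
    have "((\<lambda>_. 1) \<star> moebius_mu) (p ^ k) = (\<Sum>e | e dvd p ^ k. moebius_mu e)"
      using dconv_commute[of "\<lambda>_. 1" moebius_mu] by (simp add: dconv_def)
    also have "{e. e dvd p ^ k} = (\<lambda>i. p ^ i) ` {..k}"
      using p by (auto simp: divides_primepow_nat)
    also have "(\<Sum>e\<in>\<dots>. moebius_mu e) = (\<Sum>i\<le>k. moebius_mu (p ^ i))"
      using p by (subst sum.reindex) (auto simp: inj_on_def dest: prime_gt_1_nat)
    also have "\<dots> = (\<Sum>i\<in>{0, 1}. moebius_mu (p ^ i))"
      using p k by (intro sum.mono_neutral_right) (auto simp: moebius_mu_prime_power)
    also have "\<dots> = 0" using moebius_mu_prime_power[OF p, of 0] moebius_mu_prime_power[OF p, of 1] by simp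
    finally show ?thesis .
  qed
  show ?thesis
  proof (cases "m = 1")
    case False
    then obtain p where p: "prime p" "p dvd m" using prime_factor_nat by blast
    define k where "k = multiplicity p m"
    obtain r where r: "m = p ^ k * r" "\<not> p dvd r"
      using multiplicity_decompose'[of m p] p assms k_def
      by (metis not_prime_unit gr_implies_not0)
    have k: "k > 0" using p assms by (simp add: k_def prime_multiplicity_gt_zero_iff)
    have "coprime (p ^ k) r" using p r by (simp add: prime_imp_coprime)
    then have "((\<lambda>_. 1) \<star> moebius_mu) m = ((\<lambda>_. 1) \<star> moebius_mu) (p ^ k) * ((\<lambda>_. 1) \<star> moebius_mu) r"
      using mult r assms unfolding multiplicative_fun_def by (metis Suc_leI One_nat_def mult_eq_0_iff not_gr0)
    then show ?thesis using pp[OF p(1) k] False by (simp add: ddelta_def)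
  qed (simp add: dconv_1 moebius_mu_1 ddelta_def)
qed

text \<open>Moebius inversion. It turns nonnegativity of f * mu into nonnegativity of f, and it
  yields the divisor sums that diagonalise gcd matrices.\<close>

lemma dconv_moebius_one:
  assumes "m > 0"
  shows "((f \<star> moebius_mu) \<star> (\<lambda>_. 1)) m = f m"
proof -
  have "((f \<star> moebius_mu) \<star> (\<lambda>_. 1)) m = (f \<star> ((\<lambda>_. 1) \<star> moebius_mu)) m" by (simp add: dconv_ac)
  also have "\<dots> = (f \<star> ddelta) m" by (rule dconv_cong) (auto simp: sum_moebius_mu)
  finally show ?thesis using assms by (simp add: ddelta_dconv dconv_commute[of f])
qed

text \<open>Multiplicativity with one argument 1 reads f m = f 1 * f m, so only the zero function
  escapes the normalisation at 1.\<close>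

lemma multiplicative_fun_1:
  assumes "multiplicative_fun f"
  shows "f 1 = 1 \<or> (\<forall>m\<ge>1. f m = 0)"
proof -
  have "f (1 * m) = f 1 * f m" if "m \<ge> 1" for m
    using assms that unfolding multiplicative_fun_def by (metis coprime_1_left order_refl)
  then show ?thesis by (metis mult_cancel_right1 mult_1 mult_zero_left)
qed

lemma dconv_nonneg:
  assumes "\<And>k. k dvd m \<Longrightarrow> u k \<ge> 0" "\<And>k. k dvd m \<Longrightarrow> v k \<ge> 0"
  shows "(u \<star> v) m \<ge> 0"
  unfolding dconv_def
proof (cases "m = 0")
  case False
  show "0 \<le> (\<Sum>e | e dvd m. u e * v (m div e))"
    by (intro sum_nonneg mult_nonneg_nonneg assms) (auto simp: dvd_div_iff_mult intro: dvd_triv_right)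
qed (simp add: infinite_UNIV_nat)

lemma dpow_add: "dpow f (i + j) = (if i = 0 then dpow f j else if j = 0 then dpow f i else dpow f i \<star> dpow f j)"
proof -
  have *: "dpow f (Suc i + j) = dpow f (Suc i) \<star> dpow f j" if "j > 0" for i j
    using that
  proof (induction j)
    case (Suc j)
    show ?case
    proof (cases "j = 0")
      case True
      then show ?thesis by (simp add: dconv_left_commute[of _ ddelta] ddelta_dconv_dconv)
    qed (use Suc in \<open>simp add: dconv_ac\<close>)
  qed simp
  show ?thesis using *[of j "i - 1"] by (cases i; cases j) auto
qed

text \<open>k is the number of factors mu that u can absorb while staying nonnegative on D. A member
  of \<open>class_C\<close> absorbs one, and the numbers add under convolution; this is how l_1 +
  ... + l_c > d enters. D has to be closed under divisors because a convolution at m evaluates its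
  factors at divisors of m.\<close>

definition nonneg_below :: "nat set \<Rightarrow> nat \<Rightarrow> (nat \<Rightarrow> complex) \<Rightarrow> bool" where
  "nonneg_below D k u \<longleftrightarrow> (\<forall>i\<le>k. \<forall>m\<in>D. (u \<star> dpow moebius_mu i) m \<ge> 0)"

locale divisor_closed =
  fixes D :: "nat set"
  assumes pos: "m \<in> D \<Longrightarrow> m > 0" and dvd_closed: "m \<in> D \<Longrightarrow> k dvd m \<Longrightarrow> k \<in> D"
begin

text \<open>The i factors mu are shared out: \<open>min i k\<close> go to u and the rest, at most l,
  to v.\<close>

lemma nonneg_below_dconv:
  assumes u: "nonneg_below D k u" and v: "nonneg_below D l v"
  shows "nonneg_below D (k + l) (u \<star> v)"
  unfolding nonneg_below_def
proof (intro allI impI ballI)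
  fix i m assume i: "i \<le> k + l" and m: "m \<in> D"
  define i1 where "i1 = min i k"
  define i2 where "i2 = i - i1"
  have i12: "i = i1 + i2" "i1 \<le> k" "i2 \<le> l" using i by (auto simp: i1_def i2_def)
  have m0: "m > 0" using pos m by auto
  have "(u \<star> v) \<star> dpow moebius_mu i = (u \<star> dpow moebius_mu i1) \<star> (v \<star> dpow moebius_mu i2)"
  proof (cases "i1 = 0 \<or> i2 = 0")
    case True
    then show ?thesis
    proof
      assume "i1 = 0"
      then have "i = i2" using i12 by simp
      have "(u \<star> dpow moebius_mu i1) \<star> (v \<star> dpow moebius_mu i2) = (ddelta \<star> (u \<star> v)) \<star> dpow moebius_mu i2"
        using \<open>i1 = 0\<close> by (simp add: dconv_ac)
      then show ?thesis by (simp add: \<open>i = i2\<close> ddelta_dconv_dconv)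
    next
      assume "i2 = 0"
      then have "i = i1" using i12 by simp
      have "(u \<star> dpow moebius_mu i1) \<star> (v \<star> dpow moebius_mu i2) = (ddelta \<star> (u \<star> v)) \<star> dpow moebius_mu i1"
        using \<open>i2 = 0\<close> by (simp add: dconv_ac)
      then show ?thesis by (simp add: \<open>i = i1\<close> ddelta_dconv_dconv)
    qed
  qed (simp add: i12 dpow_add dconv_ac)
  moreover have "((u \<star> dpow moebius_mu i1) \<star> (v \<star> dpow moebius_mu i2)) m \<ge> 0"
    by (rule dconv_nonneg) (use u v i12 m dvd_closed in \<open>auto simp: nonneg_below_def\<close>)
  ultimately show "((u \<star> v) \<star> dpow moebius_mu i) m \<ge> 0" by simp
qed

lemma nonneg_below_ddelta: "nonneg_below D 0 ddelta"
  unfolding nonneg_below_def using pos by (auto simp: ddelta_dconv less_eq_complex_def) (simp_all add: ddelta_def)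

lemma nonneg_below_dpow: "nonneg_below D 1 u \<Longrightarrow> nonneg_below D k (dpow u k)"
  by (induction k) (use nonneg_below_dconv nonneg_below_ddelta in fastforce)+

lemma nonneg_below_1:
  assumes "\<And>m. m \<in> D \<Longrightarrow> (f \<star> moebius_mu) m \<ge> 0"
  shows "nonneg_below D 1 f"
  unfolding nonneg_below_def
proof (intro allI impI ballI)
  fix i :: nat and m assume i: "i \<le> 1" and m: "m \<in> D"
  have m0: "m > 0" using pos m by auto
  \<comment> \<open>This settles i = 0: f is recovered from f * mu by summing over divisors.\<close>
  have "((f \<star> moebius_mu) \<star> (\<lambda>_. 1)) m \<ge> 0"
    by (rule dconv_nonneg) (use assms m dvd_closed in \<open>auto simp: less_eq_complex_def\<close>)
  then have "f m \<ge> 0" using dconv_moebius_one m0 by simp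
  moreover have "(f \<star> dpow moebius_mu 0) m = f m" using m0 by (simp add: dconv_commute[of f] ddelta_dconv)
  moreover have "f \<star> dpow moebius_mu (Suc 0) = f \<star> moebius_mu"
    by (simp add: dconv_left_commute[of f] ddelta_dconv_dconv)
  ultimately show "(f \<star> dpow moebius_mu i) m \<ge> 0" using i assms[OF m] by (cases "i = 0") (auto simp: le_Suc_eq)
qed

end

section \<open>Dirichlet characters\<close>

text \<open>A character on a subgroup of the units modulo b, carried by representatives: H is a
  union of residue classes, so no quotient group is formed. Inverses need not be demanded, as powers
  supply them.\<close>

definition partial_char :: "nat \<Rightarrow> nat set \<Rightarrow> (nat \<Rightarrow> complex) \<Rightarrow> bool" where
  "partial_char b H \<xi> \<longleftrightarrow> 1 \<in> H \<and> \<xi> 1 = 1 \<and> (\<forall>x\<in>H. coprime x b)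
     \<and> (\<forall>x\<in>H. \<forall>y\<in>H. x * y \<in> H \<and> \<xi> (x * y) = \<xi> x * \<xi> y)
     \<and> (\<forall>x\<in>H. \<forall>y. [x = y] (mod b) \<longrightarrow> y \<in> H \<and> \<xi> y = \<xi> x)"

lemma partial_charD:
  assumes "partial_char b H \<xi>"
  shows "1 \<in> H" "\<xi> 1 = 1" "x \<in> H \<Longrightarrow> coprime x b" "x \<in> H \<Longrightarrow> y \<in> H \<Longrightarrow> x * y \<in> H"
    "x \<in> H \<Longrightarrow> y \<in> H \<Longrightarrow> \<xi> (x * y) = \<xi> x * \<xi> y"
    "x \<in> H \<Longrightarrow> [x = y] (mod b) \<Longrightarrow> y \<in> H" "x \<in> H \<Longrightarrow> [x = y] (mod b) \<Longrightarrow> \<xi> y = \<xi> x"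
  using assms unfolding partial_char_def by blast+

lemma partial_char_power:
  assumes "partial_char b H \<xi>" "x \<in> H"
  shows "x ^ k \<in> H \<and> \<xi> (x ^ k) = \<xi> x ^ k"
proof (induction k)
  case 0
  then show ?case using partial_charD(1,2)[OF assms(1)] by simp
next
  case (Suc k)
  then show ?case using partial_charD(4,5)[OF assms] by simp
qed

lemma partial_char_inverse:
  assumes "partial_char b H \<xi>" "x \<in> H"
  shows "\<exists>y\<in>H. [y * x = 1] (mod b)"
proof (cases "totient b = 0")
  \<comment> \<open>Only b = 0 has totient 0; coprimality to 0 then forces x = 1.\<close>
  case True
  then have "b = 0" by simp
  then have "x = 1" using partial_charD(3)[OF assms] by simp
  then show ?thesis using assms(2) by (intro bexI[of _ 1]) auto
next
  case False
  then have "x ^ (totient b - 1) * x = x ^ totient b"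
    by (metis Suc_pred' neq0_conv power_Suc2)
  then have "[x ^ (totient b - 1) * x = 1] (mod b)"
    using euler_theorem[of x b] partial_charD(3)[OF assms] by simp
  then show ?thesis using partial_char_power[OF assms] by blast
qed

lemma partial_char_nonzero:
  assumes "partial_char b H \<xi>" "x \<in> H"
  shows "\<xi> x \<noteq> 0"
proof -
  obtain y where y: "y \<in> H" "[y * x = 1] (mod b)" using partial_char_inverse[OF assms] by blast
  then have "\<xi> 1 = \<xi> y * \<xi> x"
    using partial_charD(4,5,7)[OF assms(1)] assms(2) by metis
  then show ?thesis using partial_charD(2)[OF assms(1)] by auto
qed

text \<open>Extension to the subgroup generated by H and g. Since k is the order of g modulo H, the
  only obstruction to the value w at g is \<open>w ^ k = \<xi> (g ^ k)\<close>.\<close>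

lemma partial_char_extend:
  assumes pc: "partial_char b H \<xi>" and g: "coprime g b"
    and k: "k > 0" "g ^ k \<in> H" "\<forall>j. 0 < j \<longrightarrow> j < k \<longrightarrow> g ^ j \<notin> H"
    and w: "w ^ k = \<xi> (g ^ k)"
  shows "\<exists>H' \<xi>'. partial_char b H' \<xi>' \<and> H \<subseteq> H' \<and> g \<in> H' \<and> \<xi>' g = w \<and> (\<forall>x\<in>H. \<xi>' x = \<xi> x)"
proof -
  note D = partial_charD[OF pc]
  have cancel: "x \<in> H" if "y \<in> H" "y * x \<in> H" for x y
  proof -
    obtain z where z: "z \<in> H" "[z * y = 1] (mod b)"
      using partial_char_inverse[OF pc \<open>y \<in> H\<close>] by blast
    have "[z * (y * x) = x] (mod b)"
      using cong_mult[OF z(2) cong_refl[of x]] by (simp add: mult.assoc)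
    then show ?thesis by (rule D(6)[OF D(4)[OF z(1) that(2)]])
  qed
  \<comment> \<open>Well-definedness: if two products represent the same class, then
    \<open>g ^ (j - i)\<close> lies in H, and by minimality of k its exponent is a multiple of
    k.\<close>
  have key: "\<xi> h * w ^ i = \<xi> h' * w ^ j"
    if hh: "h \<in> H" "h' \<in> H" "[h * g ^ i = h' * g ^ j] (mod b)" and "i \<le> j" for h h' i j
  proof -
    define t where "t = j - i"
    have j: "j = i + t" using \<open>i \<le> j\<close> by (simp add: t_def)
    have "coprime (g ^ i) b" using g by simp
    moreover have "[h * g ^ i = (h' * g ^ t) * g ^ i] (mod b)"
      using hh(3) by (simp add: j power_add mult_ac)
    ultimately have h: "[h = h' * g ^ t] (mod b)" using cong_mult_rcancel_nat by blast
    then have "h' * g ^ t \<in> H" by (rule D(6)[OF hh(1)])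
    then have gt: "g ^ t \<in> H" by (rule cancel[OF hh(2)])
    have "g ^ t = (g ^ k) ^ (t div k) * g ^ (t mod k)"
      by (metis mult_div_mod_eq power_add power_mult)
    then have "g ^ (t mod k) \<in> H" using cancel gt partial_char_power[OF pc k(2)] by metis
    then have "t mod k = 0" using k(1,3) by (metis mod_less_divisor neq0_conv)
    then have t: "t = k * (t div k)" by auto
    have "\<xi> (g ^ t) = \<xi> (g ^ k) ^ (t div k)"
      using partial_char_power[OF pc k(2), of "t div k"] t by (metis power_mult)
    also have "\<dots> = w ^ t" using t w by (metis power_mult)
    finally have "\<xi> h = \<xi> h' * w ^ t" using D(5,7) hh gt h cong_sym by metis
    then show ?thesis by (simp add: j power_add mult_ac)
  qed
  define H' where "H' = {y. \<exists>h\<in>H. \<exists>i. [y = h * g ^ i] (mod b)}"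
  \<comment> \<open>The value is read off from an arbitrary representation; \<open>key\<close> shows
    that the choice is immaterial.\<close>
  define \<xi>' where "\<xi>' y = (SOME z. \<exists>h\<in>H. \<exists>i. [y = h * g ^ i] (mod b) \<and> z = \<xi> h * w ^ i)" for y
  have \<xi>': "\<xi>' y = \<xi> h * w ^ i" if "h \<in> H" "[y = h * g ^ i] (mod b)" for y h i
  proof -
    have "\<exists>h\<in>H. \<exists>i. [y = h * g ^ i] (mod b) \<and> \<xi>' y = \<xi> h * w ^ i"
      unfolding \<xi>'_def by (rule someI_ex) (use that in blast)
    then obtain h' j where hj: "h' \<in> H" "[y = h' * g ^ j] (mod b)" "\<xi>' y = \<xi> h' * w ^ j" by blast
    have c: "[h * g ^ i = h' * g ^ j] (mod b)" using that(2) hj(2) cong_trans cong_sym by blast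
    then have "\<xi> h * w ^ i = \<xi> h' * w ^ j"
    proof (cases "i \<le> j")
      case True
      then show ?thesis using key[OF that(1) hj(1)] c by blast
    next
      case False
      then show ?thesis using key[OF hj(1) that(1) cong_sym[OF c]] by simp
    qed
    then show ?thesis using hj(3) by simp
  qed
  have "partial_char b H' \<xi>'"
    unfolding partial_char_def
  proof (intro conjI ballI allI impI)
    show "1 \<in> H'" unfolding H'_def using D(1) by (auto intro!: bexI[of _ 1] exI[of _ 0])
    show "\<xi>' 1 = 1" using \<xi>'[of 1 1 0] D(1,2) by simp
  next
    fix x assume "x \<in> H'"
    then obtain h i where h: "h \<in> H" "[x = h * g ^ i] (mod b)" unfolding H'_def by blast
    show "coprime x b" using h D(3) g by (metis cong_imp_coprime cong_sym coprime_mult_left_iff coprime_power_left_iff)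
    fix y
    { assume "[x = y] (mod b)"
      then have "[y = h * g ^ i] (mod b)" using h(2) cong_trans cong_sym by blast
      then show "y \<in> H'" "\<xi>' y = \<xi>' x" using h \<xi>' unfolding H'_def by auto }
    { assume "y \<in> H'"
      then obtain h' j where h': "h' \<in> H" "[y = h' * g ^ j] (mod b)" unfolding H'_def by blast
      have xy: "[x * y = (h * h') * g ^ (i + j)] (mod b)"
        using cong_mult[OF h(2) h'(2)] by (simp add: power_add mult_ac)
      then show "x * y \<in> H'" unfolding H'_def using D(4)[OF h(1) h'(1)] by blast
      show "\<xi>' (x * y) = \<xi>' x * \<xi>' y"
        using \<xi>'[OF _ xy] \<xi>'[OF h] \<xi>'[OF h'] D(4,5) h(1) h'(1) by (simp add: power_add) }
  qed
  moreover have "H \<subseteq> H'" unfolding H'_def by (auto intro!: exI[of _ 0] bexI[of _ x for x])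
  moreover have "g \<in> H'" unfolding H'_def using D(1) by (auto intro!: bexI[of _ 1] exI[of _ 1])
  moreover have "\<xi>' g = w" using \<xi>'[of 1 g 1] D(1,2) by simp
  moreover have "\<xi>' x = \<xi> x" if "x \<in> H" for x using \<xi>'[of x x 0] that by simp
  ultimately show ?thesis by blast
qed

lemma least_power_in:
  assumes "partial_char b H \<xi>" "coprime g b" "b > 0"
  shows "\<exists>k>0. g ^ k \<in> H \<and> (\<forall>j. 0 < j \<longrightarrow> j < k \<longrightarrow> g ^ j \<notin> (H :: nat set))"
proof -
  have "0 < totient b \<and> g ^ totient b \<in> H"
    using assms(3) partial_charD(6)[OF assms(1) partial_charD(1)[OF assms(1)]] cong_sym[OF euler_theorem[OF assms(2)]]
    by simp
  then have "\<exists>k. 0 < k \<and> g ^ k \<in> H" by blast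
  from exists_least_iff[THEN iffD1, OF this] show ?thesis by blast
qed

text \<open>The value 1 at 1 is not listed: it follows because \<open>\<xi> 1\<close> is idempotent
  and nonzero.\<close>

definition dirichlet_chars :: "nat \<Rightarrow> (nat \<Rightarrow> complex) set" where
  "dirichlet_chars b = {\<xi>. (\<forall>m n. \<xi> (m * n) = \<xi> m * \<xi> n) \<and> (\<forall>n. \<xi> (n + b) = \<xi> n) \<and> (\<forall>n. \<xi> n \<noteq> 0 \<longleftrightarrow> coprime n b)}"

lemma partial_char_trivial: "partial_char b {y. [1 = y] (mod b)} (\<lambda>_. 1)"
  unfolding partial_char_def
proof (intro conjI ballI allI impI)
  fix x assume x: "x \<in> {y. [1 = y] (mod b)}"
  then show "coprime x b" using cong_imp_coprime[of 1 x b] by simp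
  fix y
  { assume "[x = y] (mod b)"
    then show "y \<in> {y. [1 = y] (mod b)}" using x cong_trans by blast }
  { assume "y \<in> {y. [1 = y] (mod b)}"
    then show "x * y \<in> {y. [1 = y] (mod b)}" using x cong_mult[of 1 x b 1 y] by simp }
qed auto

text \<open>Start from the trivial character on the class of 1. There k is the order of n, which
  exceeds 1, so a primitive k-th root of unity is an admissible value at n.\<close>

lemma partial_char_nontrivial:
  assumes b: "b > 0" and n: "coprime n b" and n1: "\<not> [n = 1] (mod b)"
  shows "\<exists>H \<xi>. partial_char b H \<xi> \<and> n \<in> H \<and> \<xi> n \<noteq> 1"
proof -
  define H where "H = {y. [1 = y] (mod b)}"
  note pc = partial_char_trivial[of b, folded H_def]
  obtain k where k: "k > 0" "n ^ k \<in> H" "\<forall>j. 0 < j \<longrightarrow> j < k \<longrightarrow> n ^ j \<notin> H"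
    using least_power_in[OF pc n b] by (elim exE conjE) (rule that)
  have "k \<noteq> 1" using k(2) n1 cong_sym[of 1 n b] by (auto simp: H_def)
  then have k2: "k > 1" using k(1) by simp
  define w where "w = cis (2 * pi / k)"
  have "w ^ k = (\<lambda>_. 1) (n ^ k)" using k(1) by (simp add: w_def Complex.DeMoivre)
  from partial_char_extend[OF pc n k this] obtain H' \<xi>' where
    "partial_char b H' \<xi>'" "n \<in> H'" "\<xi>' n = w" by blast
  moreover have "w \<noteq> 1"
  proof
    assume "w = 1"
    then have "cos (2 * pi / k) = 1" by (simp add: w_def complex_eq_iff)
    then obtain i :: int where i: "2 * pi / k = i * 2 * pi" by (auto simp: cos_one_2pi_int)
    then have "1 = real_of_int i * real k" using k(1) by (simp add: field_simps)
    then have "1 = i * int k" by (metis of_int_1 of_int_eq_iff of_int_mult of_int_of_nat_eq)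
    then have "int k dvd 1" by (metis dvd_triv_right)
    then show False using k2 by simp
  qed
  ultimately show ?thesis by blast
qed

text \<open>The residues are adjoined one at a time; the required value is a k-th root, which always
  exists in the complex numbers.\<close>

lemma partial_char_extend_below:
  assumes b: "b > 0" and H: "partial_char b H \<xi>"
  shows "\<exists>H' \<xi>'. partial_char b H' \<xi>' \<and> H \<subseteq> H' \<and> (\<forall>x\<in>H. \<xi>' x = \<xi> x) \<and> (\<forall>g<j. coprime g b \<longrightarrow> g \<in> H')"
proof (induction j)
  case 0
  then show ?case using H by blast
next
  case (Suc j)
  then obtain H' \<xi>' where H': "partial_char b H' \<xi>'" "H \<subseteq> H'" "\<forall>x\<in>H. \<xi>' x = \<xi> x"
    "\<forall>g<j. coprime g b \<longrightarrow> g \<in> H'" by blast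
  show ?case
  proof (cases "coprime j b")
    case True
    obtain k where k: "k > 0" "j ^ k \<in> H'" "\<forall>i. 0 < i \<longrightarrow> i < k \<longrightarrow> j ^ i \<notin> H'"
      using least_power_in[OF H'(1) True b]
      by (elim exE conjE) (rule that)
    obtain w where w: "w ^ k = \<xi>' (j ^ k)" using exists_complex_root[of k "\<xi>' (j ^ k)"] k(1)
      by (metis less_irrefl)
    obtain H'' \<xi>'' where H'': "partial_char b H'' \<xi>''" "H' \<subseteq> H''" "j \<in> H''" "\<forall>x\<in>H'. \<xi>'' x = \<xi>' x"
      using partial_char_extend[OF H'(1) True k w] by blast
    have "\<forall>g<Suc j. coprime g b \<longrightarrow> g \<in> H''" using H'(4) H''(2,3) by (auto simp: less_Suc_eq)
    moreover have "\<forall>x\<in>H. \<xi>'' x = \<xi> x" using H'(2,3) H''(4) by (metis subsetD)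
    ultimately show ?thesis using H''(1,2) H'(2) by (intro exI[of _ H''] exI[of _ \<xi>'']) simp
  next
    case False
    then have "\<forall>g<Suc j. coprime g b \<longrightarrow> g \<in> H'" using H'(4) by (auto simp: less_Suc_eq)
    then show ?thesis using H' by (intro exI[of _ H'] exI[of _ \<xi>']) simp
  qed
qed

text \<open>This separation of classes is what makes the sum over all characters vanish off the
  class of 1.\<close>

lemma separating_char:
  assumes b: "b > 0" and n: "coprime n b" and n1: "\<not> [n = 1] (mod b)"
  shows "\<exists>\<xi>\<in>dirichlet_chars b. \<xi> n \<noteq> 1"
proof -
  obtain H0 \<xi>\<^sub>0 where H0: "partial_char b H0 \<xi>\<^sub>0" "n \<in> H0" "\<xi>\<^sub>0 n \<noteq> 1"
    using partial_char_nontrivial[OF assms] by blast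
  obtain H \<xi> where H: "partial_char b H \<xi>" "H0 \<subseteq> H" "\<forall>x\<in>H0. \<xi> x = \<xi>\<^sub>0 x"
    "\<forall>g<b. coprime g b \<longrightarrow> g \<in> H"
    using partial_char_extend_below[OF b H0(1), of b] by blast
  note D = partial_charD[OF H(1)]
  have mem: "x \<in> H \<longleftrightarrow> coprime x b" for x
  proof
    assume "coprime x b"
    then have "x mod b \<in> H" using H(4) b by (simp add: coprime_commute)
    then show "x \<in> H" by (rule D(6)) (simp add: Cong.cong_def)
  qed (rule D(3))
  have cong_b: "[x = x + b] (mod b)" for x by (simp add: Cong.cong_def)
  define \<psi> where "\<psi> x = (if coprime x b then \<xi> x else 0)" for x
  have "\<psi> \<in> dirichlet_chars b"
    unfolding dirichlet_chars_def
  proof (intro CollectI conjI allI)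
    fix x y
    show "\<psi> (x * y) = \<psi> x * \<psi> y"
      using D(5)[of x y] by (simp add: \<psi>_def mem)
    have "coprime (x + b) b \<longleftrightarrow> coprime x b" unfolding coprime_iff_gcd_eq_1 by simp
    then show "\<psi> (x + b) = \<psi> x" using D(7)[OF _ cong_b, of x] by (simp add: \<psi>_def mem)
    show "\<psi> x \<noteq> 0 \<longleftrightarrow> coprime x b" using partial_char_nonzero[OF H(1), of x] by (simp add: \<psi>_def mem)
  qed
  moreover have "\<psi> n \<noteq> 1" using H0 H(3) n by (simp add: \<psi>_def)
  ultimately show ?thesis by blast
qed

lemma dirichlet_charsD:
  assumes "\<xi> \<in> dirichlet_chars b"
  shows "\<xi> (m * n) = \<xi> m * \<xi> n" "\<xi> (n + b) = \<xi> n" "\<xi> n = 0 \<longleftrightarrow> \<not> coprime n b"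
  using assms unfolding dirichlet_chars_def by auto

lemma dirichlet_char_1: "\<xi> \<in> dirichlet_chars b \<Longrightarrow> \<xi> 1 = 1"
  using dirichlet_charsD(1)[of \<xi> b 1 1] dirichlet_charsD(3)[of \<xi> b 1] by simp

lemma dirichlet_char_mod:
  assumes "\<xi> \<in> dirichlet_chars b"
  shows "\<xi> (n mod b) = \<xi> n"
proof -
  have "\<xi> (m + k * b) = \<xi> m" for m k
  proof (induction k)
    case (Suc k)
    have "m + Suc k * b = (m + k * b) + b" by simp
    then show ?case using Suc dirichlet_charsD(2)[OF assms, of "m + k * b"] by (simp only:)
  qed simp
  from this[of "n mod b" "n div b"] show ?thesis by simp
qed

lemma dirichlet_char_cong:
  assumes "\<xi> \<in> dirichlet_chars b" "[m = n] (mod b)"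
  shows "\<xi> m = \<xi> n"
  using dirichlet_char_mod[OF assms(1)] assms(2) unfolding Cong.cong_def by metis

lemma dirichlet_char_power: "\<xi> \<in> dirichlet_chars b \<Longrightarrow> \<xi> (n ^ k) = \<xi> n ^ k"
  by (induction k) (simp_all add: dirichlet_charsD(1) dirichlet_char_1[simplified])

lemma dirichlet_char_root_of_unity:
  assumes "\<xi> \<in> dirichlet_chars b" "coprime n b"
  shows "\<xi> n ^ totient b = 1"
  using dirichlet_char_cong[OF assms(1) euler_theorem[OF assms(2)]]
  by (simp add: dirichlet_char_power[OF assms(1)] dirichlet_char_1[OF assms(1), simplified])

lemma norm_dirichlet_char_le:
  assumes "\<xi> \<in> dirichlet_chars b" "b > 0"
  shows "norm (\<xi> n) \<le> 1"
proof (cases "coprime n b")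
  case True
  then have "norm (\<xi> n) ^ totient b = 1"
    using dirichlet_char_root_of_unity[OF assms(1)] by (metis norm_one norm_power)
  then show ?thesis using assms(2) power_eq_imp_eq_base[of "norm (\<xi> n)" "totient b" 1] by simp
next
  case False
  then have "\<xi> n = 0" using dirichlet_charsD(3)[OF assms(1)] by blast
  then show ?thesis by simp
qed

text \<open>A character is determined by its values below b, and these are 0 or roots of unity of
  order dividing \<open>totient b\<close>.\<close>

lemma finite_dirichlet_chars:
  assumes b: "b > 0"
  shows "finite (dirichlet_chars b)"
proof (rule inj_on_finite)
  show "inj_on (\<lambda>\<xi>. restrict \<xi> {..<b}) (dirichlet_chars b)"
  proof (rule inj_onI, rule ext)
    fix \<xi> \<psi> n assume *: "\<xi> \<in> dirichlet_chars b" "\<psi> \<in> dirichlet_chars b" "restrict \<xi> {..<b} = restrict \<psi> {..<b}"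
    have "\<xi> (n mod b) = \<psi> (n mod b)" using fun_cong[OF *(3), of "n mod b"] b by simp
    then show "\<xi> n = \<psi> n" using dirichlet_char_mod *(1,2) by metis
  qed
  show "(\<lambda>\<xi>. restrict \<xi> {..<b}) ` dirichlet_chars b \<subseteq> {..<b} \<rightarrow>\<^sub>E insert 0 {z. z ^ totient b = 1}"
  proof (intro image_subsetI, unfold restrict_PiE_iff, intro ballI)
    fix \<xi> n assume "\<xi> \<in> dirichlet_chars b"
    then show "\<xi> n \<in> insert 0 {z. z ^ totient b = 1}"
      using dirichlet_char_root_of_unity[of \<xi> b n] dirichlet_charsD(3)[of \<xi> b n] by auto
  qed
  show "finite ({..<b} \<rightarrow>\<^sub>E insert 0 {z::complex. z ^ totient b = 1})"
    using b by (intro finite_PiE) (auto intro!: finite_roots_unity simp: Suc_le_eq)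
qed

definition principal_char :: "nat \<Rightarrow> nat \<Rightarrow> complex" where
  "principal_char b n = (if coprime n b then 1 else 0)"

lemma principal_char: "b > 0 \<Longrightarrow> principal_char b \<in> dirichlet_chars b"
proof -
  have "coprime (n + b) b = coprime n b" for n
    unfolding coprime_iff_gcd_eq_1 by simp
  then show ?thesis by (auto simp: dirichlet_chars_def principal_char_def)
qed

text \<open>Multiplication by a unit g permutes the residues, so the sum equals
  \<open>\<xi> g\<close> times itself for some g with \<open>\<xi> g\<close> different from
  1.\<close>

lemma sum_dirichlet_char:
  assumes \<xi>: "\<xi> \<in> dirichlet_chars b" and b: "b > 0" and ne: "\<xi> \<noteq> principal_char b"
  shows "(\<Sum>n<b. \<xi> n) = 0"
proof -
  obtain g where g: "\<xi> g \<noteq> principal_char b g" using ne by blast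
  then have g': "coprime g b" "\<xi> g \<noteq> 1" using dirichlet_charsD(3)[OF \<xi>, of g] by (auto simp: principal_char_def split: if_splits)
  have inj: "inj_on (\<lambda>n. g * n mod b) {..<b}"
  proof (rule inj_onI)
    fix m n assume *: "m \<in> {..<b}" "n \<in> {..<b}" "g * m mod b = g * n mod b"
    then have "[m = n] (mod b)" using g'(1) cong_mult_lcancel_nat[of g b m n] by (simp add: Cong.cong_def)
    then show "m = n" using *(1,2) by (simp add: Cong.cong_def)
  qed
  have "(\<lambda>n. g * n mod b) ` {..<b} \<subseteq> {..<b}" using b by auto
  then have im: "(\<lambda>n. g * n mod b) ` {..<b} = {..<b}"
    using endo_inj_surj[OF _ _ inj] by simp
  have "(\<Sum>n<b. \<xi> n) = (\<Sum>n\<in>(\<lambda>n. g * n mod b) ` {..<b}. \<xi> n)" by (simp only: im)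
  also have "\<dots> = (\<Sum>n<b. \<xi> (g * n))" using inj by (simp add: sum.reindex dirichlet_char_mod[OF \<xi>])
  also have "\<dots> = \<xi> g * (\<Sum>n<b. \<xi> n)" by (simp add: dirichlet_charsD(1)[OF \<xi>] sum_distrib_left)
  finally show ?thesis using g'(2) by (simp add: mult_cancel_right1)
qed

text \<open>The dual argument: multiplication by a character that separates n from 1 permutes the
  characters. The number of characters then follows by double counting.\<close>

lemma sum_over_dirichlet_chars:
  assumes b: "b > 0"
  shows "(\<Sum>\<xi>\<in>dirichlet_chars b. \<xi> n) = (if [n = 1] (mod b) then of_nat (totient b) else 0)"
proof -
  let ?X = "dirichlet_chars b"
  have s0: "(\<Sum>\<xi>\<in>?X. \<xi> n) = 0" if n: "\<not> [n = 1] (mod b)" for n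
  proof (cases "coprime n b")
    case True
    then obtain \<psi> where \<psi>: "\<psi> \<in> ?X" "\<psi> n \<noteq> 1" using separating_char[OF b True n] by blast
    have mult: "(\<lambda>m. \<psi> m * \<xi> m) \<in> ?X" if "\<xi> \<in> ?X" for \<xi>
      using that \<psi>(1) by (auto simp: dirichlet_chars_def)
    have inj: "inj_on (\<lambda>\<xi> m. \<psi> m * \<xi> m) ?X"
    proof (rule inj_onI, rule ext)
      fix \<xi> \<phi> m assume *: "\<xi> \<in> ?X" "\<phi> \<in> ?X" "(\<lambda>m. \<psi> m * \<xi> m) = (\<lambda>m. \<psi> m * \<phi> m)"
      show "\<xi> m = \<phi> m"
        using fun_cong[OF *(3), of m] dirichlet_charsD(3)[OF \<psi>(1), of m] dirichlet_charsD(3)[OF *(1), of m]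
          dirichlet_charsD(3)[OF *(2), of m] by auto
    qed
    have im: "(\<lambda>\<xi> m. \<psi> m * \<xi> m) ` ?X = ?X"
      using mult by (intro endo_inj_surj[OF finite_dirichlet_chars[OF b] _ inj]) auto
    have "(\<Sum>\<xi>\<in>?X. \<xi> n) = (\<Sum>\<xi>\<in>(\<lambda>\<xi> m. \<psi> m * \<xi> m) ` ?X. \<xi> n)" by (simp only: im)
    also have "\<dots> = \<psi> n * (\<Sum>\<xi>\<in>?X. \<xi> n)" using inj by (simp add: sum.reindex sum_distrib_left)
    finally show ?thesis using \<psi>(2) by (simp add: mult_cancel_right1)
  qed (auto simp: dirichlet_charsD(3) intro!: sum.neutral)
  have s1: "(\<Sum>\<xi>\<in>?X. \<xi> n) = of_nat (card ?X)" if "[n = 1] (mod b)" for n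
  proof -
    have "\<xi> n = 1" if "\<xi> \<in> ?X" for \<xi>
      using dirichlet_char_cong[OF that \<open>[n = 1] (mod b)\<close>] dirichlet_char_1[OF that] by simp
    then have "(\<Sum>\<xi>\<in>?X. \<xi> n) = (\<Sum>\<xi>\<in>?X. 1)" by (intro sum.cong refl)
    then show ?thesis by simp
  qed
  \<comment> \<open>Summed over characters first, only the residue of 1 survives; summed over
    residues first, only the principal character does.\<close>
  have "of_nat (card ?X) = (\<Sum>\<xi>\<in>?X. \<Sum>n<b. \<xi> n)"
  proof -
    have "(\<Sum>\<xi>\<in>?X. \<Sum>n<b. \<xi> n) = (\<Sum>n<b. \<Sum>\<xi>\<in>?X. \<xi> n)" by (rule sum.swap)
    also have "\<dots> = (\<Sum>n<b. if n = 1 mod b then of_nat (card ?X) else 0)"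
      using s0 s1 by (intro sum.cong refl) (auto simp: Cong.cong_def)
    also have "\<dots> = of_nat (card ?X)" using b by simp
    finally show ?thesis by simp
  qed
  also have "\<dots> = (\<Sum>\<xi>\<in>{principal_char b}. \<Sum>n<b. \<xi> n)"
    using sum_dirichlet_char[OF _ b] principal_char[OF b] finite_dirichlet_chars[OF b]
    by (intro sum.mono_neutral_right) auto
  also have "\<dots> = of_nat (card {n \<in> {..<b}. coprime n b})"
    by (simp add: principal_char_def sum.If_cases Int_def)
  also have "card {n \<in> {..<b}. coprime n b} = totient b"
  \<comment> \<open>For b = 1 the residue 0 takes the place of the totative 1.\<close>
  proof (cases "b = 1")
    case False
    then have "{n \<in> {..<b}. coprime n b} = totatives b"
      using b by (auto simp: totatives_def intro!: Nat.gr0I order.not_eq_order_implies_strict)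
    then show ?thesis by (simp add: totient_def)
  qed auto
  finally have "(of_nat (card ?X) :: complex) = of_nat (totient b)" .
  then show ?thesis using s0 s1 by auto
qed

section \<open>The convolution of all characters\<close>

text \<open>Multiplication by ln is a derivation of the convolution algebra; it corresponds to minus
  the derivative of Dirichlet series.\<close>

lemma dconv_ln:
  assumes n: "n > 0"
  shows "(f \<star> g) n * of_real (ln n) = ((\<lambda>k. f k * of_real (ln k)) \<star> g) n + (f \<star> (\<lambda>k. g k * of_real (ln k))) n"
proof -
  have "f d * g e * of_real (ln n) = f d * of_real (ln d) * g e + f d * (g e * of_real (ln e))"
    if "d * e = n" for d e :: nat
  proof -
    have "d > 0" "e > 0" using that n by (auto intro: Nat.gr0I)
    then have "ln (real n) = ln d + ln e" using that by (auto simp: ln_mult)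
    then show ?thesis by (simp add: algebra_simps)
  qed
  then show ?thesis
    unfolding dconv_pairs[OF n] sum_distrib_right sum.distrib[symmetric]
    by (intro sum.cong refl) auto
qed

lemma dconv_add_right: "(f \<star> (\<lambda>k. g k + h k)) n = (f \<star> g) n + (f \<star> h) n"
  by (simp add: dconv_def distrib_left sum.distrib)

text \<open>A completely multiplicative function can be multiplied into the identity ln = 1 *
  Lambda. In terms of series this is the logarithmic derivative of one L-series.\<close>

lemma dirichlet_char_ln:
  assumes \<xi>: "\<xi> \<in> dirichlet_chars b" and n: "n > 0"
  shows "\<xi> n * of_real (ln n) = (\<xi> \<star> (\<lambda>k. \<xi> k * mangoldt k)) n"
proof -
  have "(\<xi> \<star> (\<lambda>k. \<xi> k * mangoldt k)) n = ((\<lambda>k. \<xi> k * mangoldt k) \<star> \<xi>) n"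
    by (simp only: dconv_commute)
  also have "\<dots> = (\<Sum>d | d dvd n. \<xi> n * mangoldt d)"
    unfolding dconv_def
  proof (intro sum.cong refl)
    fix d assume "d \<in> {d. d dvd n}"
    then have "\<xi> n = \<xi> d * \<xi> (n div d)" using dirichlet_charsD(1)[OF \<xi>, of d "n div d"] by simp
    then show "\<xi> d * mangoldt d * \<xi> (n div d) = \<xi> n * mangoldt d" by simp
  qed
  finally show ?thesis using n by (simp add: mangoldt_sum flip: sum_distrib_left)
qed

text \<open>The logarithmic derivative of a product is the sum of those of the factors, so the
  characters get added and orthogonality applies.\<close>

lemma dconv_list_ln:
  assumes "set xs \<subseteq> dirichlet_chars b" "n > 0"
  shows "foldr (\<star>) xs ddelta n * of_real (ln n)
    = (foldr (\<star>) xs ddelta \<star> (\<lambda>k. (\<Sum>\<xi>\<leftarrow>xs. \<xi> k) * mangoldt k)) n"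
  using assms
proof (induction xs arbitrary: n)
  case Nil
  then show ?case by (cases "n = 1") (auto simp: ddelta_dconv, simp_all add: ddelta_def)
next
  case (Cons \<xi> xs)
  let ?a = "foldr (\<star>) xs ddelta" and ?s = "\<lambda>k. (\<Sum>\<xi>\<leftarrow>xs. \<xi> k) * mangoldt k :: complex"
  let ?x = "\<lambda>k. \<xi> k * mangoldt k"
  have "(\<xi> \<star> ?a) n * of_real (ln n)
    = ((\<lambda>k. \<xi> k * of_real (ln k)) \<star> ?a) n + (\<xi> \<star> (\<lambda>k. ?a k * of_real (ln k))) n"
    by (rule dconv_ln) (use Cons.prems in simp)
  also have "((\<lambda>k. \<xi> k * of_real (ln k)) \<star> ?a) n = ((\<xi> \<star> ?x) \<star> ?a) n"
    using Cons.prems by (intro dconv_cong refl dirichlet_char_ln) auto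
  also have "(\<xi> \<star> (\<lambda>k. ?a k * of_real (ln k))) n = (\<xi> \<star> (?a \<star> ?s)) n"
    using Cons.prems by (intro dconv_cong refl Cons.IH) auto
  also have "((\<xi> \<star> ?x) \<star> ?a) n = ((\<xi> \<star> ?a) \<star> ?x) n"
    by (simp only: dconv_ac)
  also have "(\<xi> \<star> (?a \<star> ?s)) n = ((\<xi> \<star> ?a) \<star> ?s) n" by (simp only: dconv_ac)
  finally show ?case by (simp add: distrib_right flip: dconv_add_right)
qed

definition char_list :: "nat \<Rightarrow> (nat \<Rightarrow> complex) list" where
  "char_list b = (SOME xs. set xs = dirichlet_chars b \<and> distinct xs)"

text \<open>The coefficients of the product of all L-series modulo b, which is, up to the Euler
  factors at primes dividing b, the Dedekind zeta function of the b-th cyclotomic field. By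
  commutativity the order of \<open>char_list\<close> is immaterial.\<close>

definition char_conv :: "nat \<Rightarrow> nat \<Rightarrow> complex" where
  "char_conv b = foldr (\<star>) (char_list b) ddelta"

lemma char_list:
  assumes "b > 0"
  shows "set (char_list b) = dirichlet_chars b" "distinct (char_list b)"
  using someI_ex[OF finite_distinct_list[OF finite_dirichlet_chars[OF assms]]]
  unfolding char_list_def by auto

text \<open>By orthogonality this is the sum of \<open>\<xi> n * mangoldt n\<close> over all
  characters, that is, the coefficient of minus the logarithmic derivative of the product.\<close>

definition char_mangoldt :: "nat \<Rightarrow> nat \<Rightarrow> real" where
  "char_mangoldt b n = (if [n = 1] (mod b) then totient b * mangoldt n else 0)"

lemma char_mangoldt_nonneg: "char_mangoldt b n \<ge> 0"
  by (simp add: char_mangoldt_def mangoldt_nonneg)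

lemma char_conv_ln:
  assumes b: "b > 0" and n: "n > 0"
  shows "char_conv b n * of_real (ln n) = (\<Sum>d | d dvd n. of_real (char_mangoldt b d) * char_conv b (n div d))"
proof -
  have "(\<Sum>\<xi>\<leftarrow>char_list b. \<xi> k) = (\<Sum>\<xi>\<in>dirichlet_chars b. \<xi> k)" for k
    using char_list[OF b] by (metis sum_list_distinct_conv_sum_set)
  then have "(\<Sum>\<xi>\<leftarrow>char_list b. \<xi> k) * mangoldt k = of_real (char_mangoldt b k)" for k
    by (simp add: sum_over_dirichlet_chars[OF b] char_mangoldt_def)
  then have "char_conv b n * of_real (ln n) = (char_conv b \<star> (\<lambda>k. of_real (char_mangoldt b k))) n"
    unfolding char_conv_def using dconv_list_ln[of "char_list b" b n] char_list[OF b] n by simp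
  also have "\<dots> = ((\<lambda>k. of_real (char_mangoldt b k)) \<star> char_conv b) n"
    by (simp only: dconv_commute)
  finally show ?thesis by (simp add: dconv_def)
qed

lemma char_conv_1:
  assumes b: "b > 0"
  shows "char_conv b (Suc 0) = 1"
proof -
  have "foldr (\<star>) xs ddelta (Suc 0) = 1" if "set xs \<subseteq> dirichlet_chars b" for xs
    using that by (induction xs) (auto simp: dconv_1 ddelta_def dirichlet_char_1[simplified])
  then show ?thesis unfolding char_conv_def using char_list[OF b] by simp
qed

lemma mangoldt_power:
  assumes "k > 0"
  shows "mangoldt (n ^ k) = (mangoldt n :: real)"
proof (cases "primepow n")
  case True
  then obtain p j where p: "prime p" "j > 0" "n = p ^ j"
    by (auto simp: primepow_def)
  then show ?thesis using assms by (simp flip: power_mult)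
next
  case False
  then have "\<not> primepow (n ^ k)" using primepow_power_iff_nat[of n k] assms by (cases "n = 0") (auto simp: zero_power)
  then show ?thesis using False by (simp add: mangoldt_def)
qed

text \<open>By induction along \<open>a \<cdot> ln = \<Lambda>' * a\<close>, comparing with the indicator function of the \<open>\<phi>(b)\<close>-th powers.\<close>

lemma char_conv_ge:
  assumes b: "b > 0" and n: "n > 0"
  shows "char_conv b n \<ge> of_real (if \<exists>r. coprime r b \<and> n = r ^ totient b then 1 else 0)"
  using n
proof (induction n rule: less_induct)
  case (less n)
  define K where "K n = (if \<exists>r. coprime r b \<and> n = r ^ totient b then 1 else 0 :: real)" for n
  have tot: "totient b > 0" using b by simp
  show ?case
  proof (cases "n = 1")
    case True
    then show ?thesis using char_conv_1[OF b] by (auto simp: less_eq_complex_def)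
  next
    case False
    then have n: "n > 1" using less.prems by simp
    \<comment> \<open>K satisfies the identity of \<open>char_conv_ln\<close> with an inequality in
      place of the equality; this drives the induction.\<close>
    have "of_real (K n * ln n) \<le> (of_real (\<Sum>d | d dvd n. char_mangoldt b d * K (n div d)) :: complex)"
    proof (cases "\<exists>r. coprime r b \<and> n = r ^ totient b")
      case True
      then obtain r where r: "coprime r b" "n = r ^ totient b" by blast
      have r0: "r > 0" using r n tot by (cases "r = 0") auto
      have inj: "inj_on (\<lambda>d. d ^ totient b) {d. d dvd r}"
        using tot by (auto intro!: inj_onI dest: power_eq_imp_eq_base)
      \<comment> \<open>For d dividing r the power \<open>d ^ totient b\<close> divides n, is
        congruent to 1 by Euler's theorem, and has the same Mangoldt value as d. These divisors
        alone produce ln n.\<close>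
      have "ln n = totient b * (\<Sum>d | d dvd r. mangoldt d)"
        using r0 r by (simp add: mangoldt_sum ln_realpow)
      also have "\<dots> = (\<Sum>d | d dvd r. char_mangoldt b (d ^ totient b) * K (n div d ^ totient b))"
        unfolding sum_distrib_left
      proof (intro sum.cong refl)
        fix d assume "d \<in> {d. d dvd r}"
        then obtain e where e: "r = d * e" by auto
        then have "coprime d b" "coprime e b" using r(1) by auto
        moreover have "n div d ^ totient b = e ^ totient b"
          using r0 e r(2) by (simp add: power_mult_distrib)
        ultimately show "real (totient b) * mangoldt d = char_mangoldt b (d ^ totient b) * K (n div d ^ totient b)"
          using euler_theorem[of d b] tot by (auto simp: char_mangoldt_def K_def mangoldt_power)
      qed
      also have "\<dots> = (\<Sum>d\<in>(\<lambda>d. d ^ totient b) ` {d. d dvd r}. char_mangoldt b d * K (n div d))"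
        using inj by (simp add: sum.reindex)
      also have "\<dots> \<le> (\<Sum>d | d dvd n. char_mangoldt b d * K (n div d))"
      proof (rule sum_mono2)
        show "finite {d. d dvd n}" using n by simp
      qed (use r in \<open>auto simp: char_mangoldt_nonneg K_def dvd_power_same\<close>)
      finally have "K n * ln n \<le> (\<Sum>d | d dvd n. char_mangoldt b d * K (n div d))"
        using True by (simp add: K_def)
      then show ?thesis by (simp only: less_eq_complex_def) simp
    next
      case False
      have "0 \<le> (\<Sum>d | d dvd n. char_mangoldt b d * K (n div d))"
        by (intro sum_nonneg) (auto simp: char_mangoldt_nonneg K_def)
      moreover have "K n = 0" using False by (simp add: K_def)
      ultimately show ?thesis by (simp only: less_eq_complex_def) simp
    qed
    also have "(of_real (\<Sum>d | d dvd n. char_mangoldt b d * K (n div d)) :: complex)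
        = (\<Sum>d | d dvd n. of_real (char_mangoldt b d) * of_real (K (n div d)))"
      by simp
    also have "\<dots> \<le> (\<Sum>d | d dvd n. of_real (char_mangoldt b d) * char_conv b (n div d))"
    proof (rule sum_mono)
      fix d assume "d \<in> {d. d dvd n}"
      then have d: "d dvd n" by simp
      show "of_real (char_mangoldt b d) * of_real (K (n div d)) \<le> of_real (char_mangoldt b d) * char_conv b (n div d)"
      \<comment> \<open>At d = 1 the induction hypothesis would be needed for n itself, but the
        weight \<open>char_mangoldt b 1\<close> is 0.\<close>
      proof (cases "d = 1")
        case False
        moreover have "d > 0" using d n by (auto intro!: Nat.gr0I)
        ultimately have "n div d < n" "n div d > 0" using d n by (auto intro!: div_less_dividend Nat.gr0I simp: dvd_div_eq_0_iff)
        then have "of_real (K (n div d)) \<le> char_conv b (n div d)"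
          using less.IH unfolding K_def by blast
        then show ?thesis by (intro mult_left_mono) (auto simp: char_mangoldt_nonneg less_eq_complex_def)
      qed (simp add: char_mangoldt_def)
    qed
    also have "\<dots> = char_conv b n * of_real (ln n)" using char_conv_ln[OF b] n by simp
    finally have "K n * ln n \<le> Re (char_conv b n) * ln n" "Im (char_conv b n) * ln n = 0"
      by (simp_all add: less_eq_complex_def)
    moreover have "ln (real n) > 0" using n by simp
    ultimately have "of_real (K n) \<le> char_conv b n" by (auto simp: less_eq_complex_def)
    then show ?thesis by (simp add: K_def)
  qed
qed

text \<open>Twist both sums by \<open>n\<^bsup>-s\<^esup>\<close> and call them \<open>P(s)\<close> and \<open>T(s)\<close>. The convolution identity gives
  \<open>(ln P - T)' \<ge> 0\<close>, and \<open>ln P - T\<close> tends to 0 at infinity, so it is nonpositive at 1.\<close>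

lemma mangoldt_sum_bound:
  fixes A M :: "nat \<Rightarrow> real"
  assumes A: "\<And>n. n > 0 \<Longrightarrow> A n \<ge> 0" and M: "\<And>n. M n \<ge> 0" and A1: "A 1 = 1" and M1: "M 1 = 0"
    and eq: "\<And>n. n > 0 \<Longrightarrow> A n * ln n = (\<Sum>d | d dvd n. M d * A (n div d))"
  shows "(\<Sum>n=1..N. A n / n) \<le> exp (\<Sum>n=2..N. M n / (n * ln n))"
proof (cases "N = 0")
  case False
  define P where "P s = (\<Sum>n=1..N. A n * n powr (-s))" for s :: real
  \<comment> \<open>The sum starts at 2 because ln 1 = 0 would be a denominator; since M 1 = 0,
    nothing is lost in \<open>T'\<close>.\<close>
  define T where "T s = (\<Sum>n=2..N. M n / ln n * n powr (-s))" for s :: real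
  define P' where "P' s = (\<Sum>n=1..N. A n * ln n * n powr (-s))" for s :: real
  define T' where "T' s = (\<Sum>n=2..N. M n * n powr (-s))" for s :: real
  have split1: "sum f {1..N} = f 1 + sum f {2..N}" for f :: "nat \<Rightarrow> real"
    using False by (simp add: sum.atLeast_Suc_atMost numeral_2_eq_2)
  have P1: "P s \<ge> 1" for s
    unfolding P_def split1 using A A1 by (auto intro!: sum_nonneg)
  have dP: "(P has_real_derivative - P' s) (at s)" for s
    unfolding P_def P'_def
    by (auto intro!: derivative_eq_intros sum.cong simp: sum_negf[symmetric])
  have dT: "(T has_real_derivative - T' s) (at s)" for s
    unfolding T_def T'_def
    by (auto intro!: derivative_eq_intros sum.cong simp: sum_negf[symmetric])
  have PT: "P' s \<le> P s * T' s" for s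
  proof -
    let ?g = "\<lambda>(d, e). M d * d powr (-s) * (A e * e powr (-s))"
    have "P' s = (\<Sum>n=1..N. \<Sum>(d, e) | d * e = n. ?g (d, e))"
      unfolding P'_def
    proof (rule sum.cong)
      fix n assume "n \<in> {1..N}"
      then have n: "n > 0" by simp
      have "A n * ln n * n powr (-s) = (\<Sum>d | d dvd n. M d * A (n div d) * n powr (-s))"
        using eq[OF n] by (simp add: sum_distrib_right)
      also have "\<dots> = (\<Sum>(d, e) | d * e = n. M d * A e * n powr (-s))"
        by (rule sum.reindex_bij_witness[where i = fst and j = "\<lambda>d. (d, n div d)"]) (use n in auto)
      also have "\<dots> = (\<Sum>(d, e) | d * e = n. ?g (d, e))"
        by (intro sum.cong refl) (auto simp: powr_mult)
      finally show "A n * ln n * n powr (-s) = (\<Sum>(d, e) | d * e = n. ?g (d, e))" .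
    qed simp
    also have "\<dots> = (\<Sum>(n, x)\<in>(SIGMA n:{1..N}. {(d, e). d * e = n}). ?g x)"
      by (subst sum.Sigma) (use finite_factor_pairs in \<open>auto simp: case_prod_unfold Suc_le_eq\<close>)
    also have "\<dots> = sum ?g (snd ` (SIGMA n:{1..N}. {(d, e). d * e = n}))"
      by (subst sum.reindex) (auto intro!: inj_onI simp: case_prod_unfold)
    \<comment> \<open>Truncation at N costs nothing: the pairs with product at most N lie in the
      full square, and the remaining pairs contribute nonnegative terms.\<close>
    also have "\<dots> \<le> sum ?g ({1..N} \<times> {1..N})"
    proof (intro sum_mono2)
      show "snd ` (SIGMA n:{1..N}. {(d, e). d * e = n}) \<subseteq> {1..N} \<times> {1..N}"
      proof
        fix x :: "nat \<times> nat" assume "x \<in> snd ` (SIGMA n:{1..N}. {(d, e). d * e = n})"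
        then obtain d e where x: "x = (d, e)" "d * e \<le> N" "d * e > 0" by (cases x) auto
        then have le: "d \<le> d * e" "e \<le> d * e" "d > 0" "e > 0" by simp_all
        then show "x \<in> {1..N} \<times> {1..N}"
          using x(1) le_trans[OF le(1) x(2)] le_trans[OF le(2) x(2)] by simp
      qed
    qed (auto intro!: mult_nonneg_nonneg A M)
    also have "\<dots> = (\<Sum>d=1..N. M d * d powr (-s)) * P s"
      unfolding P_def sum_product sum.cartesian_product by (rule sum.cong) auto
    also have "(\<Sum>d=1..N. M d * d powr (-s)) = T' s"
      unfolding split1 T'_def by (simp add: M1[simplified])
    finally show ?thesis by (simp add: mult.commute)
  qed
  have "ln (P 1) - T 1 \<le> ln (P s) - T s" if "s \<ge> 1" for s
  proof (rule DERIV_nonneg_imp_nondecreasing[OF that])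
    fix x :: real
    have Px: "P x > 0" using P1[of x] by simp
    then have "((\<lambda>s. ln (P s) - T s) has_real_derivative - P' x / P x + T' x) (at x)"
      by (auto intro!: derivative_eq_intros dP dT)
    moreover have "P' x / P x \<le> T' x" using PT[of x] Px by (simp add: field_simps)
    ultimately show "\<exists>y. ((\<lambda>s. ln (P s) - T s) has_real_derivative y) (at x) \<and> y \<ge> 0" by force
  qed
  moreover have "((\<lambda>s. ln (P s) - T s) \<longlongrightarrow> ln 1 - 0) at_top"
  proof -
    have z: "((\<lambda>s. f n * real n powr (-s)) \<longlongrightarrow> f n * 0) at_top" if "n \<in> {2..N}" for f n
    proof -
      have "real n > 1" using that by simp
      then have "((\<lambda>s. real n powr (-s)) \<longlongrightarrow> 0) at_top" by real_asymp
      then show ?thesis by (intro tendsto_mult tendsto_const)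
    qed
    have "(P \<longlongrightarrow> A 1 * 1 + (\<Sum>n=2..N. A n * 0)) at_top"
      unfolding P_def split1 by (intro tendsto_intros z) auto
    then have "(P \<longlongrightarrow> 1) at_top" using A1 by simp
    moreover have "(T \<longlongrightarrow> (\<Sum>n=2..N. M n / ln n * 0)) at_top"
      unfolding T_def by (intro tendsto_sum z)
    ultimately show ?thesis by (intro tendsto_intros) auto
  qed
  ultimately have "ln (P 1) - T 1 \<le> ln 1 - 0"
    by (intro tendsto_lowerbound[of _ _ at_top]) (auto simp: eventually_at_top_linorder intro!: exI[of _ 1])
  then have "P 1 \<le> exp (T 1)" using P1[of 1] by (simp add: ln_le_cancel_iff[symmetric] del: ln_le_cancel_iff)
  moreover have "P 1 = (\<Sum>n=1..N. A n / n)" unfolding P_def by (intro sum.cong) (auto simp: powr_minus field_simps)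
  moreover have "T 1 = (\<Sum>n=2..N. M n / (n * ln n))" unfolding T_def by (intro sum.cong) (auto simp: powr_minus field_simps)
  ultimately show ?thesis by simp
qed simp

text \<open>The bound is the full tail 1 / (p (p - 1)), written as a difference so that its sum over
  p telescopes.\<close>

lemma geometric_tail:
  fixes p :: real
  assumes p: "p > 1"
  shows "(\<Sum>k=2..N. 1 / p ^ k) \<le> 1 / (p - 1) - 1 / p"
proof -
  have "(\<Sum>k=2..Suc N. 1 / p ^ k) = 1 / (p - 1) - 1 / p - 1 / ((p - 1) * p ^ Suc N)" for N
  proof (induction N)
    case 0
    then show ?case using p by (simp add: field_simps)
  next
    case (Suc N)
    have "(\<Sum>k=2..Suc (Suc N). 1 / p ^ k) = (\<Sum>k=2..Suc N. 1 / p ^ k) + 1 / p ^ Suc (Suc N)"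
      by simp
    also have "1 / p ^ Suc (Suc N) = 1 / ((p - 1) * p ^ Suc N) - 1 / ((p - 1) * p ^ Suc (Suc N))"
    proof -
      have "1 / (p * x) = 1 / ((p - 1) * x) - 1 / ((p - 1) * (p * x))" if "x > 0" for x
        using p that by (simp add: divide_simps)
      from this[of "p ^ Suc N"] show ?thesis using p by simp
    qed
    finally show ?case unfolding Suc.IH by simp
  qed
  then have "(\<Sum>k=2..Suc M. 1 / p ^ k) \<le> 1 / (p - 1) - 1 / p" for M
    using p by simp
  then show ?thesis using p by (cases N) (auto simp: field_simps)
qed

text \<open>Overcounting the proper prime powers by all \<open>p ^ k\<close> with p, k at least 2
  still gives a telescoping sum. So only the primes themselves can cause divergence.\<close>

lemma sum_nonprime_primepow_le:
  "(\<Sum>n | n \<in> {2..N} \<and> primepow n \<and> \<not> prime n. 1 / real n) \<le> 1"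
proof -
  have "{n. n \<in> {2..N} \<and> primepow n \<and> \<not> prime n} \<subseteq> (\<lambda>(p, k). p ^ k) ` ({2..N} \<times> {2..N})"
  proof
    fix n assume "n \<in> {n. n \<in> {2..N} \<and> primepow n \<and> \<not> prime n}"
    then have n: "n \<le> N" "primepow n" "\<not> prime n" by auto
    then obtain p k where pk: "prime p" "k > 0" "n = p ^ k" by (auto simp: primepow_def)
    have "k \<noteq> 1" using pk n by auto
    then have k: "k \<ge> 2" using pk by simp
    have p: "p \<ge> 2" using pk prime_ge_2_nat by simp
    have "k < p ^ k" "p \<le> p ^ k" using p k power_gt_expt[of p k] self_le_power[of p k] by auto
    then show "n \<in> (\<lambda>(p, k). p ^ k) ` ({2..N} \<times> {2..N})"
      using pk k p n by (intro image_eqI[of _ _ "(p, k)"]) auto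
  qed
  then have "(\<Sum>n | n \<in> {2..N} \<and> primepow n \<and> \<not> prime n. 1 / real n)
      \<le> (\<Sum>n\<in>(\<lambda>(p, k). p ^ k) ` ({2..N} \<times> {2..N}). 1 / real n)"
    by (intro sum_mono2) auto
  also have "\<dots> \<le> (\<Sum>x\<in>{2..N} \<times> {2..N}. ((\<lambda>n. 1 / real n) \<circ> (\<lambda>(p, k). p ^ k)) x)"
    by (intro sum_image_le) auto
  also have "\<dots> = (\<Sum>p=2..N. \<Sum>k=2..N. 1 / real p ^ k)"
    by (simp add: sum.cartesian_product case_prod_unfold)
  also have "\<dots> \<le> (\<Sum>p=2..N. 1 / (real p - 1) - 1 / real p)"
    by (intro sum_mono geometric_tail) auto
  also have "\<dots> \<le> 1"
  proof -
    have "(\<Sum>p=2..Suc M. 1 / (real p - 1) - 1 / real p) = 1 - 1 / Suc M" for M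
    proof (induction M)
      case (Suc M)
      have "(\<Sum>p=2..Suc (Suc M). 1 / (real p - 1) - 1 / real p)
        = (\<Sum>p=2..Suc M. 1 / (real p - 1) - 1 / real p) + (1 / (real (Suc (Suc M)) - 1) - 1 / real (Suc (Suc M)))"
        by simp
      then show ?case unfolding Suc.IH by simp
    qed simp
    then have "(\<Sum>p=2..Suc M. 1 / (real p - 1) - 1 / real p) \<le> 1" for M by simp
    then show ?thesis by (cases N) auto
  qed
  finally show ?thesis .
qed

text \<open>As \<open>mangoldt n\<close> is at most ln n, each prime power contributes at most
  totient b / n; the primes are bounded by B and the higher powers by 1.\<close>

lemma sum_char_mangoldt_le:
  fixes B :: real
  assumes B: "\<And>N. (\<Sum>p | p \<le> N \<and> prime p \<and> [p = 1] (mod b). 1 / real p) \<le> B"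
  shows "(\<Sum>n=2..N. char_mangoldt b n / (n * ln n)) \<le> totient b * (B + 1)"
proof -
  have "(\<Sum>n=2..N. char_mangoldt b n / (n * ln n))
    \<le> (\<Sum>n=2..N. totient b * ((if prime n \<and> [n = 1] (mod b) then 1 / real n else 0)
          + (if primepow n \<and> \<not> prime n then 1 / real n else 0)))"
  proof (rule sum_mono)
    fix n assume "n \<in> {2..N}"
    then have n: "n > 1" "ln (real n) > 0" by auto
    have "mangoldt n / (n * ln n) \<le> 1 / real n"
      using mangoldt_le[of n] n by (simp add: field_simps)
    moreover have "mangoldt n = (0 :: real)" if "\<not> primepow n" using that by (simp add: mangoldt_def)
    ultimately show "char_mangoldt b n / (n * ln n) \<le> totient b * ((if prime n \<and> [n = 1] (mod b) then 1 / real n else 0)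
          + (if primepow n \<and> \<not> prime n then 1 / real n else 0))"
      using mult_left_mono[of "mangoldt n / (n * ln n)" "1 / real n" "real (totient b)"]
      by (cases "primepow n"; cases "prime n") (auto simp: char_mangoldt_def dest: primepow_prime)
  qed
  also have "\<dots> = totient b * ((\<Sum>n | n \<in> {2..N} \<and> prime n \<and> [n = 1] (mod b). 1 / real n)
      + (\<Sum>n | n \<in> {2..N} \<and> primepow n \<and> \<not> prime n. 1 / real n))"
    by (simp only: sum_distrib_left[symmetric] sum.distrib sum.inter_filter[OF finite_atLeastAtMost] )
  also have "\<dots> \<le> totient b * (B + 1)"
  proof (intro mult_left_mono add_mono)
    have "{n. n \<in> {2..N} \<and> prime n \<and> [n = 1] (mod b)} = {p. p \<le> N \<and> prime p \<and> [p = 1] (mod b)}"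
      using prime_ge_2_nat by auto
    then show "(\<Sum>n | n \<in> {2..N} \<and> prime n \<and> [n = 1] (mod b). 1 / real n) \<le> B" using B by simp
  qed (use sum_nonprime_primepow_le in auto)
  finally show ?thesis .
qed

lemma char_conv_nonneg: "b > 0 \<Longrightarrow> n > 0 \<Longrightarrow> char_conv b n \<ge> 0"
  using char_conv_ge[of b n] by (auto simp: less_eq_complex_def split: if_splits)

text \<open>This is how a hypothetical bound on the prime reciprocals becomes a bound on the product
  of all L-series at 1.\<close>

lemma sum_char_conv_le:
  fixes B :: real
  assumes b: "b > 0" and B: "\<And>N. (\<Sum>p | p \<le> N \<and> prime p \<and> [p = 1] (mod b). 1 / real p) \<le> B"
  shows "(\<Sum>n=1..N. Re (char_conv b n) / n) \<le> exp (totient b * (B + 1))"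
proof -
  have "(\<Sum>n=1..N. Re (char_conv b n) / n) \<le> exp (\<Sum>n=2..N. char_mangoldt b n / (n * ln n))"
  proof (rule mangoldt_sum_bound)
    fix n :: nat assume n: "n > 0"
    show "Re (char_conv b n) \<ge> 0" using char_conv_nonneg[OF b n] by (simp add: less_eq_complex_def)
    show "Re (char_conv b n) * ln n = (\<Sum>d | d dvd n. char_mangoldt b d * Re (char_conv b (n div d)))"
      using arg_cong[OF char_conv_ln[OF b n], of Re] by simp
  qed (use char_conv_1[OF b] in \<open>auto simp: char_mangoldt_def mangoldt_nonneg\<close>)
  also have "\<dots> \<le> exp (totient b * (B + 1))"
    using sum_char_mangoldt_le[OF B] by simp
  finally show ?thesis .
qed

section \<open>Dirichlet series\<close>

definition dterm :: "(nat \<Rightarrow> complex) \<Rightarrow> complex \<Rightarrow> nat \<Rightarrow> complex" where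
  "dterm f s n = f n * of_nat n powr (-s)"

text \<open>An unordered sum, hence 0 by default wherever the series does not converge absolutely.
  Continuations beyond that region are separate functions.\<close>

definition dser :: "(nat \<Rightarrow> complex) \<Rightarrow> complex \<Rightarrow> complex" where
  "dser f s = infsum (dterm f s) {1..}"

lemma norm_dterm: "n > 0 \<Longrightarrow> norm (dterm f s n) = norm (f n) * n powr (- Re s)"
  by (simp add: dterm_def norm_mult norm_powr_real_powr)

lemma dterm_bounded_summable:
  assumes C: "\<And>n. n > 0 \<Longrightarrow> norm (f n) \<le> C" and s: "Re s > 1"
  shows "(\<lambda>n. norm (dterm f s n)) summable_on {1..}"
proof (rule Infinite_Sum.abs_summable_on_comparison_test)
  have "summable (\<lambda>n. norm (C * real n powr (- Re s)))"
    using s by (simp add: abs_mult summable_mult summable_real_powr_iff)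
  then have "(\<lambda>n. norm (C * real n powr (- Re s))) summable_on UNIV"
    by (intro norm_summable_imp_summable_on) simp
  then show "(\<lambda>n. norm (C * real n powr (- Re s))) summable_on {1..}"
    by (rule summable_on_subset_banach) simp
next
  fix n :: nat assume "n \<in> {1..}"
  then have n: "n > 0" by simp
  have "norm (f n) * n powr (- Re s) \<le> C * n powr (- Re s)"
    using C[OF n] by (intro mult_right_mono) auto
  then show "norm (dterm f s n) \<le> norm (C * real n powr (- Re s))"
    using norm_dterm[OF n] by (metis abs_ge_self order_trans real_norm_def)
qed

text \<open>The product is an absolutely convergent sum over pairs (d, e), which may be grouped by n
  = d e.\<close>

lemma
  assumes f: "(\<lambda>n. norm (dterm f s n)) summable_on {1..}" and g: "(\<lambda>n. norm (dterm g s n)) summable_on {1..}"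
  shows dterm_dconv_summable: "(\<lambda>n. norm (dterm (f \<star> g) s n)) summable_on {1..}"
    and dser_dconv: "dser (f \<star> g) s = dser f s * dser g s"
proof -
  let ?A = "{1::nat..}" and ?F = "\<lambda>(d, e). dterm f s d * dterm g s e"
  let ?S = "SIGMA n:{1::nat..}. {(d, e). d * e = n}"
  have abs_prod: "(\<lambda>x. norm (?F x)) summable_on ?A \<times> ?A"
    unfolding Infinite_Sum.abs_summable_on_Sigma_iff
    using f g infsum_nonneg[of ?A "\<lambda>y. norm (dterm g s y)"]
    by (auto simp: norm_mult infsum_cmult_right abs_mult intro!: summable_on_cmult_right summable_on_cmult_left)
  have "infsum ?F (?A \<times> ?A) = dser f s * dser g s"
    using infsum_Sigma'_banach[OF abs_summable_summable[OF abs_prod]] f g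
    by (simp add: dser_def infsum_cmult_right infsum_cmult_left abs_summable_summable)
  then have "(?F has_sum dser f s * dser g s) (?A \<times> ?A)"
    using has_sum_infsum[OF abs_summable_summable[OF abs_prod]] by simp
  then have hs: "((\<lambda>x. ?F (snd x)) has_sum dser f s * dser g s) ?S"
    by (subst has_sum_reindex_bij_witness[where j = snd and i = "\<lambda>(d, e). (d * e, (d, e))" and T = "?A \<times> ?A" and h = ?F])
       (auto simp: Suc_le_eq)
  have "((\<lambda>x. norm (?F x)) summable_on ?A \<times> ?A) = ((\<lambda>x. norm (?F (snd x))) summable_on ?S)"
    by (rule summable_on_reindex_bij_witness[where j = "\<lambda>(d, e). (d * e, (d, e))" and i = snd])
       (auto simp: Suc_le_eq)
  then have abs: "(\<lambda>x. norm (?F (snd x))) summable_on ?S" using abs_prod by simp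
  have inner: "(\<Sum>x | fst x * snd x = n. ?F x) = dterm (f \<star> g) s n" if "n \<in> ?A" for n
  proof -
    have "?F x = f (fst x) * g (snd x) * of_nat n powr (-s)" if "fst x * snd x = n" for x
      unfolding that[symmetric] by (simp add: dterm_def case_prod_unfold powr_times_real mult_ac)
    then have "(\<Sum>x | fst x * snd x = n. ?F x) = (\<Sum>x | fst x * snd x = n. f (fst x) * g (snd x) * of_nat n powr (-s))"
      by (intro sum.cong) auto
    then show ?thesis using that by (simp add: dterm_def dconv_pairs sum_distrib_right case_prod_unfold)
  qed
  have fin: "finite {(d, e). d * e = n}" if "n \<in> ?A" for n using that by (intro finite_factor_pairs) simp
  have "(dterm (f \<star> g) s has_sum dser f s * dser g s) ?A"
  proof (rule has_sum_SigmaD[OF hs])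
    fix n assume n: "n \<in> ?A"
    show "((\<lambda>y. ?F (snd (n, y))) has_sum dterm (f \<star> g) s n) {(d, e). d * e = n}"
      using has_sum_finite[OF fin[OF n], of ?F] inner[OF n] by (simp add: case_prod_unfold)
  qed
  then show "dser (f \<star> g) s = dser f s * dser g s" unfolding dser_def by (rule infsumI)
  have "(\<lambda>n. \<Sum>\<^sub>\<infinity>y\<in>{(d, e). d * e = n}. norm (?F (snd (n, y)))) summable_on ?A"
    using abs unfolding Infinite_Sum.abs_summable_on_Sigma_iff by (auto intro: abs_summable_summable[where f = "\<lambda>n. infsum (\<lambda>y. norm (case y of (d, e) \<Rightarrow> dterm f s d * dterm g s e)) {(d, e). d * e = n}"])
  then have "(\<lambda>n. \<Sum>x | fst x * snd x = n. norm (?F x)) summable_on ?A"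
    using fin by (subst (asm) summable_on_cong) (auto simp: case_prod_unfold)
  then show "(\<lambda>n. norm (dterm (f \<star> g) s n)) summable_on ?A"
  proof (rule summable_on_comparison_test)
    fix n assume n: "n \<in> ?A"
    show "norm (dterm (f \<star> g) s n) \<le> (\<Sum>x | fst x * snd x = n. norm (?F x))"
      unfolding inner[OF n, symmetric] by (rule norm_sum)
  qed simp
qed

lemma
  shows dterm_ddelta_summable: "(\<lambda>n. norm (dterm ddelta s n)) summable_on {1..}" and dser_ddelta: "dser ddelta s = 1"
proof -
  have "((\<lambda>n. dterm ddelta s n) has_sum 1) {1..} \<longleftrightarrow> ((\<lambda>n. dterm ddelta s n) has_sum 1) {1}"
    by (rule has_sum_cong_neutral) (auto simp: dterm_def ddelta_def)
  moreover have "((\<lambda>n. dterm ddelta s n) has_sum (\<Sum>n\<in>{1}. dterm ddelta s n)) {1}"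
    by (rule has_sum_finite) simp
  moreover have "(\<Sum>n\<in>{1}. dterm ddelta s n) = 1" by (simp add: dterm_def ddelta_def)
  ultimately show "dser ddelta s = 1" unfolding dser_def by (intro infsumI) simp
  have "(\<lambda>n. norm (dterm ddelta s n)) summable_on {1..} \<longleftrightarrow> (\<lambda>n. norm (dterm ddelta s n)) summable_on {1}"
    by (rule summable_on_cong_neutral) (auto simp: dterm_def ddelta_def)
  then show "(\<lambda>n. norm (dterm ddelta s n)) summable_on {1..}" by simp
qed

lemma
  assumes "\<And>f. f \<in> set fs \<Longrightarrow> (\<lambda>n. norm (dterm f s n)) summable_on {1..}"
  shows dterm_list_summable: "(\<lambda>n. norm (dterm (foldr (\<star>) fs ddelta) s n)) summable_on {1..}"
    and dser_list: "dser (foldr (\<star>) fs ddelta) s = (\<Prod>f\<leftarrow>fs. dser f s)"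
proof -
  have "(\<lambda>n. norm (dterm (foldr (\<star>) fs ddelta) s n)) summable_on {1..} \<and> dser (foldr (\<star>) fs ddelta) s = (\<Prod>f\<leftarrow>fs. dser f s)"
    using assms by (induction fs) (auto simp: dterm_ddelta_summable dser_ddelta dser_dconv dterm_dconv_summable simp del: One_nat_def)
  then show "(\<lambda>n. norm (dterm (foldr (\<star>) fs ddelta) s n)) summable_on {1..}"
    "dser (foldr (\<star>) fs ddelta) s = (\<Prod>f\<leftarrow>fs. dser f s)" by auto
qed

text \<open>A mean value estimate. It gains one power of x over the single terms, which is what
  makes blocks of terms summable for all s with positive real part.\<close>

lemma norm_powr_diff_le:
  fixes x y :: real
  assumes "0 < x" "x \<le> y" "Re s > 0"
  shows "norm (of_real x powr (-s) - of_real y powr (-s)) \<le> norm s * x powr (- Re s - 1) * (y - x)"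
proof -
  have "norm ((of_real x :: complex) powr (-s) - of_real y powr (-s))
      \<le> norm s * x powr (- Re s - 1) * norm (of_real x - of_real y :: complex)"
  proof (rule field_differentiable_bound[where S = "of_real ` {x..y}"])
    show "convex (complex_of_real ` {x..y})"
      by (intro convex_linear_image) (auto intro: bounded_linear.linear bounded_linear_of_real)
  next
    fix z assume "z \<in> complex_of_real ` {x..y}"
    then obtain t where t: "z = of_real t" "x \<le> t" "t \<le> y" by auto
    show "((\<lambda>z. z powr (-s)) has_field_derivative (-s) * z powr (-s - 1)) (at z within complex_of_real ` {x..y})"
      using t assms by (auto intro!: derivative_eq_intros simp: complex_nonpos_Reals_iff)
    have "norm (z powr (-s - 1)) = t powr (- Re s - 1)"
      using t assms by (simp add: norm_powr_real_powr)
    also have "\<dots> \<le> x powr (- Re s - 1)" using t assms by (intro powr_mono2') auto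
    finally show "norm ((-s) * z powr (-s - 1)) \<le> norm s * x powr (- Re s - 1)"
      by (simp add: norm_mult mult_left_mono)
  qed (use assms in auto)
  then show ?thesis using assms by (simp flip: of_real_diff)
qed

text \<open>The series is summed in blocks of one period. The coefficients of a block cancel, so the
  k-th block has order \<open>k powr (- Re s - 1)\<close> and the blocks converge locally uniformly
  for Re s > 0.\<close>

lemma periodic_extension:
  fixes c :: "nat \<Rightarrow> complex"
  assumes per: "\<And>n. c (n + N) = c n" and N: "N > 0" and sum0: "(\<Sum>n<N. c n) = 0"
  shows "\<exists>L. L holomorphic_on {s. Re s > 0} \<and> (\<forall>s. Re s > 1 \<longrightarrow> L s = dser c s)"
proof -
  define C where "C = (\<Sum>n<N. norm (c n))"
  have cmod: "c n = c (n mod N)" for n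
  proof -
    have "c (m + k * N) = c m" for m k
    proof (induction k)
      case (Suc k)
      have "m + Suc k * N = (m + k * N) + N" by simp
      then show ?case using Suc per[of "m + k * N"] by (simp only:)
    qed simp
    from this[of "n mod N" "n div N"] show ?thesis by simp
  qed
  have Cn: "norm (c n) \<le> C" for n
    unfolding C_def by (subst cmod, rule member_le_sum) (use N in auto)
  have C0: "C \<ge> 0" unfolding C_def by (intro sum_nonneg) auto
  define B where "B k s = (\<Sum>n\<in>{k * N..<k * N + N}. c (Suc n) * of_nat (Suc n) powr (-s))" for k s
  have block0: "(\<Sum>n\<in>{k * N..<k * N + N}. c (Suc n)) = 0" for k
  proof -
    \<comment> \<open>The Dirichlet series begins at 1, whence \<open>Suc n\<close>; a shifted block
      is still a complete residue system.\<close>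
    have "(\<Sum>n\<in>{k * N..<k * N + N}. c (Suc n)) = (\<Sum>n<N. c n)"
    proof (rule sum.reindex_bij_betw[where h = "\<lambda>n. Suc n mod N" and g = c and S = "{k * N..<k * N + N}" and T = "{..<N}", unfolded cmod[symmetric]])
      show "bij_betw (\<lambda>n. Suc n mod N) {k * N..<k * N + N} {..<N}"
      proof (rule bij_betw_imageI)
        show inj: "inj_on (\<lambda>n. Suc n mod N) {k * N..<k * N + N}"
        proof (rule linorder_inj_onI')
          fix i j assume ij: "i \<in> {k * N..<k * N + N}" "j \<in> {k * N..<k * N + N}" "i < j"
          show "Suc i mod N \<noteq> Suc j mod N"
          proof
            assume "Suc i mod N = Suc j mod N"
            then have "N dvd Suc j - Suc i" using mod_eq_dvd_iff_nat[of "Suc i" "Suc j" N] ij by simp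
            then show False using ij by (auto dest: dvd_imp_le)
          qed
        qed
        have "(\<lambda>n. Suc n mod N) ` {k * N..<k * N + N} \<subseteq> {..<N}" using N by auto
        then show "(\<lambda>n. Suc n mod N) ` {k * N..<k * N + N} = {..<N}"
          using card_image[OF inj] by (intro card_subset_eq) auto
      qed
    qed
    then show ?thesis using sum0 by simp
  qed
  have Bbound: "norm (B k s) \<le> C * N * N * norm s * (Suc k) powr (- Re s - 1)" if s: "Re s > 0" for k s
  proof -
    \<comment> \<open>As the coefficients of a block sum to 0, the power at its last index may be
      subtracted from every power.\<close>
    have "B k s = (\<Sum>n\<in>{k * N..<k * N + N}. c (Suc n) * of_nat (Suc n) powr (-s))
        - (\<Sum>n\<in>{k * N..<k * N + N}. c (Suc n)) * of_nat (k * N + N) powr (-s)"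
      by (simp only: block0 B_def) simp
    also have "\<dots> = (\<Sum>n\<in>{k * N..<k * N + N}. c (Suc n) * (of_nat (Suc n) powr (-s) - of_nat (k * N + N) powr (-s)))"
      by (simp add: sum_distrib_right right_diff_distrib sum_subtractf del: of_nat_Suc)
    also have "norm \<dots> \<le> (\<Sum>n\<in>{k * N..<k * N + N}. C * (norm s * Suc k powr (- Re s - 1) * N))"
    proof (rule sum_norm_le)
      fix n assume n: "n \<in> {k * N..<k * N + N}"
      have "k * 1 \<le> k * N" using N by (intro mult_le_mono2) simp
      moreover have "k * N \<le> n" using n by simp
      ultimately have kn: "Suc k \<le> Suc n" by linarith
      have "Suc n \<le> k * N + N" "k * N + N \<le> Suc n + N" using n by simp_all
      then have n': "real (Suc n) \<le> real (k * N + N)" "real (k * N + N) \<le> real (Suc n + N)"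
        by (simp_all only: of_nat_le_iff)
      have "norm (of_real (real (Suc n)) powr (-s) - of_real (real (k * N + N)) powr (-s))
          \<le> norm s * real (Suc n) powr (- Re s - 1) * (real (k * N + N) - real (Suc n))"
        using n'(1) s by (intro norm_powr_diff_le) simp_all
      also have "\<dots> \<le> norm s * real (Suc k) powr (- Re s - 1) * N"
      proof (intro mult_mono)
        show "real (Suc n) powr (- Re s - 1) \<le> real (Suc k) powr (- Re s - 1)"
          using kn s by (intro powr_mono2') auto
        show "real (k * N + N) - real (Suc n) \<le> real N" using n'(2) by (simp only: of_nat_add)
      qed (use n'(1) in auto)
      finally have "norm (of_nat (Suc n) powr (-s) - of_nat (k * N + N) powr (-s) :: complex)
          \<le> norm s * real (Suc k) powr (- Re s - 1) * N" by (simp only: of_real_of_nat_eq)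
      then show "norm (c (Suc n) * (of_nat (Suc n) powr (-s) - of_nat (k * N + N) powr (-s)))
          \<le> C * (norm s * Suc k powr (- Re s - 1) * N)"
        unfolding norm_mult by (intro mult_mono Cn C0) auto
    qed
    finally show ?thesis by (simp add: mult_ac)
  qed
  define L where "L s = (\<Sum>k. B k s)" for s
  have "L holomorphic_on {s. Re s > 0}"
  proof (rule holomorphic_uniform_sequence[where f = "\<lambda>n s. \<Sum>k<n. B k s"])
    show "open {s. Re s > 0}" by (rule open_halfspace_Re_gt)
    show "(\<lambda>s. \<Sum>k<n. B k s) holomorphic_on {s. Re s > 0}" for n
      unfolding B_def by (intro holomorphic_intros)
    fix x assume "x \<in> {s. Re s > 0}"
    then have x: "Re x > 0" by simp
    define d where "d = Re x / 2"
    have d: "d > 0" using x by (simp add: d_def)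
    have Re_ge: "Re s \<ge> d" and norm_le: "norm s \<le> norm x + d" if "s \<in> cball x d" for s
    proof -
      have "norm (x - s) \<le> d" using that by (simp add: dist_norm)
      then show "norm s \<le> norm x + d" using norm_triangle_sub[of s x] by (simp add: norm_minus_commute)
      show "Re s \<ge> d" using \<open>norm (x - s) \<le> d\<close> abs_Re_le_cmod[of "x - s"] by (simp add: d_def)
    qed
    have "uniform_limit (cball x d) (\<lambda>n s. \<Sum>k<n. B k s) (\<lambda>s. suminf (\<lambda>k. B k s)) sequentially"
    proof (rule Weierstrass_m_test)
      fix k s assume s: "s \<in> cball x d"
      then have "Re s > 0" using Re_ge d by force
      then have "norm (B k s) \<le> C * N * N * norm s * (Suc k) powr (- Re s - 1)" by (rule Bbound)
      also have "\<dots> \<le> C * N * N * (norm x + d) * (Suc k) powr (- d - 1)"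
        using Re_ge[OF s] norm_le[OF s] C0 d by (intro mult_mono powr_mono) auto
      finally show "norm (B k s) \<le> C * N * N * (norm x + d) * (Suc k) powr (- d - 1)" .
    next
      have "summable (\<lambda>k. real (Suc k) powr (- d - 1))"
        using d by (subst summable_Suc_iff) (simp add: summable_real_powr_iff)
      then show "summable (\<lambda>k. C * N * N * (norm x + d) * (Suc k) powr (- d - 1))"
        by (rule summable_mult)
    qed
    moreover have "cball x d \<subseteq> {s. Re s > 0}" using Re_ge d by force
    ultimately show "\<exists>d>0. cball x d \<subseteq> {s. 0 < Re s} \<and> uniform_limit (cball x d) (\<lambda>n s. \<Sum>k<n. B k s) L sequentially"
      using d unfolding L_def by blast
  qed
  moreover have "L s = dser c s" if s: "Re s > 1" for s
  proof -
    have "dterm c s summable_on {1..}"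
      using dterm_bounded_summable[OF Cn s] by (rule abs_summable_summable)
    then have "(dterm c s has_sum dser c s) {1..}" unfolding dser_def by (rule has_sum_infsum)
    then have "((\<lambda>n. dterm c s (Suc n)) has_sum dser c s) UNIV"
      by (subst has_sum_reindex_bij_witness[where j = Suc and i = "\<lambda>n. n - 1" and T = "{1..}" and h = "dterm c s"]) auto
    then have "(\<lambda>n. dterm c s (Suc n)) sums dser c s" by (rule has_sum_imp_sums)
    from sums_group[OF this N] have "(\<lambda>k. B k s) sums dser c s" by (simp only: B_def dterm_def)
    then show ?thesis unfolding L_def by (simp add: sums_iff)
  qed
  ultimately show ?thesis by blast
qed

text \<open>The Taylor coefficients of \<open>w \<mapsto> H(2 - w)\<close> at 0 are nonnegative, so its Taylor series, which converges in the whole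
  disc, may be rearranged into the Dirichlet series.\<close>

lemma landau:
  fixes A :: "nat \<Rightarrow> real"
  assumes A: "\<And>n. n > 0 \<Longrightarrow> A n \<ge> 0"
    and sm: "\<And>t. t > 1 \<Longrightarrow> (\<lambda>n. A n * n powr (-t)) summable_on {1..}"
    and hol: "H holomorphic_on ball 2 2"
    and eq: "\<And>s. s \<in> ball 2 1 \<Longrightarrow> ((\<lambda>n. of_real (A n) * of_nat n powr (-s)) has_sum H s) {1..}"
    and t: "0 < t" "t < 2"
  shows "(\<lambda>n. A n * n powr (-t)) summable_on {1..}"
proof -
  \<comment> \<open>\<open>A n * n powr (-(2 - w))\<close> equals
    \<open>A n * n powr (-2) * exp (w * ln n)\<close>, so \<open>B n k\<close> is its k-th Taylor
    coefficient in w.\<close>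
  define B where "B n k = A n * n powr (-2) * ln n ^ k / fact k" for n k :: nat
  define c where "c k = infsum (\<lambda>n. B n k) {1..}" for k
  have B0: "B n k \<ge> 0" if "n \<in> {1..}" for n k
    unfolding B_def using A[of n] that by auto
  have exp_sums: "(\<lambda>k. of_real (B n k) * w ^ k) sums (of_real (A n) * of_nat n powr (-(2 - w)))"
    if n: "n \<in> {1..}" for n and w :: complex
  proof -
    have "(\<lambda>k. of_real (A n * n powr (-2)) * ((w * of_real (ln n)) ^ k /\<^sub>R fact k))
        sums (of_real (A n * n powr (-2)) * exp (w * of_real (ln n)))"
      by (intro sums_mult exp_converges)
    also have "exp (w * of_real (ln n)) = of_nat n powr w"
      using n by (simp add: powr_def mult.commute flip: Ln_of_nat)
    also have "of_real (A n * n powr (-2)) * of_nat n powr w = of_real (A n) * of_nat n powr (-(2 - w))"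
      using n by (simp add: powr_diff powr_minus field_simps flip: powr_of_real)
    finally show ?thesis
      by (rule sums_cong[THEN iffD1, rotated]) (simp add: B_def power_mult_distrib scaleR_conv_of_real field_simps)
  qed
  have exp_sums_real: "(\<lambda>k. B n k * u ^ k) sums (A n * n powr (-(2 - u)))" if n: "n \<in> {1..}" for n and u :: real
  proof -
    have "(\<lambda>k. A n * n powr (-2) * ((u * ln n) ^ k /\<^sub>R fact k)) sums (A n * n powr (-2) * exp (u * ln n))"
      by (intro sums_mult exp_converges)
    also have "A n * n powr (-2) * exp (u * ln n) = A n * n powr (-(2 - u))"
      using n by (simp add: powr_def exp_diff exp_minus field_simps flip: exp_add)
    finally show ?thesis
      by (rule sums_cong[THEN iffD1, rotated]) (simp add: B_def power_mult_distrib field_simps)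
  qed
  \<comment> \<open>One term of the exponential series at 1/2 is at most its sum; this compares with
    the given series at 3/2 > 1.\<close>
  have Bsum: "(\<lambda>n. B n k) summable_on {1..}" for k
  proof (rule summable_on_comparison_test)
    show "(\<lambda>n. 2 ^ k * (A n * n powr (-(3 / 2)))) summable_on {1..}"
      by (intro summable_on_cmult_right sm) auto
    fix n :: nat assume n: "n \<in> {1..}"
    have "B n k * (1 / 2) ^ k \<le> A n * n powr (-(2 - 1 / 2))"
      using sum_le_suminf[OF sums_summable[OF exp_sums_real[OF n, of "1 / 2"]], of "{k}"] B0[OF n]
        sums_unique[OF exp_sums_real[OF n, of "1 / 2"]] by simp
    then show "B n k \<le> 2 ^ k * (A n * n powr (-(3 / 2)))"
      by (simp add: field_simps)
  qed (use B0 in auto)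
  have series: "(\<lambda>k. of_real (c k) * w ^ k) sums H (2 - w)" if w: "norm w < 1" for w
  proof -
    let ?g = "\<lambda>(n, k). of_real (B n k) * w ^ k"
    have hs: "((\<lambda>k. ?g (n, k)) has_sum (of_real (A n) * of_nat n powr (-(2 - w)))) UNIV" if n: "n \<in> {1..}" for n
    proof -
      have "summable (\<lambda>k. norm (?g (n, k)))"
        using sums_summable[OF exp_sums_real[OF n, of "norm w"]] B0[OF n]
        by (simp add: norm_mult norm_power)
      then show ?thesis using norm_summable_imp_has_sum exp_sums[OF n, of w] by auto
    qed
    have nhs: "((\<lambda>k. norm (?g (n, k))) has_sum (A n * n powr (-(2 - norm w)))) UNIV" if n: "n \<in> {1..}" for n
      using sums_nonneg_imp_has_sum[OF exp_sums_real[OF n, of "norm w"]] B0[OF n]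
      by (simp add: norm_mult norm_power)
    \<comment> \<open>Taking norms replaces w by \<open>norm w\<close>, and the double series
      becomes the original one at the real point \<open>2 - norm w\<close>, which exceeds 1.\<close>
    have "(\<lambda>x. norm (?g x)) summable_on ({1..} \<times> UNIV)"
      unfolding Infinite_Sum.abs_summable_on_Sigma_iff
    proof (intro conjI ballI)
      show "(\<lambda>k. norm (?g (n, k))) summable_on UNIV" if "n \<in> {1..}" for n
        using nhs[OF that] has_sum_imp_summable by blast
      have "(\<lambda>n. norm (infsum (\<lambda>k. norm (?g (n, k))) UNIV)) summable_on {1..}
          \<longleftrightarrow> (\<lambda>n. A n * n powr (-(2 - norm w))) summable_on {1..}"
      proof (rule summable_on_cong)
        fix n :: nat assume n: "n \<in> {1..}"
        then show "norm (infsum (\<lambda>k. norm (?g (n, k))) UNIV) = A n * n powr (-(2 - norm w))"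
          unfolding infsumI[OF nhs[OF n]] using A[of n] by simp
      qed
      then show "(\<lambda>n. norm (infsum (\<lambda>k. norm (?g (n, k))) UNIV)) summable_on {1..}"
        using sm[of "2 - norm w"] w by simp
    qed
    then have "?g summable_on ({1..} \<times> UNIV)" by (rule abs_summable_summable)
    moreover have "((\<lambda>n. of_real (A n) * of_nat n powr (-(2 - w))) has_sum H (2 - w)) {1..}"
      using w by (intro eq) (simp add: dist_norm)
    ultimately have "(?g has_sum H (2 - w)) ({1..} \<times> UNIV)"
      using hs by (intro has_sum_SigmaI) auto
    then have "((\<lambda>(k, n). ?g (n, k)) has_sum H (2 - w)) (UNIV \<times> {1..})"
      by (subst has_sum_reindex_bij_witness[where i = prod.swap and j = prod.swap and h = ?g and T = "{1..} \<times> UNIV"]) auto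
    then have "((\<lambda>k. of_real (c k) * w ^ k) has_sum H (2 - w)) UNIV"
    proof (rule has_sum_SigmaD)
      fix k
      show "((\<lambda>n. (\<lambda>(k, n). ?g (n, k)) (k, n)) has_sum of_real (c k) * w ^ k) {1..}"
        using has_sum_cmult_left[OF has_sum_of_real[OF has_sum_infsum[OF Bsum[of k]]], of "w ^ k"]
        by (simp add: c_def)
    qed
    then show ?thesis by (rule has_sum_imp_sums)
  qed
  have "(\<lambda>w. H (2 - w)) has_fps_expansion Abs_fps (\<lambda>k. of_real (c k))"
  proof (rule has_fps_expansionI)
    have "eventually (\<lambda>w. w \<in> ball 0 1) (nhds (0 :: complex))"
      by (intro eventually_nhds_in_open) auto
    then show "eventually (\<lambda>w. (\<lambda>k. fps_nth (Abs_fps (\<lambda>k. of_real (c k))) k * w ^ k) sums H (2 - w)) (nhds 0)"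
      by eventually_elim (use series in auto)
  qed
  moreover have "(\<lambda>w. H (2 - w)) holomorphic_on eball 0 2"
  proof -
    have "(H \<circ> (\<lambda>w. 2 - w)) holomorphic_on ball 0 2"
      by (rule holomorphic_on_compose_gen[OF _ hol]) (auto intro!: holomorphic_intros simp: dist_norm)
    then show ?thesis by (simp add: o_def)
  qed
  moreover have "ereal (norm (complex_of_real (2 - t))) < 2"
    unfolding norm_of_real using t by simp
  ultimately have "(\<lambda>k. fps_nth (Abs_fps (\<lambda>k. of_real (c k))) k * of_real (2 - t) ^ k) sums H (2 - of_real (2 - t))"
    by (rule has_fps_expansion_imp_sums_complex)
  then have "summable (\<lambda>k. complex_of_real (c k * (2 - t) ^ k))" by (simp add: sums_iff)
  then have smc: "summable (\<lambda>k. c k * (2 - t) ^ k)" by (simp only: summable_complex_of_real)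
  \<comment> \<open>At w = 2 - t all terms are nonnegative, so bounding the sums over finite sets F
    by the Taylor series suffices.\<close>
  show ?thesis
  proof (rule nonneg_bdd_above_summable_on)
    show "bdd_above (sum (\<lambda>n. A n * n powr (-t)) ` {F. F \<subseteq> {1..} \<and> finite F})"
    proof (rule bdd_aboveI2)
      fix F :: "nat set" assume "F \<in> {F. F \<subseteq> {1..} \<and> finite F}"
      then have F: "F \<subseteq> {1..}" "finite F" by auto
      have "(\<lambda>k. \<Sum>n\<in>F. B n k * (2 - t) ^ k) sums (\<Sum>n\<in>F. A n * n powr (-(2 - (2 - t))))"
        by (intro sums_sum exp_sums_real) (use F in auto)
      then have sF: "(\<lambda>k. \<Sum>n\<in>F. B n k * (2 - t) ^ k) sums (\<Sum>n\<in>F. A n * n powr (-t))" by simp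
      show "(\<Sum>n\<in>F. A n * n powr (-t)) \<le> (\<Sum>k. c k * (2 - t) ^ k)"
      proof (rule sums_le[OF _ sF summable_sums[OF smc]])
        fix k
        show "(\<Sum>n\<in>F. B n k * (2 - t) ^ k) \<le> c k * (2 - t) ^ k"
        unfolding sum_distrib_right[symmetric] c_def
          using t F Bsum B0 by (intro mult_right_mono finite_sum_le_infsum) auto
      qed
    qed
  qed (use A in auto)
qed

section \<open>Primes congruent to 1\<close>

lemma dser_cong: "(\<And>n. n > 0 \<Longrightarrow> f n = g n) \<Longrightarrow> dser f s = dser g s"
  unfolding dser_def dterm_def by (intro infsum_cong) auto

text \<open>The factor \<open>1 - 2\<^bsup>1-s\<^esup>\<close> removes the pole of the principal series: the product has coefficients of period
  \<open>2b\<close> that sum to 0 over a period.\<close>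

lemma dirichlet_char_extension:
  assumes b: "b > 0" and \<xi>: "\<xi> \<in> dirichlet_chars b"
  shows "\<exists>L. L holomorphic_on {s. Re s > 0} \<and>
    (\<forall>s. Re s > 1 \<longrightarrow> L s = (if \<xi> = principal_char b then 1 - 2 powr (1 - s) else 1) * dser \<xi> s)"
proof (cases "\<xi> = principal_char b")
  case False
  then show ?thesis
    using periodic_extension[OF dirichlet_charsD(2)[OF \<xi>] b sum_dirichlet_char[OF \<xi> b False]] by simp
next
  case True
  \<comment> \<open>u is the Dirichlet polynomial 1 - 2 * 2^(-s). Its convolution with
    \<open>\<xi>\<close> is written out as c, so that periodicity extends to the argument 0, where a
    convolution is 0 by default.\<close>
  define u :: "nat \<Rightarrow> complex" where "u n = (if n = 1 then 1 else if n = 2 then -2 else 0)" for n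
  define c where "c n = \<xi> n - (if even n then 2 * \<xi> (n div 2) else 0)" for n
  have c_eq: "(u \<star> \<xi>) n = c n" if n: "n > 0" for n
  proof -
    have "(u \<star> \<xi>) n = (\<Sum>d | d dvd n \<and> d \<in> {1, 2}. u d * \<xi> (n div d))"
      unfolding dconv_def using n by (intro sum.mono_neutral_right) (auto simp: u_def)
    also have "{d. d dvd n \<and> d \<in> {1, 2}} = (if even n then {1, 2} else {1})" by auto
    finally have eq: "(u \<star> \<xi>) n = (\<Sum>d\<in>(if even n then {1, 2} else {1}). u d * \<xi> (n div d))" .
    have "u 1 = 1" "u 2 = -2" by (simp_all add: u_def)
    then show ?thesis unfolding eq by (cases "even n") (simp_all add: c_def)
  qed
  have u_bound: "norm (u n) \<le> 2" for n by (simp add: u_def)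
  have du: "dser u s = 1 - 2 powr (1 - s)" for s
  proof -
    have "(dterm u s has_sum (\<Sum>n\<in>{1, 2}. dterm u s n)) {1, 2}" by (rule has_sum_finite) simp
    moreover have "(\<Sum>n\<in>{1, 2}. dterm u s n) = 1 - 2 powr (1 - s)"
      by (simp add: dterm_def u_def powr_diff powr_minus field_simps)
    moreover have "(dterm u s has_sum x) {1..} \<longleftrightarrow> (dterm u s has_sum x) {1, 2}" for x
      by (rule has_sum_cong_neutral) (auto simp: dterm_def u_def)
    ultimately show ?thesis unfolding dser_def by (intro infsumI) simp
  qed
  have "\<exists>L. L holomorphic_on {s. Re s > 0} \<and> (\<forall>s. Re s > 1 \<longrightarrow> L s = dser c s)"
  proof (rule periodic_extension[of c "2 * b"])
    fix n
    have "\<xi> (n + 2 * b) = \<xi> n"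
      using dirichlet_charsD(2)[OF \<xi>, of n] dirichlet_charsD(2)[OF \<xi>, of "n + b"] by (simp add: mult_2 add.assoc)
    moreover have "(n + 2 * b) div 2 = n div 2 + b" by simp
    ultimately show "c (n + 2 * b) = c n" using dirichlet_charsD(2)[OF \<xi>, of "n div 2"] by (simp add: c_def)
  next
    \<comment> \<open>The even terms give twice the sum of \<open>\<xi>\<close> over one period,
      which is its sum over n < 2 b; the two cancel in c.\<close>
    have "(\<Sum>n<2 * b. if even n then 2 * \<xi> (n div 2) else 0) = (\<Sum>n | n < 2 * b \<and> even n. 2 * \<xi> (n div 2))"
      by (simp add: sum.inter_filter[symmetric] lessThan_def)
    also have "\<dots> = (\<Sum>n<b. 2 * \<xi> n)"
      by (rule sum.reindex_bij_witness[where i = "\<lambda>n. 2 * n" and j = "\<lambda>n. n div 2"]) auto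
    also have "\<dots> = (\<Sum>n<b. \<xi> n) + (\<Sum>n<b. \<xi> (n + b))"
      using dirichlet_charsD(2)[OF \<xi>] by (simp add: sum_distrib_left[symmetric])
    also have "(\<Sum>n<b. \<xi> (n + b)) = (\<Sum>n\<in>{b..<2 * b}. \<xi> n)"
      by (rule sum.reindex_bij_witness[where i = "\<lambda>n. n - b" and j = "\<lambda>n. n + b"]) auto
    also have "(\<Sum>n<b. \<xi> n) + (\<Sum>n\<in>{b..<2 * b}. \<xi> n) = (\<Sum>n<2 * b. \<xi> n)"
      by (simp add: lessThan_atLeast0 sum.atLeastLessThan_concat)
    finally show "(\<Sum>n<2 * b. c n) = 0" by (simp add: c_def sum_subtractf)
  qed (use b in simp)
  moreover have "dser c s = (1 - 2 powr (1 - s)) * dser \<xi> s" if s: "Re s > 1" for s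
  proof -
    have "dser c s = dser (u \<star> \<xi>) s" by (rule dser_cong) (simp add: c_eq)
    also have "\<dots> = dser u s * dser \<xi> s"
      using dterm_bounded_summable[of u 2, OF u_bound s]
        dterm_bounded_summable[of \<xi> 1, OF norm_dirichlet_char_le[OF \<xi> b] s] by (rule dser_dconv)
    finally show ?thesis by (simp add: du)
  qed
  ultimately show ?thesis using True by auto
qed

lemma
  assumes b: "b > 0" and s: "Re s > 1"
  shows dterm_char_conv_summable: "(\<lambda>n. norm (dterm (char_conv b) s n)) summable_on {1..}"
    and dser_char_conv: "dser (char_conv b) s = (\<Prod>\<xi>\<in>dirichlet_chars b. dser \<xi> s)"
proof -
  have *: "(\<lambda>n. norm (dterm \<xi> s n)) summable_on {1..}" if "\<xi> \<in> set (char_list b)" for \<xi>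
  proof (rule dterm_bounded_summable[OF _ s])
    show "norm (\<xi> n) \<le> 1" for n
      using that char_list(1)[OF b] norm_dirichlet_char_le[OF _ b] by blast
  qed
  show "(\<lambda>n. norm (dterm (char_conv b) s n)) summable_on {1..}"
    unfolding char_conv_def using * by (rule dterm_list_summable)
  have "dser (char_conv b) s = (\<Prod>\<xi>\<leftarrow>char_list b. dser \<xi> s)"
    unfolding char_conv_def using * by (rule dser_list)
  then show "dser (char_conv b) s = (\<Prod>\<xi>\<in>dirichlet_chars b. dser \<xi> s)"
    using char_list[OF b] by (metis prod.distinct_set_conv_list)
qed

text \<open>The solutions are 1 + 2 pi i n / ln 2. Their spacing exceeds 2, while |Im s| < 2 in the
  ball, so the auxiliary factor 1 - 2^(1-s) creates no new poles there.\<close>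

lemma two_powr_eq_1:
  assumes "2 powr (1 - s) = (1 :: complex)" "s \<in> ball 2 2"
  shows "s = 1"
proof -
  have "Ln 2 = of_real (ln 2)" using Ln_of_real[of 2] by simp
  then have "exp ((1 - s) * of_real (ln 2)) = 1" using assms(1) by (simp add: powr_def)
  then obtain n :: int where n: "(1 - Re s) * ln 2 = 0" "- Im s * ln 2 = of_int (2 * n) * pi"
    by (auto simp: exp_eq_1)
  have "norm (2 - s) < 2" using assms(2) by (simp add: dist_norm)
  then have "\<bar>Im s\<bar> < 2" using abs_Im_le_cmod[of "2 - s"] by simp
  moreover have "ln (2::real) \<le> 1" using ln_le_minus_one[of 2] by simp
  ultimately have "\<bar>Im s\<bar> * ln 2 \<le> 2 * 1" by (intro mult_mono) auto
  then have "\<bar>of_int n\<bar> * (2 * pi) \<le> 2" using arg_cong[OF n(2), of abs] by (simp add: abs_mult)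
  then have "\<bar>of_int n\<bar> * pi < 1 * pi" using pi_gt3 by linarith
  then have "n = 0" using pi_gt_zero by (simp add: mult_less_cancel_right_pos del: mult_1_left)
  then show ?thesis using n by (simp add: complex_eq_iff)
qed

theorem prime_reciprocals_unbounded:
  assumes b: "b > 0"
  shows "\<not> (\<forall>N. (\<Sum>p | p \<le> N \<and> prime p \<and> [p = 1] (mod b). 1 / real p) \<le> B)"
proof
  assume B: "\<forall>N. (\<Sum>p | p \<le> N \<and> prime p \<and> [p = 1] (mod b). 1 / real p) \<le> B"
  define A where "A n = Re (char_conv b n)" for n
  have A: "char_conv b n = of_real (A n)" "A n \<ge> 0" if "n > 0" for n
    using char_conv_nonneg[OF b that] by (auto simp: A_def less_eq_complex_def complex_eq_iff)
  define S where "S = exp (totient b * (B + 1))"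
  have AS: "(\<Sum>n=1..N. A n / n) \<le> S" for N
    unfolding A_def S_def by (rule sum_char_conv_le[OF b]) (use B in blast)
  have smA: "(\<lambda>n. A n * n powr (-t)) summable_on {1..}" if t: "t > 1" for t
  proof -
    have "(\<lambda>n. norm (dterm (char_conv b) (of_real t) n)) summable_on {1..}"
      using t by (intro dterm_char_conv_summable[OF b]) simp
    moreover have "(\<lambda>n. norm (dterm (char_conv b) (of_real t) n)) summable_on {1..}
        \<longleftrightarrow> (\<lambda>n. A n * n powr (-t)) summable_on {1..}"
      by (rule summable_on_cong) (use A in \<open>simp add: norm_dterm\<close>)
    ultimately show ?thesis by blast
  qed
  have F_bound: "norm (dser (char_conv b) (of_real t)) \<le> S" if t: "t > 1" for t
  proof -
    have "norm (dser (char_conv b) (of_real t)) \<le> infsum (\<lambda>n. norm (dterm (char_conv b) (of_real t) n)) {1..}"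
      unfolding dser_def using t by (intro norm_infsum_bound dterm_char_conv_summable[OF b]) simp
    also have "\<dots> = infsum (\<lambda>n. A n * n powr (-t)) {1..}"
      using A by (intro infsum_cong) (auto simp: norm_dterm)
    also have "\<dots> \<le> S"
    proof (rule infsum_le_finite_sums[OF smA[OF t]])
      fix F :: "nat set" assume F: "finite F" "F \<subseteq> {1..}"
      have "(\<Sum>n\<in>F. A n * n powr (-t)) \<le> (\<Sum>n\<in>F. A n / n)"
      proof (rule sum_mono)
        fix n assume "n \<in> F"
        then have n: "n > 0" using F by auto
        have "n powr (-t) \<le> n powr (-1)" using n t by (intro powr_mono) auto
        then show "A n * n powr (-t) \<le> A n / n"
          using mult_left_mono[OF _ A(2)[OF n], of "n powr (-t)" "n powr (-1)"] n by (simp add: powr_minus divide_inverse)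
      qed
      also have "\<dots> \<le> (\<Sum>n=1..Max (insert 0 F). A n / n)"
        using F A by (intro sum_mono2) auto
      also have "\<dots> \<le> S" by (rule AS)
      finally show "(\<Sum>n\<in>F. A n * n powr (-t)) \<le> S" .
    qed
    finally show ?thesis .
  qed
  define D :: "complex \<Rightarrow> complex" where "D s = 1 - 2 powr (1 - s)" for s
  have "\<forall>\<xi>\<in>dirichlet_chars b. \<exists>L. L holomorphic_on {s. Re s > 0} \<and>
    (\<forall>s. Re s > 1 \<longrightarrow> L s = (if \<xi> = principal_char b then D s else 1) * dser \<xi> s)"
    unfolding D_def by (intro ballI dirichlet_char_extension b)
  from bchoice[OF this] obtain L where L': "\<forall>\<xi>\<in>dirichlet_chars b. L \<xi> holomorphic_on {s. Re s > 0} \<and>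
    (\<forall>s. Re s > 1 \<longrightarrow> L \<xi> s = (if \<xi> = principal_char b then D s else 1) * dser \<xi> s)"
    by (elim exE) (rule that)
  have L: "L \<xi> holomorphic_on {s. Re s > 0}"
    "Re s > 1 \<Longrightarrow> L \<xi> s = (if \<xi> = principal_char b then D s else 1) * dser \<xi> s"
    if "\<xi> \<in> dirichlet_chars b" for \<xi> s
    using bspec[OF L' that] by simp_all
  \<comment> \<open>E continues D times the product series to Re s > 0; the factor D comes from the
    principal character alone.\<close>
  define E where "E s = (\<Prod>\<xi>\<in>dirichlet_chars b. L \<xi> s)" for s
  have holE: "E holomorphic_on {s. Re s > 0}"
    unfolding E_def by (intro holomorphic_on_prod L)
  have E_eq: "E s = D s * dser (char_conv b) s" if s: "Re s > 1" for s
    unfolding E_def dser_char_conv[OF b s]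
    using L(2)[OF _ s] principal_char[OF b] finite_dirichlet_chars[OF b]
    by (simp add: prod.distrib prod.delta)
  have holD: "D holomorphic_on UNIV" unfolding D_def by (intro holomorphic_intros) auto
  \<comment> \<open>Here the hypothetical bound enters: the product series stays below S as s
    decreases to 1, while D tends to 0.\<close>
  have E1: "E 1 = 0"
  proof -
    define z where "z k = complex_of_real (1 + 1 / Suc k)" for k
    have z: "z \<longlonglongrightarrow> 1"
    proof -
      have "z \<longlonglongrightarrow> complex_of_real (1 + 0)"
        unfolding z_def by (intro tendsto_of_real tendsto_add tendsto_const LIMSEQ_Suc lim_1_over_n)
      then show ?thesis by simp
    qed
    have "isCont E 1"
      using holomorphic_on_imp_continuous_on[OF holE] continuous_on_eq_continuous_at[OF open_halfspace_Re_gt[of 0], of E]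
      by simp
    then have "(\<lambda>k. E (z k)) \<longlonglongrightarrow> E 1" by (rule isCont_tendsto_compose[OF _ z])
    moreover have "(\<lambda>k. E (z k)) \<longlonglongrightarrow> 0"
    proof (rule Lim_null_comparison)
      show "\<forall>\<^sub>F k in sequentially. norm (E (z k)) \<le> norm (D (z k)) * S"
        using F_bound by (intro always_eventually allI) (simp add: E_eq z_def norm_mult mult_left_mono del: of_real_add)
      have "isCont D 1"
        using holomorphic_on_imp_continuous_on[OF holD] continuous_on_eq_continuous_at[OF open_UNIV, of D] by simp
      then have "(\<lambda>k. D (z k)) \<longlonglongrightarrow> D 1" by (rule isCont_tendsto_compose[OF _ z])
      then have "(\<lambda>k. norm (D (z k)) * S) \<longlonglongrightarrow> norm (D 1) * S" by (intro tendsto_intros)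
      then show "(\<lambda>k. norm (D (z k)) * S) \<longlonglongrightarrow> 0" by (simp add: D_def)
    qed
    ultimately show ?thesis by (rule LIMSEQ_unique)
  qed
  have D1: "D 1 = 0" by (simp add: D_def)
  \<comment> \<open>The zero of D is simple, so the single zero of E just found is enough to cancel
    it.\<close>
  have dD: "deriv D 1 \<noteq> 0"
  proof -
    have "(D has_field_derivative of_real (ln 2)) (at 1)"
    proof -
      have "Ln 2 = of_real (ln 2)" using Ln_of_real[of 2] by simp
      then have "D = (\<lambda>s. 1 - exp ((1 - s) * of_real (ln 2)))" by (simp add: D_def fun_eq_iff powr_def)
      then show ?thesis by (auto intro!: derivative_eq_intros)
    qed
    then show ?thesis by (simp add: DERIV_imp_deriv)
  qed
  have ball_pos: "Re s > 0" if "s \<in> ball 2 2" for s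
  proof -
    have "norm (2 - s) < 2" using that by (simp add: dist_norm)
    then show ?thesis using abs_Re_le_cmod[of "2 - s"] by simp
  qed
  \<comment> \<open>Both zeros at 1 are divided out as difference quotients, completed by the
    derivative at 1. The quotient of the two agrees with the product series where that
    converges.\<close>
  define E' where "E' s = (if s = 1 then deriv E 1 else (E s - E 1) / (s - 1))" for s
  define D' where "D' s = (if s = 1 then deriv D 1 else (D s - D 1) / (s - 1))" for s
  have one: "(1 :: complex) \<in> interior (ball 2 2)" by (simp add: dist_norm interior_open)
  have "E' holomorphic_on ball 2 2" unfolding E'_def
    using ball_pos by (intro pole_lemma[OF holomorphic_on_subset[OF holE] one]) auto
  moreover have "D' holomorphic_on ball 2 2" unfolding D'_def
    by (intro pole_lemma[OF holomorphic_on_subset[OF holD] one]) auto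
  moreover have "D' s \<noteq> 0" if "s \<in> ball 2 2" for s
    using two_powr_eq_1[OF _ that] dD by (auto simp: D'_def D1) (auto simp: D_def)
  ultimately have holH: "(\<lambda>s. E' s / D' s) holomorphic_on ball 2 2" by (intro holomorphic_on_divide)
  have smA': "(\<lambda>n. A n * n powr (-(1 / totient b))) summable_on {1..}"
  proof (rule landau[where H = "\<lambda>s. E' s / D' s"])
    fix s :: complex assume "s \<in> ball 2 1"
    then have "norm (2 - s) < 1" by (simp add: dist_norm)
    then have s: "Re s > 1" "s \<in> ball 2 2" "s \<noteq> 1"
      using abs_Re_le_cmod[of "2 - s"] by (auto simp: dist_norm)
    have "D s \<noteq> 0" using two_powr_eq_1[of s] s by (auto simp: D_def)
    then have "E' s / D' s = dser (char_conv b) s"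
      using s E_eq[OF s(1)] by (simp add: E'_def D'_def E1 D1)
    moreover have "(dterm (char_conv b) s has_sum dser (char_conv b) s) {1..}"
      unfolding dser_def by (rule has_sum_infsum[OF abs_summable_summable[OF dterm_char_conv_summable[OF b s(1)]]])
    ultimately show "((\<lambda>n. of_real (A n) * of_nat n powr (-s)) has_sum E' s / D' s) {1..}"
      using A(1) by (subst has_sum_cong[of _ _ "dterm (char_conv b) s"]) (auto simp: dterm_def)
  next
    have "real (totient b) \<ge> 1" using b totient_gt_0_iff[of b] by linarith
    then show "0 < 1 / real (totient b)" "1 / real (totient b) < 2" by (simp_all add: divide_less_eq b)
  qed (use A(2) smA holH in auto)
  define T where "T = infsum (\<lambda>n. A n * n powr (-(1 / totient b))) {1..}"
  have tot: "totient b > 0" using b by simp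
  have "(\<Sum>k<K. inverse (of_nat (Suc k))) \<le> (b + 1) * T" for K
  proof -
    let ?f = "\<lambda>k. (1 + b * k) ^ totient b"
    have inj: "inj_on ?f {..<K}"
      using tot b by (auto intro!: inj_onI dest: power_eq_imp_eq_base)
    have "(\<Sum>k<K. 1 / real (1 + b * k)) \<le> (\<Sum>k<K. A (?f k) * real (?f k) powr (-(1 / totient b)))"
    proof (rule sum_mono)
      fix k
      have "coprime (1 + b * k) b"
      proof (rule coprimeI)
        fix c assume "c dvd 1 + b * k" "c dvd b"
        then show "is_unit c" using dvd_add_left_iff[of c "b * k" 1] by simp
      qed
      then have "\<exists>r. coprime r b \<and> ?f k = r ^ totient b" by blast
      then have "char_conv b (?f k) \<ge> of_real 1" using char_conv_ge[OF b, of "?f k"] by (simp only: if_True) simp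
      then have "A (?f k) \<ge> 1" by (simp add: A_def less_eq_complex_def)
      moreover have "real (?f k) powr (-(1 / totient b)) = 1 / real (1 + b * k)"
      proof -
        have "real (?f k) = real (1 + b * k) powr real (totient b)"
          by (subst powr_realpow) (simp_all add: add_pos_nonneg)
        then show ?thesis using tot by (simp only: powr_powr) (simp add: powr_minus divide_inverse add_pos_nonneg)
      qed
      ultimately show "1 / real (1 + b * k) \<le> A (?f k) * real (?f k) powr (-(1 / totient b))"
        using mult_right_mono[of 1 "A (?f k)" "1 / real (1 + b * k)"] by simp
    qed
    also have "\<dots> = (\<Sum>n\<in>?f ` {..<K}. A n * n powr (-(1 / totient b)))"
      using inj by (simp add: sum.reindex)
    also have "\<dots> \<le> T" unfolding T_def
      using smA' A by (intro finite_sum_le_infsum) auto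
    finally have T: "(\<Sum>k<K. 1 / real (1 + b * k)) \<le> T" .
    have "(\<Sum>k<K. inverse (of_nat (Suc k))) \<le> (\<Sum>k<K. (b + 1) * (1 / real (1 + b * k)))"
    proof (rule sum_mono)
      fix k
      have "1 + b * k \<le> (b + 1) * (k + 1)" by (simp add: algebra_simps)
      then have "real (1 + b * k) \<le> real ((b + 1) * (k + 1))" by (simp only: of_nat_le_iff)
      moreover have "inverse y \<le> z * (1 / x)" if "x \<le> z * y" "x > 0" "y > 0" for x y z :: real
        using that by (simp add: field_simps)
      from this[of "real (1 + b * k)" "real (b + 1)" "real (k + 1)"]
      have "real (1 + b * k) \<le> real ((b + 1) * (k + 1)) \<Longrightarrow> inverse (real (k + 1)) \<le> real (b + 1) * (1 / real (1 + b * k))"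
        by (simp only: of_nat_mult of_nat_0_less_iff)
      ultimately show "inverse (of_nat (Suc k)) \<le> (b + 1) * (1 / real (1 + b * k))" by simp
    qed
    also have "\<dots> \<le> (b + 1) * T" using T by (simp only: sum_distrib_left[symmetric]) (rule mult_left_mono, auto)
    finally show ?thesis .
  qed
  then have "summable (\<lambda>k. inverse (real (Suc k)))"
    by (intro summableI_nonneg_bounded) auto
  then have "summable (\<lambda>k. inverse (real k))" by (subst (asm) summable_Suc_iff)
  then show False using not_summable_harmonic[where 'a = real] by simp
qed

section \<open>Eigenvalues of Hermitian matrices\<close>

text \<open>Vectors are plain functions of which only the values below n matter; combinations and
  restrictions to index sets then need no dimension bookkeeping.\<close>

definition cinner :: "nat \<Rightarrow> (nat \<Rightarrow> complex) \<Rightarrow> (nat \<Rightarrow> complex) \<Rightarrow> complex" where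
  "cinner n v w = (\<Sum>i<n. v i * cnj (w i))"

definition mat_app :: "complex mat \<Rightarrow> nat \<Rightarrow> (nat \<Rightarrow> complex) \<Rightarrow> nat \<Rightarrow> complex" where
  "mat_app A n v i = (\<Sum>j<n. A $$ (i, j) * v j)"

lemma cinner_simps:
  "cinner n (\<lambda>i. v i + w i) u = cinner n v u + cinner n w u"
  "cinner n (\<lambda>i. v i - w i) u = cinner n v u - cinner n w u"
  "cinner n (\<lambda>i. c * v i) u = c * cinner n v u"
  by (simp_all add: cinner_def sum.distrib sum_subtractf sum_distrib_left ring_distribs mult.assoc)

lemma cinner_sum: "cinner n (\<lambda>i. \<Sum>k\<in>K. v k i) u = (\<Sum>k\<in>K. cinner n (v k) u)"
  unfolding cinner_def sum_distrib_right by (rule sum.swap)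

lemma cinner_commute: "cinner n v w = cnj (cinner n w v)"
  by (simp add: cinner_def mult.commute)

lemma cinner_cong: "(\<And>i. i < n \<Longrightarrow> v i = v' i) \<Longrightarrow> (\<And>i. i < n \<Longrightarrow> w i = w' i) \<Longrightarrow> cinner n v w = cinner n v' w'"
  by (simp add: cinner_def)

lemma cinner_self: "cinner n v v = of_real (\<Sum>i<n. (norm (v i))\<^sup>2)"
  by (simp add: cinner_def complex_norm_square del: of_real_power)

lemma mat_app_simps:
  "mat_app A n (\<lambda>i. v i + w i) i = mat_app A n v i + mat_app A n w i"
  "mat_app A n (\<lambda>i. v i - w i) i = mat_app A n v i - mat_app A n w i"
  "mat_app A n (\<lambda>i. c * v i) i = c * mat_app A n v i"
  by (simp_all add: mat_app_def sum.distrib sum_subtractf sum_distrib_left ring_distribs mult.left_commute)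

lemma mat_app_sum: "mat_app A n (\<lambda>i. \<Sum>k\<in>K. v k i) i = (\<Sum>k\<in>K. mat_app A n (v k) i)"
  unfolding mat_app_def sum_distrib_left by (rule sum.swap)

lemma cinner_mat_app:
  assumes "\<And>i j. i < n \<Longrightarrow> j < n \<Longrightarrow> A $$ (i, j) = cnj (A $$ (j, i))"
  shows "cinner n (mat_app A n v) w = cinner n v (mat_app A n w)"
proof -
  have "cinner n (mat_app A n v) w = (\<Sum>i<n. \<Sum>j<n. A $$ (i, j) * v j * cnj (w i))"
    by (simp add: cinner_def mat_app_def sum_distrib_right)
  also have "\<dots> = (\<Sum>j<n. \<Sum>i<n. A $$ (i, j) * v j * cnj (w i))" by (rule sum.swap)
  also have "\<dots> = (\<Sum>j<n. \<Sum>i<n. cnj (A $$ (j, i)) * v j * cnj (w i))"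
    by (intro sum.cong refl arg_cong2[where f = "(*)"] assms) auto
  also have "\<dots> = cinner n v (mat_app A n w)"
    unfolding cinner_def mat_app_def cnj_sum complex_cnj_mult sum_distrib_left
    by (intro sum.cong refl) (simp add: mult_ac)
  finally show ?thesis .
qed

text \<open>Gram-Schmidt applied to the columns of a Schur triangularisation; self-adjointness kills the entries
  above the diagonal.\<close>

lemma orthonormal_eigenvectors:
  fixes A :: "complex mat"
  assumes A: "A \<in> carrier_mat n n"
    and herm: "\<And>i j. i < n \<Longrightarrow> j < n \<Longrightarrow> A $$ (i, j) = cnj (A $$ (j, i))"
    and cp: "char_poly A = (\<Prod>e\<leftarrow>es. [:- e, 1:])"
  shows "\<exists>u. (\<forall>k<n. \<forall>l<n. cinner n (u k) (u l) = (if k = l then 1 else 0)) \<and>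
    (\<forall>k<n. \<forall>i<n. mat_app A n (u k) i = es ! k * u k i)"
proof -
  obtain B P Q where "schur_decomposition A es = (B, P, Q)" by (metis prod_cases3)
  from schur_decomposition[OF A cp this]
  have sim: "similar_mat_wit A B P Q" and ut: "upper_triangular B" and diag: "diag_mat B = es" by auto
  note sD = similar_mat_witD2[OF A sim]
  have BPQ: "B \<in> carrier_mat n n" "P \<in> carrier_mat n n" "Q \<in> carrier_mat n n" using sD by auto
  have esB: "es ! k = B $$ (k, k)" if "k < n" for k
    using that BPQ(1) by (simp add: diag[symmetric] diag_mat_def)
  define p where "p j i = P $$ (i, j)" for j i
  have QP: "(\<Sum>i<n. Q $$ (l, i) * p j i) = (if l = j then 1 else 0)" if "l < n" "j < n" for l j
  proof -
    have "(Q * P) $$ (l, j) = (\<Sum>i<n. Q $$ (l, i) * P $$ (i, j))"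
      using that BPQ by (simp add: scalar_prod_def lessThan_atLeast0)
    then show ?thesis using sD(2) that by (simp add: p_def)
  qed
  have Ap: "mat_app A n (p j) i = (\<Sum>k\<le>j. B $$ (k, j) * p k i)" if ij: "i < n" "j < n" for i j
  proof -
    have "A * P = P * B * (Q * P)" using sD(3) A BPQ by (simp add: assoc_mult_mat[of _ n n _ n _ n])
    also have "\<dots> = P * B" using sD(2) BPQ by simp
    finally have "(A * P) $$ (i, j) = (P * B) $$ (i, j)" by simp
    then have "mat_app A n (p j) i = (\<Sum>k<n. P $$ (i, k) * B $$ (k, j))"
      using ij A BPQ by (simp add: scalar_prod_def lessThan_atLeast0 mat_app_def p_def)
    also have "\<dots> = (\<Sum>k\<le>j. P $$ (i, k) * B $$ (k, j))"
      using ij BPQ(1) ut by (intro sum.mono_neutral_right) (auto simp: upper_triangular_def)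
    finally show ?thesis by (simp add: p_def mult.commute)
  qed
  \<comment> \<open>The last two clauses say that the u k and the first m columns of P have the same
    span. One direction shows that the next residual is nonzero, the other expresses the upper part
    of B in terms of the u k.\<close>
  have "\<exists>u d. (\<forall>k<m. \<forall>l<m. cinner n (u k) (u l) = (if k = l then 1 else 0)) \<and>
    (\<forall>k<m. \<forall>i<n. mat_app A n (u k) i = es ! k * u k i) \<and>
    (\<forall>k<m. \<forall>i<n. u k i = (\<Sum>j<m. d k j * p j i)) \<and>
    (\<forall>j<m. \<exists>c. \<forall>i<n. p j i = (\<Sum>k<m. c k * u k i))" if "m \<le> n" for m
    using that
  proof (induction m)
    case 0
    then show ?case by simp
  next
    case (Suc m)
    from Suc.IH[OF Suc_leD[OF Suc.prems]] obtain u d where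
      IH: "\<forall>k<m. \<forall>l<m. cinner n (u k) (u l) = (if k = l then 1 else 0)"
        "\<forall>k<m. \<forall>i<n. mat_app A n (u k) i = es ! k * u k i"
        "\<forall>k<m. \<forall>i<n. u k i = (\<Sum>j<m. d k j * p j i)"
        "\<forall>j<m. \<exists>c. \<forall>i<n. p j i = (\<Sum>k<m. c k * u k i)"
      by (elim exE conjE) (rule that)
    note on = IH(1)[rule_format] and ev = IH(2)[rule_format] and up = IH(3)[rule_format]
      and pu = IH(4)[rule_format]
    have m: "m < n" using Suc.prems by simp
    define c0 where "c0 k = cinner n (p m) (u k)" for k
    define r where "r i = p m i - (\<Sum>k<m. c0 k * u k i)" for i
    have r_orth: "cinner n r (u l) = 0" if l: "l < m" for l
    proof -
      have "cinner n r (u l) = cinner n (p m) (u l) - (\<Sum>k<m. c0 k * cinner n (u k) (u l))"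
        unfolding r_def by (simp add: cinner_simps cinner_sum)
      also have "(\<Sum>k<m. c0 k * cinner n (u k) (u l)) = (\<Sum>k<m. if k = l then c0 k else 0)"
        using on l by (intro sum.cong) auto
      finally show ?thesis using l by (simp add: c0_def)
    qed
    define d0 where "d0 j = - (\<Sum>k<m. c0 k * d k j)" for j
    have r_p: "r i = p m i + (\<Sum>j<m. d0 j * p j i)" if i: "i < n" for i
    proof -
      have "(\<Sum>k<m. c0 k * u k i) = (\<Sum>k<m. \<Sum>j<m. c0 k * d k j * p j i)"
        using up i by (simp add: sum_distrib_left mult.assoc)
      also have "\<dots> = (\<Sum>j<m. \<Sum>k<m. c0 k * d k j * p j i)" by (rule sum.swap)
      finally show ?thesis by (simp add: r_def d0_def sum_distrib_right sum_negf)
    qed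
    \<comment> \<open>Row m of Q, the inverse of P, reads off the coefficient of column m, and this
      is 1 in r.\<close>
    have r_nz: "\<exists>i<n. r i \<noteq> 0"
    proof (rule ccontr)
      assume "\<not> ?thesis"
      then have "0 = (\<Sum>i<n. Q $$ (m, i) * r i)" by simp
      also have "\<dots> = (\<Sum>i<n. Q $$ (m, i) * p m i + (\<Sum>j<m. d0 j * (Q $$ (m, i) * p j i)))"
        by (intro sum.cong refl) (simp add: r_p ring_distribs sum_distrib_left mult.left_commute)
      also have "\<dots> = (\<Sum>i<n. Q $$ (m, i) * p m i) + (\<Sum>j<m. d0 j * (\<Sum>i<n. Q $$ (m, i) * p j i))"
        unfolding sum.distrib sum_distrib_left by (subst sum.swap) (rule refl)
      also have "\<dots> = 1" using m by (simp add: QP)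
      finally show False by simp
    qed
    define s where "s = (\<Sum>i<n. (norm (r i))\<^sup>2)"
    have s: "s > 0"
    proof -
      obtain i where "i < n" "r i \<noteq> 0" using r_nz by blast
      then show ?thesis unfolding s_def by (intro sum_pos2[of _ i]) auto
    qed
    define t where "t = complex_of_real (1 / sqrt s)"
    have "t * cnj t * of_real s = of_real (1 / sqrt s * (1 / sqrt s) * s)"
      by (simp only: t_def complex_cnj_complex_of_real of_real_mult)
    also have "1 / sqrt s * (1 / sqrt s) * s = 1" using s by simp
    finally have t: "t \<noteq> 0" "t * cnj t * of_real s = 1" by auto
    have Ar: "\<exists>c. \<forall>i<n. mat_app A n r i = es ! m * r i + (\<Sum>k<m. c k * u k i)"
    proof -
      have "\<forall>j\<in>{..<m}. \<exists>c. \<forall>i<n. p j i = (\<Sum>k<m. c k * u k i)" using pu by simp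
      from bchoice[OF this] obtain C where "\<forall>j\<in>{..<m}. \<forall>i<n. p j i = (\<Sum>k<m. C j k * u k i)"
        by (elim exE) (rule that)
      then have C: "p j i = (\<Sum>k<m. C j k * u k i)" if "j < m" "i < n" for j i
        using that by simp
      define S where "S k = (\<Sum>j<m. B $$ (j, m) * C j k)" for k
      have "mat_app A n r i = es ! m * r i + (\<Sum>k<m. (es ! m * c0 k - c0 k * es ! k + S k) * u k i)"
        if i: "i < n" for i
      proof -
        have "mat_app A n r i = mat_app A n (p m) i - (\<Sum>k<m. c0 k * (es ! k * u k i))"
          unfolding r_def using ev i by (simp add: mat_app_simps mat_app_sum)
        also have "mat_app A n (p m) i = es ! m * p m i + (\<Sum>j<m. B $$ (j, m) * p j i)"
          using Ap[OF i m] esB[OF m] by (simp add: lessThan_Suc_atMost[symmetric] add.commute)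
        also have "p m i = r i + (\<Sum>k<m. c0 k * u k i)" by (simp add: r_def)
        also have "(\<Sum>j<m. B $$ (j, m) * p j i) = (\<Sum>j<m. \<Sum>k<m. B $$ (j, m) * C j k * u k i)"
          using C i by (simp add: sum_distrib_left mult.assoc)
        also have "\<dots> = (\<Sum>k<m. S k * u k i)"
          unfolding S_def by (subst sum.swap) (simp add: sum_distrib_right)
        finally show ?thesis
          by (simp add: ring_distribs sum.distrib sum_subtractf sum_distrib_left mult_ac)
      qed
      then have "\<forall>i<n. mat_app A n r i = es ! m * r i + (\<Sum>k<m. (es ! m * c0 k - c0 k * es ! k + S k) * u k i)"
        by (intro allI impI)
      then show ?thesis by (rule exI[of _ "\<lambda>k. es ! m * c0 k - c0 k * es ! k + S k"])
    qed
    then obtain c where "\<forall>i<n. mat_app A n r i = es ! m * r i + (\<Sum>k<m. c k * u k i)"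
      by (elim exE) (rule that)
    note c = this[rule_format]
    have "c l = 0" if l: "l < m" for l
    proof -
      have "cinner n (mat_app A n r) (u l) = cinner n (\<lambda>i. es ! m * r i + (\<Sum>k<m. c k * u k i)) (u l)"
        by (rule cinner_cong) (simp_all add: c)
      also have "\<dots> = (\<Sum>k<m. c k * cinner n (u k) (u l))"
        using r_orth[OF l] by (simp add: cinner_simps cinner_sum)
      also have "\<dots> = (\<Sum>k<m. if k = l then c k else 0)"
        using on l by (intro sum.cong) auto
      also have "\<dots> = c l" using l by simp
      finally have "c l = cinner n (mat_app A n r) (u l)" by simp
      also have "\<dots> = cinner n r (mat_app A n (u l))" by (rule cinner_mat_app) (rule herm)
      also have "\<dots> = cinner n r (\<lambda>i. es ! l * u l i)" by (rule cinner_cong) (simp_all add: ev l)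
      also have "\<dots> = cnj (es ! l) * cinner n r (u l)" by (simp add: cinner_def sum_distrib_left mult_ac)
      finally show ?thesis using r_orth[OF l] by simp
    qed
    then have Ar: "mat_app A n r i = es ! m * r i" if "i < n" for i
      using c[OF that] by simp
    define u' where "u' k = (if k = m then (\<lambda>i. t * r i) else u k)" for k
    have u': "u' m = (\<lambda>i. t * r i)" "k < m \<Longrightarrow> u' k = u k" for k by (auto simp: u'_def)
    define d' where "d' k j = (if k = m then (if j = m then t else t * d0 j) else if j = m then 0 else d k j)" for k j
    show ?case
    proof (rule exI[of _ u'], rule exI[of _ d'], intro conjI allI impI)
      fix k l assume kl: "k < Suc m" "l < Suc m"
      have "cinner n (u' m) (u' m) = t * cnj t * cinner n r r"
        by (simp add: u' cinner_def sum_distrib_left mult_ac)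
      then have mm: "cinner n (u' m) (u' m) = 1" using t by (simp add: cinner_self s_def)
      have ml: "cinner n (u' m) (u' l) = 0" if "l < m" for l
        using that r_orth by (simp add: u' cinner_simps)
      have lm: "cinner n (u' l) (u' m) = 0" if "l < m" for l
        using ml[OF that] cinner_commute[of n "u' l" "u' m"] by simp
      show "cinner n (u' k) (u' l) = (if k = l then 1 else 0)"
        using kl mm ml lm on u'(2) by (cases "k = m"; cases "l = m") auto
    next
      fix k i assume "k < Suc m" "i < n"
      then show "mat_app A n (u' k) i = es ! k * u' k i"
        using ev u'(2) Ar by (cases "k = m") (auto simp: u'(1) mat_app_simps)
    next
      fix k i assume "k < Suc m" "i < n"
      then show "u' k i = (\<Sum>j<Suc m. d' k j * p j i)"
        using up u'(2) by (cases "k = m") (auto simp: u'(1) r_p d'_def ring_distribs sum_distrib_left mult.assoc add.commute)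
    next
      fix j assume j: "j < Suc m"
      show "\<exists>c. \<forall>i<n. p j i = (\<Sum>k<Suc m. c k * u' k i)"
      proof (cases "j = m")
        case True
        have "p m i = (\<Sum>k<Suc m. (if k = m then 1 / t else c0 k) * u' k i)" for i
          using t u'(2) by (simp add: u'(1) r_def)
        then show ?thesis unfolding True
          by (intro exI[of _ "\<lambda>k. if k = m then 1 / t else c0 k"]) simp
      next
        case False
        then obtain c where c: "\<And>i. i < n \<Longrightarrow> p j i = (\<Sum>k<m. c k * u k i)" using pu[of j] j by auto
        have "p j i = (\<Sum>k<Suc m. (if k = m then 0 else c k) * u' k i)" if "i < n" for i
          using c[OF that] u'(2) by simp
        then show ?thesis by (intro exI[of _ "\<lambda>k. if k = m then 0 else c k"]) simp
      qed
    qed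
  qed
  from this[of n] show ?thesis by blast
qed

text \<open>Orthonormality says that a square matrix has its adjoint as left inverse; being also a
  right inverse is completeness.\<close>

lemma orthonormal_complete:
  assumes on: "\<And>k l. k < n \<Longrightarrow> l < n \<Longrightarrow> cinner n (u k) (u l) = (if k = l then 1 else 0)"
    and i: "i < n"
  shows "v i = (\<Sum>k<n. cinner n v (u k) * u k i)"
proof -
  define U where "U = mat n n (\<lambda>(i, k). u k i)"
  define V where "V = mat n n (\<lambda>(k, i). cnj (u k i))"
  have UV: "U \<in> carrier_mat n n" "V \<in> carrier_mat n n" by (simp_all add: U_def V_def)
  have "V * U = 1\<^sub>m n"
  proof (rule eq_matI)
    fix k l assume kl: "k < dim_row (1\<^sub>m n :: complex mat)" "l < dim_col (1\<^sub>m n :: complex mat)"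
    then have "(V * U) $$ (k, l) = cinner n (u l) (u k)"
      by (simp add: U_def V_def scalar_prod_def cinner_def lessThan_atLeast0 mult.commute)
    then show "(V * U) $$ (k, l) = 1\<^sub>m n $$ (k, l)" using on[of l k] kl by auto
  qed (use UV in auto)
  then have UV1: "U * V = 1\<^sub>m n" by (rule mat_mult_left_right_inverse[OF UV(2,1)])
  have ij: "(\<Sum>k<n. u k i * cnj (u k j)) = (if i = j then 1 else 0)" if "j < n" for j
  proof -
    have "(U * V) $$ (i, j) = (\<Sum>k<n. u k i * cnj (u k j))"
      using i that by (simp add: U_def V_def scalar_prod_def lessThan_atLeast0)
    then show ?thesis using UV1 i that by simp
  qed
  have "(\<Sum>k<n. cinner n v (u k) * u k i) = (\<Sum>k<n. \<Sum>j<n. v j * (u k i * cnj (u k j)))"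
    by (simp add: cinner_def sum_distrib_right sum_distrib_left mult_ac)
  also have "\<dots> = (\<Sum>j<n. v j * (\<Sum>k<n. u k i * cnj (u k j)))"
    by (subst sum.swap) (simp add: sum_distrib_left)
  also have "\<dots> = (\<Sum>j<n. if j = i then v j else 0)"
    by (intro sum.cong refl) (auto simp: ij)
  finally show ?thesis using i by simp
qed

text \<open>There are q - 1 homogeneous equations in q unknowns. A row of zeros makes the system
  square with determinant 0.\<close>

lemma exists_annihilated_combination:
  fixes M :: "nat \<Rightarrow> nat \<Rightarrow> complex"
  assumes q: "q > 0"
  shows "\<exists>\<alpha>. (\<exists>t<q. \<alpha> t \<noteq> 0) \<and> (\<forall>k<q - 1. (\<Sum>t<q. M k t * \<alpha> t) = 0)"
proof -
  define Z where "Z = mat q q (\<lambda>(k, t). if k = q - 1 then 0 else M k t)"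
  have Z: "Z \<in> carrier_mat q q" by (simp add: Z_def)
  have "det Z = 0"
  proof -
    have "(\<Prod>i\<in>{0..<q}. Z $$ (i, p i)) = 0" if "p permutes {0..<q}" for p
    proof (rule prod_zero)
      have "p (q - 1) < q" using permutes_in_image[OF that, of "q - 1"] q by simp
      then have "Z $$ (q - 1, p (q - 1)) = 0" using q by (simp add: Z_def)
      then show "\<exists>i\<in>{0..<q}. Z $$ (i, p i) = 0" using q by (intro bexI[of _ "q - 1"]) auto
    qed simp
    then show ?thesis unfolding det_def'[OF Z] by (intro sum.neutral) auto
  qed
  then obtain v where v: "v \<in> carrier_vec q" "v \<noteq> 0\<^sub>v q" "Z *\<^sub>v v = 0\<^sub>v q"
    using det_0_iff_vec_prod_zero[OF Z] by blast
  have "\<exists>t<q. v $ t \<noteq> 0"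
  proof (rule ccontr)
    assume "\<not> ?thesis"
    then have "v = 0\<^sub>v q" using v(1) by (intro eq_vecI) auto
    with v(2) show False by simp
  qed
  moreover have "(\<Sum>t<q. M k t * v $ t) = 0" if k: "k < q - 1" for k
  proof -
    have "(Z *\<^sub>v v) $ k = (\<Sum>t<q. M k t * v $ t)"
      using k v(1) by (simp add: Z_def scalar_prod_def lessThan_atLeast0)
    then show ?thesis using v(3) k by simp
  qed
  ultimately show ?thesis by (intro exI[of _ "\<lambda>t. v $ t"]) auto
qed

lemma quadratic_form_eigen:
  assumes on: "\<And>k l. k < n \<Longrightarrow> l < n \<Longrightarrow> cinner n (u k) (u l) = (if k = l then 1 else 0)"
    and ev: "\<And>k i. k < n \<Longrightarrow> i < n \<Longrightarrow> mat_app A n (u k) i = es k * u k i"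
  shows "cinner n (mat_app A n v) v = (\<Sum>k<n. es k * (cinner n v (u k) * cnj (cinner n v (u k))))"
    and "cinner n v v = (\<Sum>k<n. cinner n v (u k) * cnj (cinner n v (u k)))"
proof -
  have *: "cinner n (\<lambda>i. \<Sum>k<n. c k * u k i) v = (\<Sum>k<n. c k * cnj (cinner n v (u k)))" for c
    by (simp add: cinner_sum cinner_simps cinner_commute[of n _ v])
  have v: "v i = (\<Sum>k<n. cinner n v (u k) * u k i)" if "i < n" for i
    using orthonormal_complete[OF on that] .
  have "cinner n v v = cinner n (\<lambda>i. \<Sum>k<n. cinner n v (u k) * u k i) v"
    by (intro cinner_cong v refl)
  then show "cinner n v v = (\<Sum>k<n. cinner n v (u k) * cnj (cinner n v (u k)))" using * by simp
  have "mat_app A n v i = (\<Sum>k<n. (es k * cinner n v (u k)) * u k i)" if i: "i < n" for i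
  proof -
    have "mat_app A n v i = mat_app A n (\<lambda>i. \<Sum>k<n. cinner n v (u k) * u k i) i"
      unfolding mat_app_def by (intro sum.cong refl arg_cong2[where f = "(*)"] v) auto
    also have "\<dots> = (\<Sum>k<n. cinner n v (u k) * (es k * u k i))"
      by (simp add: mat_app_sum mat_app_simps ev i)
    finally show ?thesis by (simp add: mult_ac)
  qed
  then have "cinner n (mat_app A n v) v = cinner n (\<lambda>i. \<Sum>k<n. (es k * cinner n v (u k)) * u k i) v"
    by (intro cinner_cong refl)
  also have "\<dots> = (\<Sum>k<n. (es k * cinner n v (u k)) * cnj (cinner n v (u k)))" by (rule *)
  finally show "cinner n (mat_app A n v) v = (\<Sum>k<n. es k * (cinner n v (u k) * cnj (cinner n v (u k))))"
    by (simp only: mult.assoc)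
qed

text \<open>The upper half of the min-max principle: some nontrivial combination of the q vectors is
  orthogonal to the first q - 1 eigenvectors, and there the form is at least the q-th eigenvalue
  times the squared norm. Independence of the vectors is hidden in the positive norms of
  \<open>small\<close>.\<close>

lemma nth_eigenvalue_le:
  fixes A :: "complex mat" and v :: "nat \<Rightarrow> nat \<Rightarrow> complex"
  assumes A: "A \<in> carrier_mat n n"
    and sym: "\<And>i j. i < n \<Longrightarrow> j < n \<Longrightarrow> A $$ (i, j) = A $$ (j, i)"
    and re: "\<And>i j. i < n \<Longrightarrow> j < n \<Longrightarrow> A $$ (i, j) \<in> \<real>"
    and q: "1 \<le> q" "q \<le> n"
    and small: "\<And>\<alpha> w. \<exists>t<q. \<alpha> t \<noteq> 0 \<Longrightarrow> w = (\<lambda>i. \<Sum>t<q. \<alpha> t * v t i) \<Longrightarrow>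
      Re (cinner n (mat_app A n w) w) \<le> eps * Re (cinner n w w) \<and> Re (cinner n w w) > 0"
  shows "nth_eigenvalue A q \<le> eps"
proof (rule ccontr)
  assume "\<not> ?thesis"
  then have gt: "nth_eigenvalue A q > eps" by simp
  define es where "es = map (\<lambda>k. complex_of_real (nth_eigenvalue A (Suc k))) [0..<n]"
  have es: "es ! k = of_real (nth_eigenvalue A (Suc k))" if "k < n" for k using that by (simp add: es_def)
  note ev = char_poly_nth_eigenvalue[OF A sym re]
  have "char_poly A = (\<Prod>k=1..n. [:- complex_of_real (nth_eigenvalue A k), 1:])" by (rule ev(1))
  also have "\<dots> = (\<Prod>k<n. [:- complex_of_real (nth_eigenvalue A (Suc k)), 1:])"
    by (rule prod.reindex_bij_witness[where i = Suc and j = "\<lambda>k. k - 1"]) auto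
  also have "\<dots> = (\<Prod>e\<leftarrow>es. [:- e, 1:])"
    by (simp add: es_def prod.list_conv_set_nth lessThan_atLeast0)
  finally have cp: "char_poly A = (\<Prod>e\<leftarrow>es. [:- e, 1:])" .
  have herm: "A $$ (i, j) = cnj (A $$ (j, i))" if "i < n" "j < n" for i j
    using sym[OF that] re[OF that(2,1)] by (simp add: Reals_cnj_iff)
  obtain u where on: "\<And>k l. k < n \<Longrightarrow> l < n \<Longrightarrow> cinner n (u k) (u l) = (if k = l then 1 else 0)"
    and eu: "\<And>k i. k < n \<Longrightarrow> i < n \<Longrightarrow> mat_app A n (u k) i = es ! k * u k i"
    using orthonormal_eigenvectors[OF A herm cp] by blast
  obtain \<alpha> where \<alpha>: "\<exists>t<q. \<alpha> t \<noteq> 0" "\<And>k. k < q - 1 \<Longrightarrow> (\<Sum>t<q. cinner n (v t) (u k) * \<alpha> t) = 0"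
    using exists_annihilated_combination[of q "\<lambda>k t. cinner n (v t) (u k)"] q(1) by auto
  define w where "w = (\<lambda>i. \<Sum>t<q. \<alpha> t * v t i)"
  have w0: "cinner n w (u k) = 0" if "k < q - 1" for k
    using \<alpha>(2)[OF that] by (simp add: w_def cinner_sum cinner_simps mult.commute)
  define z where "z k = (norm (cinner n w (u k)))\<^sup>2" for k
  have zz: "cinner n w (u k) * cnj (cinner n w (u k)) = of_real (z k)" for k
    by (simp add: z_def complex_norm_square del: of_real_power)
  have form: "cinner n (mat_app A n w) w = of_real (\<Sum>k<n. nth_eigenvalue A (Suc k) * z k)"
  proof -
    have "cinner n (mat_app A n w) w = (\<Sum>k<n. es ! k * (cinner n w (u k) * cnj (cinner n w (u k))))"
      by (rule quadratic_form_eigen(1)) (use on eu in auto)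
    then show ?thesis unfolding zz by (simp add: es)
  qed
  have nrm: "cinner n w w = of_real (\<Sum>k<n. z k)"
  proof -
    have "cinner n w w = (\<Sum>k<n. cinner n w (u k) * cnj (cinner n w (u k)))"
      by (rule quadratic_form_eigen(2)[where es = "\<lambda>k. es ! k" and A = A]) (use on eu in auto)
    then show ?thesis unfolding zz by simp
  qed
  have "nth_eigenvalue A q * z k \<le> nth_eigenvalue A (Suc k) * z k" if "k < n" for k
  proof (cases "k < q - 1")
    case False
    then have "nth_eigenvalue A q \<le> nth_eigenvalue A (Suc k)" using that q by (intro ev(2)) auto
    then show ?thesis by (intro mult_right_mono) (auto simp: z_def)
  qed (simp add: z_def w0)
  then have "nth_eigenvalue A q * (\<Sum>k<n. z k) \<le> (\<Sum>k<n. nth_eigenvalue A (Suc k) * z k)"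
    unfolding sum_distrib_left by (intro sum_mono) auto
  moreover have "(\<Sum>k<n. nth_eigenvalue A (Suc k) * z k) \<le> eps * (\<Sum>k<n. z k)" "(\<Sum>k<n. z k) > 0"
    using small[OF \<alpha>(1) w_def] unfolding form nrm by simp_all
  ultimately have "nth_eigenvalue A q \<le> eps" by (meson mult_le_cancel_right_pos order_trans)
  with gt show False by simp
qed

lemma nth_eigenvalue_nonneg:
  fixes A :: "complex mat"
  assumes A: "A \<in> carrier_mat n n"
    and sym: "\<And>i j. i < n \<Longrightarrow> j < n \<Longrightarrow> A $$ (i, j) = A $$ (j, i)"
    and re: "\<And>i j. i < n \<Longrightarrow> j < n \<Longrightarrow> A $$ (i, j) \<in> \<real>"
    and q: "1 \<le> q" "q \<le> n"
    and psd: "\<And>w. Re (cinner n (mat_app A n w) w) \<ge> 0"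
  shows "nth_eigenvalue A q \<ge> 0"
proof -
  note cp = char_poly_nth_eigenvalue(1)[OF A sym re]
  have "poly (char_poly A) (of_real (nth_eigenvalue A q)) = 0"
  proof -
    have "poly (char_poly A) (of_real (nth_eigenvalue A q))
        = (\<Prod>k=1..n. poly [:- complex_of_real (nth_eigenvalue A k), 1:] (of_real (nth_eigenvalue A q)))"
      using arg_cong[OF cp, of "\<lambda>p. poly p (of_real (nth_eigenvalue A q))"] by (simp only: poly_prod)
    also have "\<dots> = 0" using q by (intro prod_zero) (auto intro!: bexI[of _ q])
    finally show ?thesis .
  qed
  then have "eigenvalue A (of_real (nth_eigenvalue A q))" using eigenvalue_root_char_poly[OF A] by simp
  then obtain w where w: "w \<in> carrier_vec n" "w \<noteq> 0\<^sub>v n" "A *\<^sub>v w = of_real (nth_eigenvalue A q) \<cdot>\<^sub>v w"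
    using A by (auto simp: eigenvalue_def eigenvector_def)
  define v where "v i = w $ i" for i
  have Av: "mat_app A n v i = of_real (nth_eigenvalue A q) * v i" if "i < n" for i
  proof -
    have "(A *\<^sub>v w) $ i = mat_app A n v i"
      using A w(1) that by (simp add: scalar_prod_def mat_app_def v_def lessThan_atLeast0)
    then show ?thesis using w(1,3) that by (simp add: v_def)
  qed
  have "cinner n (mat_app A n v) v = cinner n (\<lambda>i. of_real (nth_eigenvalue A q) * v i) v"
    by (intro cinner_cong Av refl)
  also have "\<dots> = of_real (nth_eigenvalue A q * (\<Sum>i<n. (norm (v i))\<^sup>2))"
    by (simp add: cinner_simps cinner_self)
  finally have "nth_eigenvalue A q * (\<Sum>i<n. (norm (v i))\<^sup>2) \<ge> 0" using psd[of v] by simp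
  moreover have "(\<Sum>i<n. (norm (v i))\<^sup>2) > 0"
  proof -
    obtain i where "i < n" "v i \<noteq> 0"
      using w(1,2) unfolding v_def by (metis carrier_vecD eq_vecI index_zero_vec(1) index_zero_vec(2))
    then show ?thesis by (intro sum_pos2[of _ i]) auto
  qed
  ultimately show ?thesis by (simp add: zero_le_mult_iff)
qed

section \<open>Gcd matrices\<close>

lemma sum_Pow_insert:
  assumes "finite T" "p \<notin> T"
  shows "(\<Sum>S\<in>Pow (insert p T). F S) = (\<Sum>S\<in>Pow T. F S + F (insert p S) :: real)"
proof -
  have "inj_on (insert p) (Pow T)" using assms(2) by (auto intro!: inj_onI)
  moreover have "Pow T \<inter> insert p ` Pow T = {}" using assms(2) by auto
  ultimately show ?thesis
    using assms(1) by (simp add: Pow_insert sum.union_disjoint sum.reindex sum.distrib)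
qed

text \<open>Subsets of T index the Kronecker product. Its form at a product vector is the product of
  the forms, each evaluated at (1, t p).\<close>

lemma sum_Pow_prod_inter:
  fixes H t :: "'a \<Rightarrow> real"
  assumes "finite T"
  shows "(\<Sum>S\<in>Pow T. \<Sum>S'\<in>Pow T. prod H (S \<inter> S') * prod t S * prod t S')
    = (\<Prod>p\<in>T. 1 + 2 * t p + (t p)\<^sup>2 * H p)"
  using assms
proof (induction T rule: finite_induct)
  case (insert p T)
  let ?G = "\<lambda>S S'. prod H (S \<inter> S') * prod t S * prod t S'"
  have G: "?G S (insert p S') = t p * ?G S S'" "?G (insert p S) S' = t p * ?G S S'"
    "?G (insert p S) (insert p S') = (t p)\<^sup>2 * H p * ?G S S'"
    if "S \<in> Pow T" "S' \<in> Pow T" for S S'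
  proof -
    have fin: "finite S" "finite S'" "p \<notin> S" "p \<notin> S'" using that insert.hyps by (auto intro: finite_subset)
    then have "S \<inter> insert p S' = S \<inter> S'" "insert p S \<inter> S' = S \<inter> S'"
      "insert p S \<inter> insert p S' = insert p (S \<inter> S')" by auto
    with fin show "?G S (insert p S') = t p * ?G S S'" "?G (insert p S) S' = t p * ?G S S'"
      "?G (insert p S) (insert p S') = (t p)\<^sup>2 * H p * ?G S S'"
      by (simp_all add: power2_eq_square)
  qed
  have "(\<Sum>S\<in>Pow (insert p T). \<Sum>S'\<in>Pow (insert p T). ?G S S')
    = (\<Sum>S\<in>Pow T. (\<Sum>S'\<in>Pow T. ?G S S' + ?G S (insert p S'))
        + (\<Sum>S'\<in>Pow T. ?G (insert p S) S' + ?G (insert p S) (insert p S')))"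
    by (simp only: sum_Pow_insert[OF insert.hyps(1,2)])
  also have "\<dots> = (\<Sum>S\<in>Pow T. \<Sum>S'\<in>Pow T. (1 + 2 * t p + (t p)\<^sup>2 * H p) * ?G S S')"
    unfolding sum.distrib[symmetric]
  proof (intro sum.cong refl)
    fix S S' assume SS: "S \<in> Pow T" "S' \<in> Pow T"
    show "?G S S' + ?G S (insert p S') + (?G (insert p S) S' + ?G (insert p S) (insert p S'))
      = (1 + 2 * t p + (t p)\<^sup>2 * H p) * ?G S S'" unfolding G(1)[OF SS] G(2)[OF SS] G(3)[OF SS] by (simp add: algebra_simps)
  qed
  also have "\<dots> = (1 + 2 * t p + (t p)\<^sup>2 * H p) * (\<Sum>S\<in>Pow T. \<Sum>S'\<in>Pow T. ?G S S')"
    by (simp only: sum_distrib_left)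
  finally show ?case using insert by simp
qed simp

lemma multiplicative_prod_primes:
  assumes h: "multiplicative_fun h" "h 1 = 1" and R: "finite R" "\<And>p. p \<in> R \<Longrightarrow> prime p"
  shows "h (\<Prod>R) = (\<Prod>p\<in>R. h p)"
  using R
proof (induction R rule: finite_induct)
  case (insert p R)
  have "coprime p (\<Prod>R)"
  proof (rule prod_coprime_right)
    fix r assume "r \<in> R"
    then show "coprime p r" using insert.hyps insert.prems by (intro primes_coprime) auto
  qed
  moreover have "r > 0" if "r \<in> insert p R" for r using insert.prems[OF that] by (rule prime_gt_0_nat)
  then have "\<Prod>R > 0" "p > 0" by (auto intro: prod_pos)
  ultimately have "h (p * \<Prod>R) = h p * h (\<Prod>R)"
    using h(1) unfolding multiplicative_fun_def by (simp add: Suc_le_eq)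
  then show ?case using insert by simp
qed (use h(2) in simp)

lemma gcd_prod_primes:
  fixes S S' :: "nat set"
  assumes "finite S" "finite S'" "\<And>p. p \<in> S \<union> S' \<Longrightarrow> prime p"
  shows "gcd (\<Prod>S) (\<Prod>S') = \<Prod>(S \<inter> S')"
proof -
  have "\<Prod>S = \<Prod>(S \<inter> S') * \<Prod>(S - S')" "\<Prod>S' = \<Prod>(S \<inter> S') * \<Prod>(S' - S)"
    using assms(1,2) by (simp_all add: prod.Int_Diff[of S _ S'] prod.Int_Diff[of S' _ S] Int_commute)
  moreover have "coprime (\<Prod>(S - S')) (\<Prod>(S' - S))"
    using assms(3) by (intro prod_coprime_left prod_coprime_right primes_coprime) auto
  ultimately show ?thesis by (simp add: gcd_mult_distrib_nat[symmetric])
qed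

lemma small_test_vector:
  fixes h :: "nat \<Rightarrow> complex" and y :: "nat \<Rightarrow> nat" and H :: "nat \<Rightarrow> real"
  assumes h: "multiplicative_fun h" "h 1 = 1" and a: "a \<ge> 1"
    and y: "strict_mono y" and ap: "\<And>m. m \<ge> M \<Longrightarrow> [m = a] (mod b) \<Longrightarrow> \<exists>i. y i = m"
    and H: "\<And>p. prime p \<Longrightarrow> [p = 1] (mod b) \<Longrightarrow> h p = of_real (H p) \<and> H p \<ge> 1"
    and div: "\<And>K B. \<exists>T. finite T \<and> (\<forall>p\<in>T. prime p \<and> [p = 1] (mod b) \<and> p > K) \<and> (\<Sum>p\<in>T. 1 / H p) \<ge> B"
    and eps: "eps > 0"
  shows "\<exists>I v. finite I \<and> (\<forall>i\<in>I. i \<ge> N) \<and> (\<Sum>i\<in>I. \<Sum>j\<in>I. Re (h (gcd (y i) (y j))) * v i * v j) \<le> eps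
    \<and> (\<Sum>i\<in>I. (v i)\<^sup>2) \<ge> (1 :: real)"
proof -
  \<comment> \<open>P exceeds M, so that the numbers \<open>z S\<close> are covered by
    \<open>ap\<close>, and exceeds \<open>y N\<close>, so that their indices are at least N.\<close>
  obtain T0 where T0: "\<forall>p\<in>T0. prime p \<and> [p = 1] (mod b) \<and> p > a + M + y N" "(\<Sum>p\<in>T0. 1 / H p) \<ge> 1"
    using div[of "a + M + y N" 1] by blast
  then have "T0 \<noteq> {}" by auto
  then obtain P where P: "prime P" "[P = 1] (mod b)" "P > a + M + y N" using T0 by blast
  \<comment> \<open>The summand 1 keeps \<open>\<kappa>\<close> positive. T is chosen afterwards,
    with 1 / H summing to at least \<open>ln (\<kappa> / eps)\<close>, so that the final bound is
    exactly eps.\<close>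
  define \<kappa> where "\<kappa> = \<bar>Re (h (a * P))\<bar> + 1"
  obtain T where T: "finite T" "\<And>p. p \<in> T \<Longrightarrow> prime p" "\<And>p. p \<in> T \<Longrightarrow> [p = 1] (mod b)"
    "\<And>p. p \<in> T \<Longrightarrow> p > a + P" "(\<Sum>p\<in>T. 1 / H p) \<ge> ln (\<kappa> / eps)"
    using div[of "a + P" "ln (\<kappa> / eps)"] by blast
  have HT: "h p = of_real (H p)" "H p \<ge> 1" if "p \<in> T" for p using H[OF T(2,3)] that by auto
  define z where "z S = a * P * \<Prod>S" for S
  have Tsub: "finite S" "\<And>p. p \<in> S \<Longrightarrow> p \<in> T" if "S \<in> Pow T" for S
    using that T(1) by (auto intro: finite_subset)
  have prod_pos: "\<Prod>S > 0" if "S \<in> Pow T" for S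
    using Tsub(2)[OF that] T(2) by (intro prod_pos) (auto intro: prime_gt_0_nat)
  have cop: "coprime (a * P) (\<Prod>S)" if "S \<in> Pow T" for S
  proof (rule prod_coprime_right)
    fix p assume "p \<in> S"
    then have p: "prime p" "p > a + P" using Tsub(2)[OF that] T by auto
    then have "\<not> p dvd a" "\<not> p dvd P" using a P prime_gt_0_nat[OF P(1)] by (auto dest: dvd_imp_le)
    then have "coprime p a" "coprime p P" using p(1) by (auto intro: prime_imp_coprime)
    then show "coprime (a * P) p" by (simp add: coprime_commute)
  qed
  have P_le: "P \<le> z S" if S: "S \<in> Pow T" for S
  proof -
    have "1 \<le> a * \<Prod>S" using a prod_pos[OF S] by (simp add: Suc_le_eq)
    from mult_le_mono2[OF this, of P] show ?thesis by (simp add: z_def mult_ac)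
  qed
  have "\<exists>i. y i = z S" if S: "S \<in> Pow T" for S
  proof (rule ap)
    show "M \<le> z S" using P(3) P_le[OF S] by linarith
    have "[\<Prod>S = (\<Prod>p\<in>S. 1)] (mod b)"
      using Tsub(2)[OF S] T(3) by (intro cong_prod) auto
    then have "[a * P * \<Prod>S = a * 1 * (\<Prod>p\<in>S. 1)] (mod b)"
      using P(2) by (intro cong_mult cong_refl)
    then show "[z S = a] (mod b)" by (simp add: z_def)
  qed
  then have "\<forall>S\<in>Pow T. \<exists>i. y i = z S" by blast
  from bchoice[OF this] obtain idx where idx: "\<forall>S\<in>Pow T. y (idx S) = z S" by (elim exE) (rule that)
  have recover: "{p \<in> T. p dvd z S} = S" if S: "S \<in> Pow T" for S
  proof -
    have "p dvd z S \<longleftrightarrow> p \<in> S" if p: "p \<in> T" for p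
    proof
      assume "p dvd z S"
      moreover have "\<not> p dvd a * P"
      proof
        assume "p dvd a * P"
        then have "p dvd a \<or> p dvd P" using T(2)[OF p] by (simp add: prime_dvd_mult_iff)
        then show False using T(4)[OF p] a prime_gt_0_nat[OF P(1)] by (auto dest: dvd_imp_le)
      qed
      ultimately have "p dvd \<Prod>S" using T(2)[OF p] by (simp add: z_def prime_dvd_mult_iff)
      then obtain r where "r \<in> S" "p dvd r" using prime_dvd_prod_iff[OF Tsub(1)[OF S] T(2)[OF p], of "\<lambda>x. x"] by auto
      then have "p = r" using primes_dvd_imp_eq[OF T(2)[OF p] T(2)[OF Tsub(2)[OF S]]] by blast
      then show "p \<in> S" using \<open>r \<in> S\<close> by simp
    next
      assume "p \<in> S"
      then show "p dvd z S" using dvd_prodI[OF Tsub(1)[OF S], of p "\<lambda>x. x"] by (simp add: z_def)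
    qed
    then show ?thesis using Tsub(2)[OF S] by blast
  qed
  have inj: "inj_on idx (Pow T)"
  proof (rule inj_onI)
    fix S S' assume S: "S \<in> Pow T" "S' \<in> Pow T" "idx S = idx S'"
    then have "z S = z S'" using bspec[OF idx S(1)] bspec[OF idx S(2)] by simp
    have "S = {p \<in> T. p dvd z S'}" using recover[OF S(1)] unfolding \<open>z S = z S'\<close> by (rule sym)
    then show "S = S'" unfolding recover[OF S(2)] .
  qed
  \<comment> \<open>This value minimises \<open>1 + 2 * t p + (t p)\<^sup>2 * H p\<close>, and the
    minimum is \<open>1 - 1 / H p\<close>.\<close>
  define t where "t p = - 1 / H p" for p
  define I where "I = idx ` Pow T"
  \<comment> \<open>S is read back from \<open>y i\<close> by divisibility: the primes of T exceed a
    and P, so they divide \<open>z S\<close> only if they lie in S.\<close>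
  define v where "v i = prod t {p \<in> T. p dvd y i}" for i
  have v: "v (idx S) = prod t S" if "S \<in> Pow T" for S
    by (simp only: v_def bspec[OF idx that] recover[OF that])
  have hgcd: "h (gcd (z S) (z S')) = h (a * P) * of_real (prod H (S \<inter> S'))" if S: "S \<in> Pow T" "S' \<in> Pow T" for S S'
  proof -
    have I: "S \<inter> S' \<in> Pow T" using S by auto
    have "gcd (z S) (z S') = a * P * gcd (\<Prod>S) (\<Prod>S')"
      unfolding z_def by (rule gcd_mult_distrib_nat[symmetric])
    also have "gcd (\<Prod>S) (\<Prod>S') = \<Prod>(S \<inter> S')"
      by (rule gcd_prod_primes[OF Tsub(1)[OF S(1)] Tsub(1)[OF S(2)]]) (use S T(2) in auto)
    finally have "h (gcd (z S) (z S')) = h (a * P) * h (\<Prod>(S \<inter> S'))"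
      using h(1) cop[OF I] prod_pos[OF I] a prime_gt_0_nat[OF P(1)]
      unfolding multiplicative_fun_def by (simp add: Suc_le_eq)
    also have "h (\<Prod>(S \<inter> S')) = (\<Prod>p\<in>S \<inter> S'. h p)"
      using Tsub[OF I] T(2) by (intro multiplicative_prod_primes h) auto
    also have "\<dots> = (\<Prod>p\<in>S \<inter> S'. of_real (H p))"
      using HT(1) Tsub(2)[OF I] by (intro prod.cong refl) auto
    finally show ?thesis by simp
  qed
  have "(\<Sum>i\<in>I. \<Sum>j\<in>I. Re (h (gcd (y i) (y j))) * v i * v j)
      = (\<Sum>S\<in>Pow T. \<Sum>S'\<in>Pow T. Re (h (gcd (z S) (z S'))) * prod t S * prod t S')"
    unfolding I_def using idx v by (simp add: sum.reindex[OF inj])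
  also have "\<dots> = (\<Sum>S\<in>Pow T. \<Sum>S'\<in>Pow T. Re (h (a * P)) * (prod H (S \<inter> S') * prod t S * prod t S'))"
    by (intro sum.cong refl) (simp add: hgcd del: of_real_prod)
  also have "\<dots> = Re (h (a * P)) * (\<Prod>p\<in>T. 1 + 2 * t p + (t p)\<^sup>2 * H p)"
    unfolding sum_distrib_left[symmetric] sum_Pow_prod_inter[OF T(1)] ..
  also have "(\<Prod>p\<in>T. 1 + 2 * t p + (t p)\<^sup>2 * H p) = (\<Prod>p\<in>T. 1 - 1 / H p)"
  proof (intro prod.cong refl)
    fix p assume "p \<in> T"
    then have "H p \<noteq> 0" using HT(2) by force
    then show "1 + 2 * t p + (t p)\<^sup>2 * H p = 1 - 1 / H p" by (simp add: t_def power2_eq_square)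
  qed
  also have "Re (h (a * P)) * (\<Prod>p\<in>T. 1 - 1 / H p) \<le> \<kappa> * exp (- ln (\<kappa> / eps))"
  proof (rule mult_mono)
    show "0 \<le> (\<Prod>p\<in>T. 1 - 1 / H p)"
    proof (rule prod_nonneg)
      fix p assume "p \<in> T"
      then show "0 \<le> 1 - 1 / H p" using HT(2)[of p] by simp
    qed
    have "(\<Prod>p\<in>T. 1 - 1 / H p) \<le> (\<Prod>p\<in>T. exp (- (1 / H p)))"
    proof (rule prod_mono)
      fix p assume "p \<in> T"
      then show "0 \<le> 1 - 1 / H p \<and> 1 - 1 / H p \<le> exp (- (1 / H p))"
        using HT(2)[of p] exp_ge_add_one_self[of "- (1 / H p)"] by simp
    qed
    also have "\<dots> = exp (- (\<Sum>p\<in>T. 1 / H p))" using T(1) by (simp add: exp_sum[symmetric] sum_negf)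
    also have "\<dots> \<le> exp (- ln (\<kappa> / eps))" using T(5) by simp
    finally show "(\<Prod>p\<in>T. 1 - 1 / H p) \<le> exp (- ln (\<kappa> / eps))" .
  qed (auto simp: \<kappa>_def)
  also have "\<kappa> * exp (- ln (\<kappa> / eps)) = eps"
  proof -
    have "\<kappa> > 0" by (simp add: \<kappa>_def)
    then show ?thesis using eps by (simp add: exp_minus)
  qed
  finally have "(\<Sum>i\<in>I. \<Sum>j\<in>I. Re (h (gcd (y i) (y j))) * v i * v j) \<le> eps" .
  moreover have "finite I" using T(1) by (simp add: I_def)
  moreover have "i \<ge> N" if i: "i \<in> I" for i
  proof -
    obtain S where S: "S \<in> Pow T" "i = idx S" using i unfolding I_def by blast
    have "y i = z S" using idx S by simp
    then have "y N \<le> y i" using P(3) P_le[OF S(1)] by linarith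
    then show ?thesis using strict_mono_less_eq[OF y] by simp
  qed
  moreover have "(\<Sum>i\<in>I. (v i)\<^sup>2) \<ge> 1"
  proof -
    \<comment> \<open>The empty set already contributes the empty product 1.\<close>
    have "(v (idx {}))\<^sup>2 \<le> (\<Sum>i\<in>I. (v i)\<^sup>2)"
      using \<open>finite I\<close> by (intro member_le_sum) (auto simp: I_def)
    then show ?thesis using v[of "{}"] by simp
  qed
  ultimately show ?thesis by (intro exI[of _ I] exI[of _ v] conjI ballI)
qed

text \<open>Each new support is taken beyond the maximum of all earlier ones.\<close>

lemma disjoint_test_vectors:
  fixes q :: nat
  assumes ex: "\<And>N. \<exists>I v. finite I \<and> (\<forall>i\<in>I. i \<ge> N) \<and> R I v"
  shows "\<exists>I v. (\<forall>t<q. finite (I t) \<and> R (I t) (v t)) \<and> (\<forall>s<q. \<forall>t<q. s \<noteq> t \<longrightarrow> I s \<inter> I t = ({} :: nat set))"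
proof (induction q)
  case (Suc q)
  then obtain I v where I: "\<forall>t<q. finite (I t) \<and> R (I t) (v t)" "\<forall>s<q. \<forall>t<q. s \<noteq> t \<longrightarrow> I s \<inter> I t = {}"
    by (elim exE conjE) (rule that)
  define N where "N = Suc (Max (insert 0 (\<Union>t<q. I t)))"
  have N: "i < N" if "t < q" "i \<in> I t" for i t
    using I(1) that by (auto simp: N_def less_Suc_eq_le intro!: Max_ge)
  obtain J w where J: "finite J" "\<forall>i\<in>J. i \<ge> N" "R J w" using ex by blast
  have disj: "I t \<inter> J = {}" "J \<inter> I t = {}" if "t < q" for t using N[OF that] J(2) by fastforce+
  show ?case
  proof (rule exI[of _ "I(q := J)"], rule exI[of _ "v(q := w)"], intro conjI allI impI)
    fix t assume "t < Suc q"
    then show "finite ((I(q := J)) t)" "R ((I(q := J)) t) ((v(q := w)) t)" using I(1) J by (auto simp: less_Suc_eq)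
  next
    fix s t assume "s < Suc q" "t < Suc q" "s \<noteq> t"
    then show "(I(q := J)) s \<inter> (I(q := J)) t = {}" using I(2) disj by (auto simp: less_Suc_eq)
  qed
qed simp

section \<open>Values and positivity of \<open>h_fun\<close>\<close>

lemma multiplicative_h_fun: "(\<And>j. j \<in> {1..c} \<Longrightarrow> multiplicative_fun (f j)) \<Longrightarrow> multiplicative_fun (h_fun c f l d)"
proof -
  assume f: "\<And>j. j \<in> {1..c} \<Longrightarrow> multiplicative_fun (f j)"
  have *: "multiplicative_fun (foldr (\<lambda>j g. dpow (f j) (l j) \<star> g) js (dpow moebius_mu d))" if "set js \<subseteq> {1..c}" for js
    using that by (induction js) (auto intro!: dconv_multiplicative dpow_multiplicative f moebius_mu_multiplicative)
  show ?thesis unfolding h_fun_def by (rule *) auto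
qed

lemma dpow_dconv_ddelta: "ddelta \<star> dpow f k = dpow f k"
proof (cases k)
  case 0
  show ?thesis unfolding 0 dpow.simps
  proof
    fix m show "(ddelta \<star> ddelta) m = ddelta m"
      by (cases "m = 0") (simp_all add: ddelta_dconv, simp add: dconv_0 ddelta_def)
  qed
qed (simp add: ddelta_dconv_dconv)

text \<open>h * mu contains d + 1 factors mu, and the powers of the f j together absorb l_1 + ... +
  l_c, which is at least d + 1.\<close>

lemma (in divisor_closed) h_fun_moebius_nonneg:
  assumes f: "\<And>j m. j \<in> {1..c} \<Longrightarrow> m \<in> D \<Longrightarrow> (f j \<star> moebius_mu) m \<ge> 0"
    and d: "d < (\<Sum>j=1..c. l j)" and m: "m \<in> D"
  shows "(h_fun c f l d \<star> moebius_mu) m \<ge> 0"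
proof -
  define P where "P js = foldr (\<lambda>j g. dpow (f j) (l j) \<star> g) js ddelta" for js
  have P: "foldr (\<lambda>j g. dpow (f j) (l j) \<star> g) js (dpow moebius_mu d) = P js \<star> dpow moebius_mu d" for js
    by (induction js) (simp_all add: P_def dpow_dconv_ddelta dconv_assoc)
  have "nonneg_below D (\<Sum>j\<leftarrow>js. l j) (P js)" if "set js \<subseteq> {1..c}" for js
    using that
  proof (induction js)
    case (Cons j js)
    have "nonneg_below D (l j) (dpow (f j) (l j))"
      using Cons.prems f by (intro nonneg_below_dpow nonneg_below_1) auto
    then show ?case using nonneg_below_dconv[of "l j" _ "\<Sum>j\<leftarrow>js. l j" "P js"] Cons by (simp add: P_def)
  qed (simp add: P_def nonneg_below_ddelta)
  from this[of "[1..<Suc c]"] have "nonneg_below D (\<Sum>j\<leftarrow>[1..<Suc c]. l j) (P [1..<Suc c])"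
    by (simp del: upt_Suc add: atLeastLessThanSuc_atLeastAtMost)
  moreover have "(\<Sum>j\<leftarrow>[1..<Suc c]. l j) = (\<Sum>j=1..c. l j)"
    by (simp only: sum_list_distinct_conv_sum_set distinct_upt set_upt atLeastLessThanSuc_atLeastAtMost)
  ultimately have "(P [1..<Suc c] \<star> dpow moebius_mu (Suc d)) m \<ge> 0"
    using d m unfolding nonneg_below_def by (simp del: upt_Suc dpow.simps)
  then show ?thesis unfolding h_fun_def P by (simp add: dconv_assoc del: upt_Suc)
qed

lemma dpow_at_1: "f 1 = 1 \<Longrightarrow> dpow f k 1 = 1"
  by (induction k) (simp_all add: ddelta_def dconv_1)

lemma dpow_at_prime:
  assumes "prime p" "f 1 = 1"
  shows "dpow f k p = of_nat k * f p"
proof (induction k)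
  case 0
  then show ?case using assms(1) by (auto simp: ddelta_def)
next
  case (Suc k)
  then show ?case using dpow_at_1[of f k, OF assms(2)] assms by (simp add: dconv_prime algebra_simps)
qed

text \<open>On functions with value 1 at 1, evaluation at a prime turns convolution into addition,
  and mu has the value -1 there.\<close>

lemma h_fun_values:
  assumes f1: "\<And>j. j \<in> {1..c} \<Longrightarrow> f j 1 = 1"
  shows "h_fun c f l d 1 = 1" "prime p \<Longrightarrow> h_fun c f l d p = (\<Sum>j=1..c. of_nat (l j) * f j p) - of_nat d"
proof -
  let ?h = "\<lambda>js. foldr (\<lambda>j g. dpow (f j) (l j) \<star> g) js (dpow moebius_mu d)"
  have h1: "?h js 1 = 1" if "set js \<subseteq> {1..c}" for js
    using that
  proof (induction js)
    case Nil
    show ?case using dpow_at_1[of moebius_mu d] by (simp add: moebius_mu_1)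
  next
    case (Cons j js)
    then show ?case using dpow_at_1[of "f j" "l j"] f1[of j] by (simp add: dconv_1)
  qed
  show "h_fun c f l d 1 = 1" unfolding h_fun_def by (rule h1) auto
  assume p: "prime p"
  have "?h js p = (\<Sum>j\<leftarrow>js. of_nat (l j) * f j p) - of_nat d" if "set js \<subseteq> {1..c}" for js
    using that
  proof (induction js)
    case Nil
    have "moebius_mu p = -1" using moebius_mu_prime_power[OF p, of 1] by simp
    then show ?case using dpow_at_prime[OF p, of moebius_mu d] by (simp add: moebius_mu_1)
  next
    case (Cons j js)
    have "?h (j # js) p = dpow (f j) (l j) 1 * ?h js p + dpow (f j) (l j) p * ?h js 1"
      using dconv_prime[OF p] by simp
    then show ?case
      using Cons h1[of js] dpow_at_1[of "f j" "l j"] dpow_at_prime[OF p, of "f j" "l j"] f1[of j] by simp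
  qed
  from this[of "[1..<Suc c]"] show "h_fun c f l d p = (\<Sum>j=1..c. of_nat (l j) * f j p) - of_nat d"
    unfolding h_fun_def
    by (simp only: sum_list_distinct_conv_sum_set distinct_upt set_upt atLeastLessThanSuc_atLeastAtMost)
qed

lemma h_fun_zero:
  assumes j: "j \<in> {1..c}" "l j \<ge> 1" and f0: "\<And>m. m \<ge> 1 \<Longrightarrow> f j m = 0" and m: "m \<ge> 1"
  shows "h_fun c f l d m = 0"
proof -
  have z: "(u \<star> v) m = 0" if "\<And>k. k \<ge> 1 \<Longrightarrow> u k = 0" "m \<ge> 1" for u v m
    using dconv_cong[of m u "\<lambda>_. 0" v v] that by (simp add: dconv_def)
  have dp: "dpow (f j) (l j) k = 0" if "k \<ge> 1" for k
  proof -
    have "dpow (f j) (l j) = f j \<star> dpow (f j) (l j - 1)"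
      using j(2) by (cases "l j") (simp_all add: dconv_commute)
    moreover have "(f j \<star> dpow (f j) (l j - 1)) k = 0" by (rule z[OF f0 that])
    ultimately show ?thesis by simp
  qed
  have *: "foldr (\<lambda>j g. dpow (f j) (l j) \<star> g) js (dpow moebius_mu d) m = 0" if "j \<in> set js" "m \<ge> 1" for js m
    using that
  proof (induction js arbitrary: m)
    case (Cons i js)
    show ?case
    proof (cases "i = j")
      case True
      then show ?thesis using z[OF dp Cons.prems(2)] by simp
    next
      case False
      then have "foldr (\<lambda>j g. dpow (f j) (l j) \<star> g) js (dpow moebius_mu d) k = 0" if "k \<ge> 1" for k
        using Cons.IH[OF _ that] Cons.prems(1) by simp
      from z[OF this Cons.prems(2), where v = "dpow (f i) (l i)"] show ?thesis
        by (simp add: dconv_commute)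
    qed
  qed simp
  show ?thesis unfolding h_fun_def by (rule *) (use j(1) m in auto)
qed

text \<open>The divisors of a gcd are the common divisors, so the matrix is a sum of rank-one
  matrices, one for each e, with weight \<open>g e\<close>.\<close>

lemma gcd_quadratic_form:
  fixes h g :: "nat \<Rightarrow> complex" and y :: "nat \<Rightarrow> nat"
  assumes y: "\<And>i. i \<in> I \<Longrightarrow> y i > 0" and I: "finite I"
    and hg: "\<And>i m. i \<in> I \<Longrightarrow> m dvd y i \<Longrightarrow> h m = (\<Sum>e | e dvd m. g e)"
  shows "(\<Sum>i\<in>I. \<Sum>j\<in>I. h (gcd (y i) (y j)) * w j * cnj (w i))
    = (\<Sum>e\<in>(\<Union>i\<in>I. {e. e dvd y i}). g e * of_real ((norm (\<Sum>i | i \<in> I \<and> e dvd y i. w i))\<^sup>2))"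
proof -
  define E where "E = (\<Union>i\<in>I. {e. e dvd y i})"
  have finE: "finite E" using I y by (auto simp: E_def)
  have "h (gcd (y i) (y j)) = (\<Sum>e\<in>E. if e dvd y i \<and> e dvd y j then g e else 0)" if ij: "i \<in> I" "j \<in> I" for i j
  proof -
    have "h (gcd (y i) (y j)) = (\<Sum>e | e dvd gcd (y i) (y j). g e)" using ij by (intro hg) auto
    also have "{e. e dvd gcd (y i) (y j)} = {e \<in> E. e dvd y i \<and> e dvd y j}" using ij by (auto simp: E_def)
    finally show ?thesis using finE by (simp add: sum.inter_filter)
  qed
  then have "(\<Sum>i\<in>I. \<Sum>j\<in>I. h (gcd (y i) (y j)) * w j * cnj (w i))
    = (\<Sum>i\<in>I. \<Sum>j\<in>I. \<Sum>e\<in>E. if e dvd y i \<and> e dvd y j then g e * (w j * cnj (w i)) else 0)"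
    by (intro sum.cong refl) (auto simp: sum_distrib_right mult.assoc intro!: sum.cong)
  also have "\<dots> = (\<Sum>i\<in>I. \<Sum>e\<in>E. \<Sum>j\<in>I. if e dvd y i \<and> e dvd y j then g e * (w j * cnj (w i)) else 0)"
    by (intro sum.cong refl sum.swap)
  also have "\<dots> = (\<Sum>e\<in>E. \<Sum>i\<in>I. \<Sum>j\<in>I. if e dvd y i \<and> e dvd y j then g e * (w j * cnj (w i)) else 0)"
    by (rule sum.swap)
  also have "\<dots> = (\<Sum>e\<in>E. g e * of_real ((norm (\<Sum>i | i \<in> I \<and> e dvd y i. w i))\<^sup>2))"
  proof (intro sum.cong refl)
    fix e
    let ?J = "{i. i \<in> I \<and> e dvd y i}"
    have "(\<Sum>i\<in>I. \<Sum>j\<in>I. if e dvd y i \<and> e dvd y j then g e * (w j * cnj (w i)) else 0)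
        = (\<Sum>i\<in>I. if e dvd y i then \<Sum>j\<in>I. if e dvd y j then g e * (w j * cnj (w i)) else 0 else 0)"
      by (intro sum.cong) auto
    also have "\<dots> = (\<Sum>i\<in>?J. \<Sum>j\<in>?J. g e * (w j * cnj (w i)))"
      using I by (simp add: sum.inter_filter)
    also have "\<dots> = g e * ((\<Sum>j\<in>?J. w j) * cnj (\<Sum>i\<in>?J. w i))"
    proof -
      have "(\<Sum>j\<in>?J. w j) * cnj (\<Sum>i\<in>?J. w i) = (\<Sum>i\<in>?J. \<Sum>j\<in>?J. w j * cnj (w i))"
        unfolding cnj_sum sum_product by (rule sum.swap)
      then show ?thesis by (simp only: sum_distrib_left)
    qed
    also have "\<dots> = g e * of_real ((norm (\<Sum>i\<in>?J. w i))\<^sup>2)"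
      by (simp only: complex_norm_square)
    finally show "(\<Sum>i\<in>I. \<Sum>j\<in>I. if e dvd y i \<and> e dvd y j then g e * (w j * cnj (w i)) else 0)
        = g e * of_real ((norm (\<Sum>i\<in>?J. w i))\<^sup>2)" .
  qed
  finally show ?thesis by (simp only: E_def)
qed

lemma norm_sum_squared_le:
  fixes z :: "nat \<Rightarrow> complex"
  shows "(norm (\<Sum>t<q. z t))\<^sup>2 \<le> q * (\<Sum>t<q. (norm (z t))\<^sup>2)"
proof -
  have "(norm (\<Sum>t<q. z t))\<^sup>2 \<le> (\<Sum>t<q. norm (z t))\<^sup>2"
    by (intro power_mono norm_sum) auto
  also have "\<dots> \<le> (\<Sum>t<q. (norm (z t))\<^sup>2) * card {..<q}"
    by (rule sum_squared_le_sum_of_squares)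
  finally show ?thesis by (simp add: mult.commute)
qed

text \<open>Disjoint supports make squared norms additive, but the matrix still couples the vectors.
  In the sum of squares with nonnegative weights, \<open>norm_sum_squared_le\<close> bounds each
  square of a q-term combination; this is the origin of the factor q.\<close>

lemma
  fixes h g :: "nat \<Rightarrow> complex" and x :: "nat \<Rightarrow> nat"
  assumes x: "\<And>i. i \<ge> 1 \<Longrightarrow> x i > 0"
    and hg: "\<And>i m. i \<ge> 1 \<Longrightarrow> m dvd x i \<Longrightarrow> h m = (\<Sum>e | e dvd m. g e)"
    and g: "\<And>i m. i \<ge> 1 \<Longrightarrow> m dvd x i \<Longrightarrow> g m \<ge> 0"
    and q: "q \<ge> 1"
  shows gcd_mat_eigenvalue_nonneg: "n \<ge> q \<Longrightarrow> nth_eigenvalue (gcd_mat h x n) q \<ge> 0"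
    and gcd_mat_eigenvalue_le: "(\<forall>t<q. finite (I t) \<and>
        (\<Sum>i\<in>I t. \<Sum>j\<in>I t. Re (h (gcd (x (Suc i)) (x (Suc j)))) * v t i * v t j) \<le> eps \<and> (\<Sum>i\<in>I t. (v t i)\<^sup>2) \<ge> (1 :: real)) \<Longrightarrow>
      (\<forall>s<q. \<forall>t<q. s \<noteq> t \<longrightarrow> I s \<inter> I t = {}) \<Longrightarrow> (\<forall>t<q. I t \<subseteq> {..<n}) \<Longrightarrow> eps \<ge> 0 \<Longrightarrow> n \<ge> q \<Longrightarrow>
      nth_eigenvalue (gcd_mat h x n) q \<le> q * eps"
proof -
  define y where "y i = x (Suc i)" for i
  have y: "y i > 0" for i using x by (simp add: y_def)
  have hg': "h m = (\<Sum>e | e dvd m. g e)" if "m dvd y i" for i m using hg[of "Suc i"] that by (simp add: y_def)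
  have g': "g m \<ge> 0" if "m dvd y i" for i m using g[of "Suc i"] that by (simp add: y_def)
  have h0: "h m \<ge> 0" if "m dvd y i" for i m
    unfolding hg'[OF that] by (intro sum_nonneg g'[of _ i]) (use that in \<open>auto intro: dvd_trans\<close>)
  have carrier: "gcd_mat h x n \<in> carrier_mat n n" for n by (simp add: gcd_mat_def)
  have sym: "gcd_mat h x n $$ (i, j) = gcd_mat h x n $$ (j, i)" if "i < n" "j < n" for i j n
    using that by (simp add: gcd_mat_def gcd.commute)
  have re: "gcd_mat h x n $$ (i, j) \<in> \<real>" if "i < n" "j < n" for i j n
    using that h0[of "gcd (y i) (y j)" i] by (simp add: gcd_mat_def y_def nonnegative_complex_is_real)
  define Z where "Z I w e = (norm (\<Sum>i | i \<in> I \<and> e dvd y i. w i :: complex))\<^sup>2" for I w e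
  define E where "E I = (\<Union>i\<in>I. {e. e dvd y i})" for I :: "nat set"
  have gE: "Re (g e) \<ge> 0" "Im (g e) = 0" if "e \<in> E I" for e I
    using g' that by (auto simp: E_def less_eq_complex_def)
  have form: "(\<Sum>i\<in>I. \<Sum>j\<in>I. h (gcd (y i) (y j)) * w j * cnj (w i)) = of_real (\<Sum>e\<in>E I. Re (g e) * Z I w e)"
    if "finite I" for I w
  proof -
    have "(\<Sum>i\<in>I. \<Sum>j\<in>I. h (gcd (y i) (y j)) * w j * cnj (w i)) = (\<Sum>e\<in>E I. g e * of_real (Z I w e))"
      unfolding E_def Z_def using y hg' that by (intro gcd_quadratic_form)
    also have "\<dots> = (\<Sum>e\<in>E I. of_real (Re (g e) * Z I w e))"
      using gE by (intro sum.cong refl) (simp add: complex_eq_iff)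
    finally show ?thesis by simp
  qed
  have app: "cinner n (mat_app (gcd_mat h x n) n w) w = of_real (\<Sum>e\<in>E {..<n}. Re (g e) * Z {..<n} w e)" for n w
    unfolding form[OF finite_lessThan, symmetric]
    by (simp add: cinner_def mat_app_def gcd_mat_def y_def sum_distrib_right)
  show "nth_eigenvalue (gcd_mat h x n) q \<ge> 0" if "n \<ge> q"
  proof (rule nth_eigenvalue_nonneg[OF carrier sym re q that])
    show "Re (cinner n (mat_app (gcd_mat h x n) n w) w) \<ge> 0" for w
      unfolding app Re_complex_of_real using gE by (intro sum_nonneg mult_nonneg_nonneg) (auto simp: Z_def)
  qed
  assume I: "\<forall>t<q. finite (I t) \<and> (\<Sum>i\<in>I t. \<Sum>j\<in>I t. Re (h (gcd (x (Suc i)) (x (Suc j)))) * v t i * v t j) \<le> eps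
      \<and> (\<Sum>i\<in>I t. (v t i)\<^sup>2) \<ge> 1"
    and disj: "\<forall>s<q. \<forall>t<q. s \<noteq> t \<longrightarrow> I s \<inter> I t = {}" and sub: "\<forall>t<q. I t \<subseteq> {..<n}"
    and eps: "eps \<ge> 0" and n: "n \<ge> q"
  define V where "V t i = complex_of_real (if i \<in> I t then v t i else 0)" for t i
  have VE: "(\<Sum>e\<in>E {..<n}. Re (g e) * Z {..<n} (V t) e) \<le> eps" if t: "t < q" for t
  proof -
    have fin: "finite (I t)" using I t by blast
    have "complex_of_real (\<Sum>e\<in>E {..<n}. Re (g e) * Z {..<n} (V t) e)
        = (\<Sum>i<n. \<Sum>j<n. h (gcd (y i) (y j)) * V t j * cnj (V t i))"
      by (rule form[symmetric]) simp
    also have "\<dots> = (\<Sum>i\<in>I t. \<Sum>j<n. h (gcd (y i) (y j)) * V t j * cnj (V t i))"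
      using sub t by (intro sum.mono_neutral_right) (auto simp: V_def)
    also have "\<dots> = (\<Sum>i\<in>I t. \<Sum>j\<in>I t. h (gcd (y i) (y j)) * V t j * cnj (V t i))"
      using sub t by (intro sum.cong refl sum.mono_neutral_right) (auto simp: V_def)
    finally have eq: "complex_of_real (\<Sum>e\<in>E {..<n}. Re (g e) * Z {..<n} (V t) e)
        = (\<Sum>i\<in>I t. \<Sum>j\<in>I t. h (gcd (y i) (y j)) * V t j * cnj (V t i))" .
    have "(\<Sum>e\<in>E {..<n}. Re (g e) * Z {..<n} (V t) e)
        = Re (\<Sum>i\<in>I t. \<Sum>j\<in>I t. h (gcd (y i) (y j)) * V t j * cnj (V t i))"
      unfolding eq[symmetric] by simp
    also have "\<dots> = (\<Sum>i\<in>I t. \<Sum>j\<in>I t. Re (h (gcd (y i) (y j))) * v t i * v t j)"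
      by (simp add: V_def mult_ac)
    finally show ?thesis using I t by (simp add: y_def)
  qed
  show "nth_eigenvalue (gcd_mat h x n) q \<le> q * eps"
  proof (rule nth_eigenvalue_le[OF carrier sym re q n, where v = V])
    fix \<alpha> :: "nat \<Rightarrow> complex" and w
    assume \<alpha>: "\<exists>t<q. \<alpha> t \<noteq> 0" and w: "w = (\<lambda>i. \<Sum>t<q. \<alpha> t * V t i)"
    define s where "s = (\<Sum>t<q. (norm (\<alpha> t))\<^sup>2)"
    have s: "s > 0"
    proof -
      obtain t where "t < q" "\<alpha> t \<noteq> 0" using \<alpha> by blast
      then show ?thesis unfolding s_def by (intro sum_pos2[of _ t]) auto
    qed
    \<comment> \<open>At each index at most one of the q summands is nonzero.\<close>
    have sq: "(norm (w i))\<^sup>2 = (\<Sum>t<q. (norm (\<alpha> t * V t i))\<^sup>2)" for i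
    proof (cases "\<exists>t<q. i \<in> I t")
      case True
      then obtain t where t: "t < q" "i \<in> I t" by blast
      have V0: "V s i = 0" if "s < q" "s \<noteq> t" for s
        using disj t that by (auto simp: V_def)
      have "w i = (\<Sum>s<q. if s = t then \<alpha> t * V t i else 0)" unfolding w using V0 by (intro sum.cong) auto
      moreover have "(\<Sum>s<q. (norm (\<alpha> s * V s i))\<^sup>2) = (\<Sum>s<q. if s = t then (norm (\<alpha> t * V t i))\<^sup>2 else 0)"
        using V0 by (intro sum.cong) auto
      ultimately show ?thesis using t by simp
    next
      case False
      then have "V t i = 0" if "t < q" for t using that by (auto simp: V_def)
      then show ?thesis by (simp add: w)
    qed
    have "(\<Sum>i<n. (norm (w i))\<^sup>2) = (\<Sum>t<q. (norm (\<alpha> t))\<^sup>2 * (\<Sum>i<n. (norm (V t i))\<^sup>2))"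
      unfolding sq sum_distrib_left norm_mult power_mult_distrib by (rule sum.swap)
    also have "\<dots> \<ge> (\<Sum>t<q. (norm (\<alpha> t))\<^sup>2 * 1)"
    proof (intro sum_mono mult_left_mono)
      fix t assume "t \<in> {..<q}"
      then have t: "t < q" by simp
      have "(\<Sum>i<n. (norm (V t i))\<^sup>2) = (\<Sum>i\<in>I t. (norm (V t i))\<^sup>2)"
        using sub t by (intro sum.mono_neutral_right) (auto simp: V_def)
      also have "\<dots> = (\<Sum>i\<in>I t. (v t i)\<^sup>2)" by (intro sum.cong) (auto simp: V_def)
      finally show "1 \<le> (\<Sum>i<n. (norm (V t i))\<^sup>2)" using I t by simp
    qed auto
    finally have norm_w: "(\<Sum>i<n. (norm (w i))\<^sup>2) \<ge> s" by (simp add: s_def)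
    have Zw: "Z {..<n} w e \<le> q * (\<Sum>t<q. (norm (\<alpha> t))\<^sup>2 * Z {..<n} (V t) e)" for e
    proof -
      have "(\<Sum>i | i \<in> {..<n} \<and> e dvd y i. w i) = (\<Sum>t<q. \<alpha> t * (\<Sum>i | i \<in> {..<n} \<and> e dvd y i. V t i))"
        unfolding w sum_distrib_left by (rule sum.swap)
      then show ?thesis using norm_sum_squared_le[of "\<lambda>t. \<alpha> t * (\<Sum>i | i \<in> {..<n} \<and> e dvd y i. V t i)" q]
        by (simp add: Z_def norm_mult power_mult_distrib)
    qed
    have "Re (cinner n (mat_app (gcd_mat h x n) n w) w) = (\<Sum>e\<in>E {..<n}. Re (g e) * Z {..<n} w e)"
      unfolding app by simp
    also have "\<dots> \<le> (\<Sum>e\<in>E {..<n}. Re (g e) * (q * (\<Sum>t<q. (norm (\<alpha> t))\<^sup>2 * Z {..<n} (V t) e)))"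
      using gE by (intro sum_mono mult_left_mono Zw) auto
    also have "\<dots> = q * (\<Sum>t<q. (norm (\<alpha> t))\<^sup>2 * (\<Sum>e\<in>E {..<n}. Re (g e) * Z {..<n} (V t) e))"
      unfolding sum_distrib_left by (subst sum.swap) (simp only: mult_ac)
    also have "\<dots> \<le> q * (\<Sum>t<q. (norm (\<alpha> t))\<^sup>2 * eps)"
      by (intro mult_left_mono sum_mono VE) auto
    also have "\<dots> = q * eps * s" by (simp add: s_def sum_distrib_right sum_distrib_left mult_ac)
    also have "\<dots> \<le> q * eps * (\<Sum>i<n. (norm (w i))\<^sup>2)"
      using norm_w eps by (intro mult_left_mono) auto
    finally have "Re (cinner n (mat_app (gcd_mat h x n) n w) w) \<le> q * eps * Re (cinner n w w)"
      by (simp add: cinner_self)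
    then show "Re (cinner n (mat_app (gcd_mat h x n) n w) w) \<le> q * eps * Re (cinner n w w) \<and> Re (cinner n w w) > 0"
      using norm_w s by (simp add: cinner_self)
  qed
qed

section \<open>Enumeration of the primes congruent to 1\<close>

lemma ap_prime_set:
  fixes b :: nat
  assumes b: "b > 0"
  shows "{p :: nat. prime p \<and> (\<exists>k. p = 1 + b * k)} = {p. prime p \<and> [p = 1] (mod b)}"
proof -
  have "(\<exists>k. p = 1 + b * k) \<longleftrightarrow> [p = 1] (mod b)" if "prime p" for p :: nat
  proof -
    have p: "p \<ge> 1" using prime_gt_0_nat[OF that] by simp
    have "[p = 1] (mod b) \<longleftrightarrow> b dvd p - 1"
      using mod_eq_dvd_iff_nat[OF p, of b] by (simp add: Cong.cong_def)
    also have "\<dots> \<longleftrightarrow> (\<exists>k. p = 1 + b * k)" unfolding dvd_def using p by (intro iff_exI) auto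
    finally show ?thesis by simp
  qed
  then show ?thesis by blast
qed

text \<open>\<open>enumerate\<close> behaves as an increasing enumeration only for infinite sets, so
  \<open>ap_prime\<close> has its meaning only by this case of Dirichlet's theorem, here a
  consequence of the divergence.\<close>

lemma infinite_ap_primes:
  fixes b :: nat
  assumes b: "b > 0"
  shows "infinite {p :: nat. prime p \<and> (\<exists>k. p = 1 + b * k)}"
proof
  assume fin: "finite {p :: nat. prime p \<and> (\<exists>k. p = 1 + b * k)}"
  have "\<forall>N. (\<Sum>p | p \<le> N \<and> prime p \<and> [p = 1] (mod b). 1 / real p)
      \<le> (\<Sum>p | prime p \<and> [p = 1] (mod b). 1 / real p)"
    using fin unfolding ap_prime_set[OF b] by (intro allI sum_mono2) auto
  with prime_reciprocals_unbounded[OF b] show False by (rule notE)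
qed

lemma ap_prime_in:
  assumes "b > 0"
  shows "prime (ap_prime b i)" "[ap_prime b i = 1] (mod b)"
  using enumerate_in_set[OF infinite_ap_primes[OF assms], of "i - 1"]
  unfolding ap_prime_def ap_prime_set[OF assms] by auto

lemma ap_prime_inj:
  assumes "b > 0"
  shows "inj_on (ap_prime b) {1..}"
proof (rule linorder_inj_onI')
  fix i j assume "i \<in> {1..}" "j \<in> {1..}" "i < (j :: nat)"
  then have "i - 1 < j - 1" by auto
  from enumerate_mono[OF this infinite_ap_primes[OF assms]] show "ap_prime b i \<noteq> ap_prime b j"
    unfolding ap_prime_def by simp
qed

lemma ap_prime_surj:
  assumes "b > 0" "prime p" "[p = 1] (mod b)"
  shows "\<exists>i\<ge>1. ap_prime b i = p"
proof -
  have "p \<in> {p :: nat. prime p \<and> (\<exists>k. p = 1 + b * k)}" unfolding ap_prime_set[OF assms(1)] using assms(2,3) by simp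
  from enumerate_Ex[OF infinite_ap_primes[OF assms(1)] this]
  obtain n where "enumerate {p :: nat. prime p \<and> (\<exists>k. p = 1 + b * k)} n = p"
    by (elim exE) (rule that)
  then show ?thesis unfolding ap_prime_def by (intro exI[of _ "Suc n"]) simp
qed

text \<open>The numbers up to K are K + 1 in number and weigh at most 1 each.\<close>

lemma unbounded_sums_tail:
  fixes w :: "nat \<Rightarrow> real"
  assumes w: "\<And>p. p \<in> S \<Longrightarrow> w p \<le> 1" and T: "finite T" "T \<subseteq> S" "sum w T \<ge> B + real K + 1"
  shows "\<exists>T. finite T \<and> (\<forall>p\<in>T. p \<in> S \<and> p > K) \<and> sum w T \<ge> B"
proof (rule exI[of _ "T - {..K}"], intro conjI ballI)
  have "sum w T = sum w (T \<inter> {..K}) + sum w (T - {..K})" using T(1) by (rule sum.Int_Diff)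
  also have "sum w (T \<inter> {..K}) \<le> (\<Sum>p\<in>T \<inter> {..K}. 1)" using w T(2) by (intro sum_mono) auto
  also have "(\<Sum>p\<in>T \<inter> {..K}. 1 :: real) = card (T \<inter> {..K})" by simp
  also have "card (T \<inter> {..K}) \<le> card {..K}" by (intro card_mono) auto
  finally show "sum w (T - {..K}) \<ge> B" using T(3) by simp
qed (use T in auto)

lemma gcd_mat_eigenvalue_tendsto_0:
  fixes h g :: "nat \<Rightarrow> complex" and x :: "nat \<Rightarrow> nat"
  assumes x: "\<And>i. i \<ge> 1 \<Longrightarrow> x i > 0" "strict_mono_on {1..} x"
    and hg: "\<And>i m. i \<ge> 1 \<Longrightarrow> m dvd x i \<Longrightarrow> h m = (\<Sum>e | e dvd m. g e)"
    and g: "\<And>i m. i \<ge> 1 \<Longrightarrow> m dvd x i \<Longrightarrow> g m \<ge> 0"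
    and q: "q \<ge> 1"
    and h: "multiplicative_fun h" "h 1 = 1" and a: "a \<ge> 1"
    and ap: "\<And>m. m \<ge> M \<Longrightarrow> [m = a] (mod b) \<Longrightarrow> \<exists>i\<ge>1. x i = m"
    and H: "\<And>p. prime p \<Longrightarrow> [p = 1] (mod b) \<Longrightarrow> h p = of_real (H p) \<and> H p \<ge> 1"
    and div: "\<And>B. \<exists>T. finite T \<and> T \<subseteq> {p. prime p \<and> [p = 1] (mod b)} \<and> (\<Sum>p\<in>T. 1 / H p) \<ge> B"
  shows "(\<lambda>n. nth_eigenvalue (gcd_mat h x n) q) \<longlonglongrightarrow> 0"
proof (rule LIMSEQ_I)
  fix r :: real assume r: "r > 0"
  \<comment> \<open>The factor q compensates the coupling of the q test vectors.\<close>
  define eps where "eps = r / (2 * q)"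
  have eps: "eps > 0" "q * eps < r" using r q by (auto simp: eps_def field_simps)
  define y where "y i = x (Suc i)" for i
  have y: "strict_mono y"
    unfolding y_def by (rule strict_monoI) (use x(2) in \<open>auto simp: strict_mono_on_def\<close>)
  have ap': "\<exists>i. y i = m" if m: "m \<ge> M" "[m = a] (mod b)" for m
  proof -
    obtain i where "i \<ge> 1" "x i = m" using ap[OF m] by blast
    then show ?thesis unfolding y_def by (intro exI[of _ "i - 1"]) simp
  qed
  have H1: "1 / H p \<le> 1" if "p \<in> {p. prime p \<and> [p = 1] (mod b)}" for p
    using H[of p] that by simp
  have div': "\<exists>T. finite T \<and> (\<forall>p\<in>T. prime p \<and> [p = 1] (mod b) \<and> p > K) \<and> (\<Sum>p\<in>T. 1 / H p) \<ge> B" for K B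
  proof -
    obtain T where T: "finite T" "T \<subseteq> {p. prime p \<and> [p = 1] (mod b)}" "(\<Sum>p\<in>T. 1 / H p) \<ge> B + real K + 1"
      using div[of "B + real K + 1"] by (elim exE conjE) (rule that)
    from unbounded_sums_tail[OF H1 this] show ?thesis by simp
  qed
  define R where "R I v \<longleftrightarrow> (\<Sum>i\<in>I. \<Sum>j\<in>I. Re (h (gcd (y i) (y j))) * v i * v j) \<le> eps \<and> (\<Sum>i\<in>I. (v i)\<^sup>2) \<ge> (1 :: real)"
    for I v
  have "\<exists>I v. finite I \<and> (\<forall>i\<in>I. i \<ge> N) \<and> R I v" for N
    unfolding R_def by (rule small_test_vector[OF h a y ap' H div' eps(1)])
  from disjoint_test_vectors[of R q, OF this] obtain I v where
    I: "\<forall>t<q. finite (I t) \<and> R (I t) (v t)" and disj: "\<forall>s<q. \<forall>t<q. s \<noteq> t \<longrightarrow> I s \<inter> I t = {}"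
    by (elim exE conjE) (rule that)
  define n0 where "n0 = max q (Suc (Max (insert 0 (\<Union>t<q. I t))))"
  have sub: "\<forall>t<q. I t \<subseteq> {..<n}" if "n \<ge> n0" for n
  proof (intro allI impI subsetI)
    fix t i assume "t < q" "i \<in> I t"
    then have "i \<le> Max (insert 0 (\<Union>t<q. I t))" using I by (intro Max_ge) auto
    then show "i \<in> {..<n}" using that by (simp add: n0_def)
  qed
  show "\<exists>n0. \<forall>n\<ge>n0. norm (nth_eigenvalue (gcd_mat h x n) q - 0) < r"
  proof (intro exI[of _ n0] allI impI)
    fix n assume n: "n \<ge> n0"
    then have nq: "n \<ge> q" by (simp add: n0_def)
    have "nth_eigenvalue (gcd_mat h x n) q \<le> q * eps"
    proof (rule gcd_mat_eigenvalue_le[OF x(1) hg g q _ disj sub[OF n] less_imp_le[OF eps(1)] nq])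
      show "\<forall>t<q. finite (I t) \<and> (\<Sum>i\<in>I t. \<Sum>j\<in>I t. Re (h (gcd (x (Suc i)) (x (Suc j)))) * v t i * v t j) \<le> eps
          \<and> 1 \<le> (\<Sum>i\<in>I t. (v t i)\<^sup>2)"
        using I unfolding R_def y_def .
    qed
    moreover have "nth_eigenvalue (gcd_mat h x n) q \<ge> 0"
      by (rule gcd_mat_eigenvalue_nonneg[OF x(1) hg g q nq])
    ultimately show "norm (nth_eigenvalue (gcd_mat h x n) q - 0) < r" using eps(2) by simp
  qed
qed

theorem theorem1p7:
  fixes a b c q d e :: nat
    and x l :: "nat \<Rightarrow> nat"
    and f :: "nat \<Rightarrow> nat \<Rightarrow> complex"
    and h :: "nat \<Rightarrow> complex"
    and eig :: "nat \<Rightarrow> nat \<Rightarrow> real"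
  assumes "a \<ge> 1" and "b \<ge> 1" and "c \<ge> 1" and "q \<ge> 1"
    and x_pos: "\<And>i. i \<ge> 1 \<Longrightarrow> x i > 0"
    and x_incr: "strict_mono_on {1..} x"
    and x_ap: "\<exists>s. strict_mono_on {e..} s \<and> (\<forall>i\<ge>e. s i \<ge> 1 \<and> x (s i) = a + b * i)"
    and l_pos: "\<And>j. j \<in> {1..c} \<Longrightarrow> l j \<ge> 1"
    and l_sum: "(\<Sum>j=1..c. l j) > d"
    and f_class: "\<And>j. j \<in> {1..c} \<Longrightarrow> f j \<in> class_C x"
    and f_distinct: "\<And>j k. j \<in> {1..c} \<Longrightarrow> k \<in> {1..c} \<Longrightarrow> j \<noteq> k \<Longrightarrow> \<exists>m\<ge>1. f j m \<noteq> f k m"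
    and f_mult: "\<And>j. j \<in> {1..c} \<Longrightarrow> multiplicative_fun (f j)"
    and f_incr: "\<And>j. j \<in> {1..c} \<Longrightarrow> increasing_on_seq (f j) (ap_prime b)"
    and h_eq: "h = h_fun c f l d"
    and eig_eq: "eig = (\<lambda>n k. nth_eigenvalue (gcd_mat h x n) k)"
  shows
    "((\<exists>i\<ge>1. h (ap_prime b i) = 0) \<longrightarrow> (\<forall>\<^sub>F n in sequentially. eig n q = 0)) \<and>
     ((\<forall>i\<ge>1. h (ap_prime b i) \<noteq> 0) \<and>
        filterlim (\<lambda>N. \<Sum>i=1..N. 1 / (\<Sum>j=1..c. Re (f j (ap_prime b i)))) at_top sequentially
      \<longrightarrow> (\<lambda>n. eig n q) \<longlonglongrightarrow> 0) \<and>
     ((\<forall>j\<in>{1..c}. \<exists>C>0. \<forall>i\<ge>1. f j (ap_prime b i) \<le> complex_of_real (C * real (ap_prime b i)))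
      \<longrightarrow> (\<lambda>n. eig n q) \<longlonglongrightarrow> 0)"
proof -
  have b0: "b > 0" using \<open>b \<ge> 1\<close> by simp
  define D where "D = {m. \<exists>i\<ge>1. m dvd x i}"
  interpret D: divisor_closed D
    using x_pos by unfold_locales (auto simp: D_def intro: dvd_trans dvd_pos_nat)
  have fD: "(f j \<star> moebius_mu) m \<ge> 0" if "j \<in> {1..c}" "m \<in> D" for j m
    using f_class[OF that(1)] that(2) by (auto simp: class_C_def D_def)
  have g: "(h \<star> moebius_mu) m \<ge> 0" if "i \<ge> 1" "m dvd x i" for i m
    unfolding h_eq by (rule D.h_fun_moebius_nonneg[OF fD l_sum]) (use that in \<open>auto simp: D_def\<close>)
  have hg: "h m = (\<Sum>e | e dvd m. (h \<star> moebius_mu) e)" if "i \<ge> 1" "m dvd x i" for i m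
  proof -
    have "m > 0" using that x_pos[OF that(1)] by (auto intro: dvd_pos_nat)
    then have "((h \<star> moebius_mu) \<star> (\<lambda>_. 1)) m = h m" by (rule dconv_moebius_one)
    then show ?thesis by (simp add: dconv_def[of "h \<star> moebius_mu"])
  qed
  show ?thesis
  proof (cases "\<forall>j\<in>{1..c}. f j 1 = 1")
    case False
    then obtain j where j: "j \<in> {1..c}" "f j 1 \<noteq> 1" by blast
    then have "\<And>m. m \<ge> 1 \<Longrightarrow> f j m = 0" using multiplicative_fun_1[OF f_mult[OF j(1)]] by blast
    then have h0: "h m = 0" if "m \<ge> 1" for m
      unfolding h_eq using j(1) l_pos[OF j(1)] that by (intro h_fun_zero)
    have "eig n q = 0" if n: "n \<ge> q" for n
    proof -
      have "h (gcd (x (Suc i)) (x (Suc i'))) = 0" "h (x (Suc i)) = 0" for i i'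
        using x_pos[of "Suc i"] by (auto intro!: h0 simp: Suc_le_eq)
      \<comment> \<open>The matrix is zero, so standard unit vectors serve as test vectors with
        bound 0.\<close>
      then have "nth_eigenvalue (gcd_mat h x n) q \<le> real q * 0"
        using n \<open>q \<ge> 1\<close>
        by (intro gcd_mat_eigenvalue_le[OF x_pos hg g, where I = "\<lambda>t. {t}" and v = "\<lambda>_ _. 1"]) auto
      moreover have "nth_eigenvalue (gcd_mat h x n) q \<ge> 0"
        by (rule gcd_mat_eigenvalue_nonneg[OF x_pos hg g \<open>q \<ge> 1\<close> n])
      ultimately show ?thesis by (simp add: eig_eq)
    qed
    then have ev: "\<forall>\<^sub>F n in sequentially. eig n q = 0" by (rule eventually_sequentiallyI)
    then have "(\<lambda>n. eig n q) \<longlonglongrightarrow> 0" by (rule tendsto_eventually)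
    with ev show ?thesis by blast
  next
    case True
    then have f1: "\<And>j. j \<in> {1..c} \<Longrightarrow> f j 1 = 1" by blast
    obtain s where s: "\<And>i. i \<ge> e \<Longrightarrow> s i \<ge> 1 \<and> x (s i) = a + b * i" using x_ap by blast
    have ap: "\<exists>i\<ge>1. x i = m" if m: "m \<ge> a + b * e" "[m = a] (mod b)" for m
    proof -
      have "b dvd m - a" using m mod_eq_dvd_iff_nat[of a m b] by (simp add: Cong.cong_def)
      then obtain i where "m - a = b * i" by blast
      then have i: "m = a + b * i" using m(1) by simp
      then have "i \<ge> e" using m(1) b0 by simp
      then show ?thesis using s[of i] i by blast
    qed
    define S where "S = {p. prime p \<and> [p = 1] (mod b)}"
    have SD: "p \<in> D" if "p \<in> S" for p
    proof -
      have p: "prime p" "[p = 1] (mod b)" using that by (auto simp: S_def)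
      \<comment> \<open>To use the class condition at p, some \<open>x i\<close> divisible by p is
        needed. The number \<open>a * p ^ ?k\<close> is congruent to a, and as
        \<open>?k < p ^ ?k\<close> it is large enough to lie in the progression.\<close>
      let ?k = "Suc (a + b * e)"
      have "?k < p ^ ?k" using power_gt_expt[of p ?k] prime_ge_2_nat[OF p(1)] by simp
      then have "a + b * e \<le> a * p ^ ?k" using \<open>a \<ge> 1\<close> mult_le_mono1[of 1 a "p ^ ?k"] by linarith
      moreover have "[a * p ^ ?k = a] (mod b)"
        using cong_mult[OF cong_refl[of a] cong_pow[OF p(2), of ?k]] by (simp only: power_one mult_1_right)
      ultimately obtain i where "i \<ge> 1" "x i = a * p ^ ?k" using ap by blast
      then show ?thesis unfolding D_def by (intro CollectI exI[of _ i]) simp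
    qed
    define F where "F j p = Re (f j p)" for j p
    have F: "f j p = of_real (F j p)" "F j p \<ge> 1" if "p \<in> S" "j \<in> {1..c}" for j p
    proof -
      have p: "prime p" "p > 0" using that(1) prime_gt_0_nat by (auto simp: S_def)
      have "f j p = ((f j \<star> moebius_mu) \<star> (\<lambda>_. 1)) p" using dconv_moebius_one[OF p(2)] by simp
      \<comment> \<open>At a prime, f exceeds f 1 = 1 by the value of f * mu, which is
        nonnegative.\<close>
      also have "\<dots> = 1 + (f j \<star> moebius_mu) p"
        using dconv_prime[OF p(1)] f1[OF that(2)] by (simp add: dconv_1 moebius_mu_1)
      finally have "f j p = 1 + (f j \<star> moebius_mu) p" .
      moreover have "(f j \<star> moebius_mu) p \<ge> 0" using fD that SD by blast
      ultimately show "f j p = of_real (F j p)" "F j p \<ge> 1"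
        by (auto simp: F_def less_eq_complex_def complex_eq_iff)
    qed
    \<comment> \<open>L bounds every l j, so H is at most L times the sum of the f j; divergence for
      that sum then passes to 1 / H.\<close>
    define L where "L = real (\<Sum>j=1..c. l j)"
    have "0 < (\<Sum>j=1..c. l j)" using l_sum by linarith
    then have L: "L > 0" by (simp only: L_def of_nat_0_less_iff)
    define H where "H p = (\<Sum>j=1..c. l j * F j p) - d" for p
    have h_val: "h 1 = 1" "\<And>p. prime p \<Longrightarrow> h p = (\<Sum>j=1..c. of_nat (l j) * f j p) - of_nat d"
      unfolding h_eq using h_fun_values[where c = c and f = f and l = l and d = d, OF f1] by simp_all
    have H: "h p = of_real (H p)" "H p \<ge> 1" "H p \<le> L * (\<Sum>j=1..c. F j p)" if p: "p \<in> S" for p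
    proof -
      have "prime p" using p by (simp add: S_def)
      then show "h p = of_real (H p)" using F(1)[OF p] by (simp add: h_val(2) H_def)
      have "(\<Sum>j=1..c. real (l j) * 1) \<le> (\<Sum>j=1..c. l j * F j p)"
        using F(2)[OF p] by (intro sum_mono mult_left_mono) auto
      moreover have "real d + 1 \<le> (\<Sum>j=1..c. real (l j) * 1)"
      proof -
        have "d + 1 \<le> (\<Sum>j=1..c. l j)" using l_sum by simp
        then have "real (d + 1) \<le> real (\<Sum>j=1..c. l j)" by (simp only: of_nat_le_iff)
        then show ?thesis by simp
      qed
      ultimately show "H p \<ge> 1" by (simp add: H_def)
      have "l j \<le> (\<Sum>j=1..c. l j)" if "j \<in> {1..c}" for j using that by (intro member_le_sum) auto
      then have "real (l j) \<le> L" if "j \<in> {1..c}" for j using that unfolding L_def by (simp only: of_nat_le_iff)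
      then have "(\<Sum>j=1..c. l j * F j p) \<le> (\<Sum>j=1..c. L * F j p)"
        using F(2)[OF p] by (intro sum_mono mult_right_mono) force+
      then show "H p \<le> L * (\<Sum>j=1..c. F j p)" by (simp add: H_def sum_distrib_left)
    qed
    have lim: "(\<lambda>n. eig n q) \<longlonglongrightarrow> 0"
      if "\<And>B. \<exists>T. finite T \<and> T \<subseteq> S \<and> (\<Sum>p\<in>T. 1 / H p) \<ge> B"
      unfolding eig_eq
    proof (rule gcd_mat_eigenvalue_tendsto_0[OF x_pos x_incr hg g \<open>q \<ge> 1\<close> _ h_val(1) \<open>a \<ge> 1\<close> ap])
      show "multiplicative_fun h" unfolding h_eq by (rule multiplicative_h_fun) (rule f_mult)
      show "h p = of_real (H p) \<and> 1 \<le> H p" if "prime p" "[p = 1] (mod b)" for p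
        using H(1,2)[of p] that by (simp add: S_def)
      show "\<exists>T. finite T \<and> T \<subseteq> {p. prime p \<and> [p = 1] (mod b)} \<and> B \<le> (\<Sum>p\<in>T. 1 / H p)" for B
        using that[of B] by (simp add: S_def)
    qed
    have apS: "ap_prime b i \<in> S" for i using ap_prime_in[OF b0] by (simp add: S_def)
    have "h (ap_prime b i) \<noteq> 0" for i using H(1,2)[OF apS[of i]] by auto
    \<comment> \<open>So the first part only concerns the case \<open>h = 0\<close> above.\<close>
    then have part1: "\<not> (\<exists>i\<ge>1. h (ap_prime b i) = 0)" by blast
    have part2: "(\<lambda>n. eig n q) \<longlonglongrightarrow> 0"
      if lim_top: "filterlim (\<lambda>N. \<Sum>i=1..N. 1 / (\<Sum>j=1..c. Re (f j (ap_prime b i)))) at_top sequentially"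
    proof (rule lim)
      fix B
      have "\<forall>\<^sub>F N in sequentially. (\<Sum>i=1..N. 1 / (\<Sum>j=1..c. Re (f j (ap_prime b i)))) \<ge> L * B"
        using lim_top unfolding filterlim_at_top by blast
      then obtain N where N: "(\<Sum>i=1..N. 1 / (\<Sum>j=1..c. F j (ap_prime b i))) \<ge> L * B"
        unfolding F_def eventually_sequentially by blast
      have inj: "inj_on (ap_prime b) {1..N}" using ap_prime_inj[OF b0] by (rule inj_on_subset) auto
      have "L * B / L \<le> (\<Sum>i=1..N. 1 / (\<Sum>j=1..c. F j (ap_prime b i))) / L"
        using N L by (intro divide_right_mono) auto
      also have "\<dots> = (\<Sum>i=1..N. 1 / (L * (\<Sum>j=1..c. F j (ap_prime b i))))"
        by (simp add: sum_divide_distrib mult.commute)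
      also have "\<dots> \<le> (\<Sum>i=1..N. 1 / H (ap_prime b i))"
      proof (rule sum_mono)
        fix i
        show "1 / (L * (\<Sum>j=1..c. F j (ap_prime b i))) \<le> 1 / H (ap_prime b i)"
          using H(2,3)[OF apS[of i]] by (intro frac_le) linarith+
      qed
      also have "\<dots> = (\<Sum>p\<in>ap_prime b ` {1..N}. 1 / H p)" using inj by (simp add: sum.reindex)
      finally have "B \<le> (\<Sum>p\<in>ap_prime b ` {1..N}. 1 / H p)" using L by simp
      then show "\<exists>T. finite T \<and> T \<subseteq> S \<and> B \<le> (\<Sum>p\<in>T. 1 / H p)"
        using apS by (intro exI[of _ "ap_prime b ` {1..N}"]) auto
    qed
    have part3: "(\<lambda>n. eig n q) \<longlonglongrightarrow> 0"
      if C: "\<forall>j\<in>{1..c}. \<exists>C>0. \<forall>i\<ge>1. f j (ap_prime b i) \<le> complex_of_real (C * real (ap_prime b i))"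
    proof (rule lim)
      fix B
      from bchoice[OF C] obtain K where
        K: "\<forall>j\<in>{1..c}. K j > 0 \<and> (\<forall>i\<ge>1. f j (ap_prime b i) \<le> complex_of_real (K j * real (ap_prime b i)))"
        by (elim exE) (rule that)
      \<comment> \<open>The summand 1 makes positivity of Q immediate; what matters is only that H p
        is at most a constant times p.\<close>
      define Q where "Q = L * (\<Sum>j=1..c. K j) + 1"
      have Q: "Q > 0"
        unfolding Q_def using L K by (intro add_nonneg_pos mult_nonneg_nonneg sum_nonneg) (auto intro: less_imp_le)
      have HQ: "H p \<le> Q * p" if p: "p \<in> S" for p
      proof -
        obtain i where i: "i \<ge> 1" "ap_prime b i = p" using ap_prime_surj[OF b0] p by (auto simp: S_def)
        have "F j p \<le> K j * p" if "j \<in> {1..c}" for j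
          using bspec[OF K that] i by (auto simp: F_def less_eq_complex_def)
        then have "(\<Sum>j=1..c. F j p) \<le> (\<Sum>j=1..c. K j * p)" by (intro sum_mono)
        then have "L * (\<Sum>j=1..c. F j p) \<le> L * (\<Sum>j=1..c. K j * p)" using L by (intro mult_left_mono) auto
        then have "H p \<le> L * (\<Sum>j=1..c. K j) * p" using H(3)[OF p] by (simp add: sum_distrib_right mult.assoc)
        then show ?thesis by (simp add: Q_def ring_distribs)
      qed
      obtain N where N: "(\<Sum>p | p \<le> N \<and> prime p \<and> [p = 1] (mod b). 1 / real p) > Q * B"
        using prime_reciprocals_unbounded[OF b0, of "Q * B"] by (auto simp: not_le)
      let ?T = "{p. p \<le> N \<and> prime p \<and> [p = 1] (mod b)}"
      have "Q * B / Q \<le> (\<Sum>p\<in>?T. 1 / real p) / Q" using N Q by (intro divide_right_mono) auto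
      also have "\<dots> = (\<Sum>p\<in>?T. 1 / (Q * real p))" by (simp add: sum_divide_distrib mult.commute)
      also have "\<dots> \<le> (\<Sum>p\<in>?T. 1 / H p)"
      proof (rule sum_mono)
        fix p assume "p \<in> ?T"
        then have "p \<in> S" by (simp add: S_def)
        from H(2)[OF this] HQ[OF this] show "1 / (Q * real p) \<le> 1 / H p"
          by (intro frac_le) linarith+
      qed
      finally have "B \<le> (\<Sum>p\<in>?T. 1 / H p)" using Q by simp
      then show "\<exists>T. finite T \<and> T \<subseteq> S \<and> B \<le> (\<Sum>p\<in>T. 1 / H p)"
        by (intro exI[of _ ?T]) (auto simp: S_def)
    qed
    show ?thesis using part1 part2 part3 by blast
  qed
qed

end
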